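(* Let $A$ be any one of the following structures: (i) a unital algebra over a field $k$; (ii) a unital $k$-algebra equipped with a linear functional $\tau:A\to k$; (iii) a complex unital $*$-algebra; (iv) a complex unital $*$-algebra equipped with a linear functional $\tau:A\to\mathbb{C}$; or any of these enriched with a fixed unital subalgebra $A'\subseteq A$ (a $*$-subalgebra in cases (iii) and (iv)). Then there is a universal Hopf algebra (Hopf $*$-algebra in cases (iii) and (iv)) measuring the structure: a Hopf ($*$-)algebra $H$ with a structure-preserving action $H\otimes A\to A$ such that for every Hopf ($*$-)algebra $H'$ with a structure-preserving action on $A$ there is a unique Hopf ($*$-)algebra morphism $\psi:H'\to H$ with $h'\cdot a=\psi(h')\cdot a$ for all $h'\in H'$, $a\in A$.
   Context: A Hopf $*$-algebra is a complex Hopf algebra $H$ (with $\Delta h=h_1\otimes h_2$, counit $\varepsilon$, antipode $S$) that is a $*$-algebra such that $\Delta$ is a $*$-algebra morphism and $h\mapsto S(h)^*$ is an involution. An action of a Hopf algebra $H$ on $A$ is structure-preserving if it is a left module structure with: $h\cdot(ab)=(h_1\cdot a)(h_2\cdot b)$ and $h\cdot1=\varepsilon(h)1$ (so $A$ is an $H$-module algebra); if a functional $\tau$ is part of the structure, $\tau(h\cdot a)=\varepsilon(h)\tau(a)$; if $A$ is a $*$-algebra (and $H$ a Hopf $*$-algebra), $(h\cdot a)^*=S(h)^*\cdot a^*$; and if a subalgebra $A'\subseteq A$ is part of the structure, $h\cdot a=\varepsilon(h)a$ for all $a\in A'$. *)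

theory Defs
  imports Complex_Main "HOL-Library.Poly_Mapping" "HOL-Library.FuncSet"
    "HOL-Library.Function_Algebras"
begin

section \<open>Tensor powers of a vector space\<close>

text \<open>
  Let \<open>V\<close> be a subspace of a vector space with scalar multiplication \<open>s\<close>.  An element of the
  \<open>n\<close>-fold tensor power of \<open>V\<close> is represented by a formal sum of words of length \<open>n\<close> over \<open>V\<close>,
  given as a list of words: \<open>[[x, y], [x', y']]\<close> stands for the tensor \<open>x \<otimes> y + x' \<otimes> y'\<close>.
  Two such sums represent the same tensor iff their difference in the free vector space on all
  words lies in the span of the multilinearity relations.  (These relations are homogeneous in the
  word length, so all tensor powers can be treated at once.)
\<close>

abbreviation free_scale :: "'k::field \<Rightarrow> ('w \<Rightarrow>\<^sub>0 'k) \<Rightarrow> ('w \<Rightarrow>\<^sub>0 'k)"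
  where "free_scale c \<equiv> Poly_Mapping.map ((*) c)"

lemma vector_space_free_scale: "vector_space (free_scale :: 'k::field \<Rightarrow> ('w \<Rightarrow>\<^sub>0 'k) \<Rightarrow> _)"
proof -
  have lk: "Poly_Mapping.lookup (free_scale c p) w = c * Poly_Mapping.lookup p w"
    for c :: 'k and p and w :: 'w
    by transfer (simp add: when_def)
  show ?thesis
    by unfold_locales
      (auto intro!: poly_mapping_eqI simp: lk Poly_Mapping.lookup_add algebra_simps)
qed

definition formal_sum :: "'v list list \<Rightarrow> ('v list \<Rightarrow>\<^sub>0 'k::field)"
  where "formal_sum ws = (\<Sum>w\<leftarrow>ws. Poly_Mapping.single w 1)"

definition tensor_relations ::
    "('k::field \<Rightarrow> 'v::ab_group_add \<Rightarrow> 'v) \<Rightarrow> 'v set \<Rightarrow> ('v list \<Rightarrow>\<^sub>0 'k) set"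
  where
    "tensor_relations s V =
      {Poly_Mapping.single (u @ [x + y] @ v) 1
         - Poly_Mapping.single (u @ [x] @ v) 1 - Poly_Mapping.single (u @ [y] @ v) 1
       | u v x y. set u \<subseteq> V \<and> set v \<subseteq> V \<and> x \<in> V \<and> y \<in> V} \<union>
      {Poly_Mapping.single (u @ [s c x] @ v) 1 - Poly_Mapping.single (u @ [x] @ v) c
       | u v x c. set u \<subseteq> V \<and> set v \<subseteq> V \<and> x \<in> V}"

definition tensor_eq ::
    "('k::field \<Rightarrow> 'v::ab_group_add \<Rightarrow> 'v) \<Rightarrow> 'v set \<Rightarrow> 'v list list \<Rightarrow> 'v list list \<Rightarrow> bool"
  where
    "tensor_eq s V ws ws' \<longleftrightarrow>
      formal_sum ws - formal_sum ws' \<in> module.span free_scale (tensor_relations s V)"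

section \<open>Hopf algebras and Hopf *-algebras\<close>

text \<open>
  The underlying vector space of a Hopf algebra is a subspace \<open>carrier\<close> of an ambient vector space;
  all operations matter on \<open>carrier\<close> only.  The comultiplication of \<open>h\<close> is given by a Sweedler
  representative \<open>comul H h = [(x\<^sub>1, y\<^sub>1), \<dots>, (x\<^sub>n, y\<^sub>n)]\<close> of the tensor
  \<open>\<Delta> h = x\<^sub>1 \<otimes> y\<^sub>1 + \<dots> + x\<^sub>n \<otimes> y\<^sub>n\<close>; only the tensor, not the representative, is
  meaningful.
\<close>

record ('k, 'h) hopf =
  carrier :: "'h set"
  smul :: "'k \<Rightarrow> 'h \<Rightarrow> 'h"
  mul :: "'h \<Rightarrow> 'h \<Rightarrow> 'h"  (infixl \<open>\<odot>\<index>\<close> 70)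
  unity :: "'h"  (\<open>\<one>\<index>\<close>)
  comul :: "'h \<Rightarrow> ('h \<times> 'h) list"
  counit :: "'h \<Rightarrow> 'k"
  antipode :: "'h \<Rightarrow> 'h"

record 'h star_hopf = "(complex, 'h) hopf" +
  invol :: "'h \<Rightarrow> 'h"

locale hopf_algebra =
  fixes H :: "('k::field, 'h::ab_group_add, 'm) hopf_scheme" (structure)
  assumes vector_space: "vector_space (smul H)"
    and subspace: "module.subspace (smul H) (carrier H)"
    \<comment> \<open>unital associative algebra\<close>
    and mul_closed: "\<lbrakk>x \<in> carrier H; y \<in> carrier H\<rbrakk> \<Longrightarrow> x \<odot> y \<in> carrier H"
    and mul_assoc: "\<lbrakk>x \<in> carrier H; y \<in> carrier H; z \<in> carrier H\<rbrakk>
          \<Longrightarrow> (x \<odot> y) \<odot> z = x \<odot> (y \<odot> z)"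
    and mul_add_left: "\<lbrakk>x \<in> carrier H; y \<in> carrier H; z \<in> carrier H\<rbrakk>
          \<Longrightarrow> (x + y) \<odot> z = x \<odot> z + y \<odot> z"
    and mul_add_right: "\<lbrakk>x \<in> carrier H; y \<in> carrier H; z \<in> carrier H\<rbrakk>
          \<Longrightarrow> x \<odot> (y + z) = x \<odot> y + x \<odot> z"
    and mul_smul_left: "\<lbrakk>x \<in> carrier H; y \<in> carrier H\<rbrakk> \<Longrightarrow> smul H c x \<odot> y = smul H c (x \<odot> y)"
    and mul_smul_right: "\<lbrakk>x \<in> carrier H; y \<in> carrier H\<rbrakk> \<Longrightarrow> x \<odot> smul H c y = smul H c (x \<odot> y)"
    and unity_closed: "\<one> \<in> carrier H"
    and mul_unity_left: "x \<in> carrier H \<Longrightarrow> \<one> \<odot> x = x"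
    and mul_unity_right: "x \<in> carrier H \<Longrightarrow> x \<odot> \<one> = x"
    \<comment> \<open>coassociative counital coalgebra\<close>
    and comul_closed: "h \<in> carrier H \<Longrightarrow> set (comul H h) \<subseteq> carrier H \<times> carrier H"
    and comul_add: "\<lbrakk>g \<in> carrier H; h \<in> carrier H\<rbrakk> \<Longrightarrow>
          tensor_eq (smul H) (carrier H)
            [[x, y]. (x, y) \<leftarrow> comul H (g + h)]
            ([[x, y]. (x, y) \<leftarrow> comul H g] @ [[x, y]. (x, y) \<leftarrow> comul H h])"
    and comul_smul: "h \<in> carrier H \<Longrightarrow>
          tensor_eq (smul H) (carrier H)
            [[x, y]. (x, y) \<leftarrow> comul H (smul H c h)]
            [[smul H c x, y]. (x, y) \<leftarrow> comul H h]"
    and counit_add: "\<lbrakk>g \<in> carrier H; h \<in> carrier H\<rbrakk> \<Longrightarrow> counit H (g + h) = counit H g + counit H h"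
    and counit_smul: "h \<in> carrier H \<Longrightarrow> counit H (smul H c h) = c * counit H h"
    and coassoc: "h \<in> carrier H \<Longrightarrow>
          tensor_eq (smul H) (carrier H)
            [[u, v, y]. (x, y) \<leftarrow> comul H h, (u, v) \<leftarrow> comul H x]
            [[x, u, v]. (x, y) \<leftarrow> comul H h, (u, v) \<leftarrow> comul H y]"
    and counit_left: "h \<in> carrier H \<Longrightarrow> (\<Sum>(x, y)\<leftarrow>comul H h. smul H (counit H x) y) = h"
    and counit_right: "h \<in> carrier H \<Longrightarrow> (\<Sum>(x, y)\<leftarrow>comul H h. smul H (counit H y) x) = h"
    \<comment> \<open>comultiplication and counit are morphisms of unital algebras\<close>
    and comul_mul: "\<lbrakk>g \<in> carrier H; h \<in> carrier H\<rbrakk> \<Longrightarrow>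
          tensor_eq (smul H) (carrier H)
            [[x, y]. (x, y) \<leftarrow> comul H (g \<odot> h)]
            [[x \<odot> x', y \<odot> y']. (x, y) \<leftarrow> comul H g, (x', y') \<leftarrow> comul H h]"
    and comul_unity: "tensor_eq (smul H) (carrier H) [[x, y]. (x, y) \<leftarrow> comul H \<one>] [[\<one>, \<one>]]"
    and counit_mul: "\<lbrakk>g \<in> carrier H; h \<in> carrier H\<rbrakk> \<Longrightarrow> counit H (g \<odot> h) = counit H g * counit H h"
    and counit_unity: "counit H \<one> = 1"
    \<comment> \<open>antipode\<close>
    and antipode_closed: "h \<in> carrier H \<Longrightarrow> antipode H h \<in> carrier H"
    and antipode_add: "\<lbrakk>g \<in> carrier H; h \<in> carrier H\<rbrakk>
          \<Longrightarrow> antipode H (g + h) = antipode H g + antipode H h"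
    and antipode_smul: "h \<in> carrier H \<Longrightarrow> antipode H (smul H c h) = smul H c (antipode H h)"
    and antipode_left: "h \<in> carrier H \<Longrightarrow>
          (\<Sum>(x, y)\<leftarrow>comul H h. antipode H x \<odot> y) = smul H (counit H h) \<one>"
    and antipode_right: "h \<in> carrier H \<Longrightarrow>
          (\<Sum>(x, y)\<leftarrow>comul H h. x \<odot> antipode H y) = smul H (counit H h) \<one>"

locale hopf_star_algebra = hopf_algebra H
  for H :: "('h::ab_group_add, 'm) star_hopf_scheme" (structure) +
  assumes invol_closed: "h \<in> carrier H \<Longrightarrow> invol H h \<in> carrier H"
    and invol_add: "\<lbrakk>g \<in> carrier H; h \<in> carrier H\<rbrakk> \<Longrightarrow> invol H (g + h) = invol H g + invol H h"
    and invol_smul: "h \<in> carrier H \<Longrightarrow> invol H (smul H c h) = smul H (cnj c) (invol H h)"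
    and invol_mul: "\<lbrakk>g \<in> carrier H; h \<in> carrier H\<rbrakk> \<Longrightarrow> invol H (g \<odot> h) = invol H h \<odot> invol H g"
    and invol_invol: "h \<in> carrier H \<Longrightarrow> invol H (invol H h) = h"
    and comul_invol: "h \<in> carrier H \<Longrightarrow>
          tensor_eq (smul H) (carrier H)
            [[x, y]. (x, y) \<leftarrow> comul H (invol H h)]
            [[invol H x, invol H y]. (x, y) \<leftarrow> comul H h]"
    and antipode_invol_involutive:
      "h \<in> carrier H \<Longrightarrow> invol H (antipode H (invol H (antipode H h))) = h"

locale hopf_morphism =
  fixes H :: "('k::field, 'h::ab_group_add, 'm) hopf_scheme"
    and K :: "('k, 'g::ab_group_add, 'n) hopf_scheme"
    and \<psi> :: "'h \<Rightarrow> 'g"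
  assumes map_closed: "h \<in> carrier H \<Longrightarrow> \<psi> h \<in> carrier K"
    and map_add: "\<lbrakk>g \<in> carrier H; h \<in> carrier H\<rbrakk> \<Longrightarrow> \<psi> (g + h) = \<psi> g + \<psi> h"
    and map_smul: "h \<in> carrier H \<Longrightarrow> \<psi> (smul H c h) = smul K c (\<psi> h)"
    and map_mul: "\<lbrakk>g \<in> carrier H; h \<in> carrier H\<rbrakk> \<Longrightarrow> \<psi> (g \<odot>\<^bsub>H\<^esub> h) = \<psi> g \<odot>\<^bsub>K\<^esub> \<psi> h"
    and map_unity: "\<psi> \<one>\<^bsub>H\<^esub> = \<one>\<^bsub>K\<^esub>"
    and map_comul: "h \<in> carrier H \<Longrightarrow>
          tensor_eq (smul K) (carrier K)
            [[x, y]. (x, y) \<leftarrow> comul K (\<psi> h)]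
            [[\<psi> x, \<psi> y]. (x, y) \<leftarrow> comul H h]"
    and map_counit: "h \<in> carrier H \<Longrightarrow> counit K (\<psi> h) = counit H h"
    and map_antipode: "h \<in> carrier H \<Longrightarrow> \<psi> (antipode H h) = antipode K (\<psi> h)"

locale hopf_star_morphism = hopf_morphism H K \<psi>
  for H :: "('h::ab_group_add, 'm) star_hopf_scheme"
    and K :: "('g::ab_group_add, 'n) star_hopf_scheme"
    and \<psi> :: "'h \<Rightarrow> 'g" +
  assumes map_invol: "h \<in> carrier H \<Longrightarrow> \<psi> (invol H h) = invol K (\<psi> h)"

section \<open>The structures acted upon\<close>

text \<open>
  The sort \<open>{ring, monoid_mult}\<close> is used instead of \<open>ring_1\<close> because the latter excludes the zero
  algebra.  The optional data are the functional \<open>\<tau>\<close> and the distinguished subalgebra \<open>A'\<close>.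
\<close>

locale unital_algebra = vector_space scale
  for scale :: "'k::field \<Rightarrow> 'a::{ring, monoid_mult} \<Rightarrow> 'a" +
  assumes scale_mult_left: "scale c a * b = scale c (a * b)"
    and scale_mult_right: "a * scale c b = scale c (a * b)"

locale algebra_structure = unital_algebra scale
  for scale :: "'k::field \<Rightarrow> 'a::{ring, monoid_mult} \<Rightarrow> 'a" +
  fixes \<tau> :: "('a \<Rightarrow> 'k) option" and A' :: "'a set option"
  assumes functional_linear: "\<tau> = Some t \<Longrightarrow> Vector_Spaces.linear scale (*) t"
    and subalgebra_subspace: "A' = Some B \<Longrightarrow> subspace B"
    and subalgebra_one: "A' = Some B \<Longrightarrow> 1 \<in> B"
    and subalgebra_mult: "\<lbrakk>A' = Some B; a \<in> B; b \<in> B\<rbrakk> \<Longrightarrow> a * b \<in> B"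

locale star_algebra_structure = algebra_structure scale \<tau> A'
  for scale :: "complex \<Rightarrow> 'a::{ring, monoid_mult} \<Rightarrow> 'a"
    and \<tau> :: "('a \<Rightarrow> complex) option" and A' :: "'a set option" +
  fixes star :: "'a \<Rightarrow> 'a"
  assumes star_add: "star (a + b) = star a + star b"
    and star_scale: "star (scale c a) = scale (cnj c) (star a)"
    and star_mult: "star (a * b) = star b * star a"
    and star_star: "star (star a) = a"
    and subalgebra_star: "\<lbrakk>A' = Some B; a \<in> B\<rbrakk> \<Longrightarrow> star a \<in> B"

section \<open>Structure-preserving actions and universality\<close>

locale hopf_action =
  fixes scale :: "'k::field \<Rightarrow> 'a::{ring, monoid_mult} \<Rightarrow> 'a"
    and \<tau> :: "('a \<Rightarrow> 'k) option" and A' :: "'a set option"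
    and H :: "('k, 'h::ab_group_add, 'm) hopf_scheme" (structure)
    and act :: "'h \<Rightarrow> 'a \<Rightarrow> 'a"
  assumes act_add_left: "\<lbrakk>g \<in> carrier H; h \<in> carrier H\<rbrakk> \<Longrightarrow> act (g + h) a = act g a + act h a"
    and act_smul_left: "h \<in> carrier H \<Longrightarrow> act (smul H c h) a = scale c (act h a)"
    and act_add_right: "h \<in> carrier H \<Longrightarrow> act h (a + b) = act h a + act h b"
    and act_scale_right: "h \<in> carrier H \<Longrightarrow> act h (scale c a) = scale c (act h a)"
    and act_unity: "act \<one> a = a"
    and act_mul: "\<lbrakk>g \<in> carrier H; h \<in> carrier H\<rbrakk> \<Longrightarrow> act (g \<odot> h) a = act g (act h a)"
    and act_mult: "h \<in> carrier H \<Longrightarrow> act h (a * b) = (\<Sum>(x, y)\<leftarrow>comul H h. act x a * act y b)"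
    and act_one: "h \<in> carrier H \<Longrightarrow> act h 1 = scale (counit H h) 1"
    and act_functional: "\<lbrakk>\<tau> = Some t; h \<in> carrier H\<rbrakk> \<Longrightarrow> t (act h a) = counit H h * t a"
    and act_subalgebra: "\<lbrakk>A' = Some B; h \<in> carrier H; a \<in> B\<rbrakk> \<Longrightarrow> act h a = scale (counit H h) a"

locale hopf_star_action = hopf_action scale \<tau> A' H act
  for scale :: "complex \<Rightarrow> 'a::{ring, monoid_mult} \<Rightarrow> 'a"
    and \<tau> :: "('a \<Rightarrow> complex) option" and A' :: "'a set option"
    and star :: "'a \<Rightarrow> 'a"
    and H :: "('h::ab_group_add, 'm) star_hopf_scheme" (structure)
    and act :: "'h \<Rightarrow> 'a \<Rightarrow> 'a" +
  assumes act_star: "h \<in> carrier H \<Longrightarrow> star (act h a) = act (invol H (antipode H h)) (star a)"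

text \<open>
  The universal property, tested against all Hopf (*-)algebras whose carrier lies in the type \<open>'t\<close>.
  Morphisms are taken to be \<open>undefined\<close> outside the carrier, so that \<open>\<exists>!\<close> means uniqueness on
  the carrier.
\<close>

definition universal_hopf_algebra ::
    "'t::ab_group_add itself \<Rightarrow> ('k::field \<Rightarrow> 'a::{ring, monoid_mult} \<Rightarrow> 'a) \<Rightarrow> ('a \<Rightarrow> 'k) option
      \<Rightarrow> 'a set option \<Rightarrow> ('k, 'h::ab_group_add) hopf \<Rightarrow> ('h \<Rightarrow> 'a \<Rightarrow> 'a) \<Rightarrow> bool"
  where
    "universal_hopf_algebra _ scale \<tau> A' H act \<longleftrightarrow>
      hopf_algebra H \<and> hopf_action scale \<tau> A' H act \<and>
      (\<forall>(H' :: ('k, 't) hopf) act'. hopf_algebra H' \<and> hopf_action scale \<tau> A' H' act' \<longrightarrow>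
        (\<exists>!\<psi>. \<psi> \<in> extensional (carrier H') \<and> hopf_morphism H' H \<psi> \<and>
              (\<forall>h\<in>carrier H'. \<forall>a. act' h a = act (\<psi> h) a)))"

definition universal_hopf_star_algebra ::
    "'t::ab_group_add itself \<Rightarrow> (complex \<Rightarrow> 'a::{ring, monoid_mult} \<Rightarrow> 'a) \<Rightarrow> ('a \<Rightarrow> complex) option
      \<Rightarrow> 'a set option \<Rightarrow> ('a \<Rightarrow> 'a) \<Rightarrow> 'h::ab_group_add star_hopf \<Rightarrow> ('h \<Rightarrow> 'a \<Rightarrow> 'a) \<Rightarrow> bool"
  where
    "universal_hopf_star_algebra _ scale \<tau> A' star H act \<longleftrightarrow>
      hopf_star_algebra H \<and> hopf_star_action scale \<tau> A' star H act \<and>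
      (\<forall>(H' :: 't star_hopf) act'. hopf_star_algebra H' \<and> hopf_star_action scale \<tau> A' star H' act' \<longrightarrow>
        (\<exists>!\<psi>. \<psi> \<in> extensional (carrier H') \<and> hopf_star_morphism H' H \<psi> \<and>
              (\<forall>h\<in>carrier H'. \<forall>a. act' h a = act (\<psi> h) a)))"

text \<open>
  A type with room for the universal Hopf algebra: an element \<open>h\<close> is determined by the coordinates
  of the tensors \<open>S\<^bsup>i\<^esup>(h\<^sub>1) \<cdot> a \<otimes> \<dots> \<otimes> S\<^bsup>j\<^esup>(h\<^sub>n) \<cdot> b\<close> with respect to a basis of the
  algebra (with negative powers of the antipode, which is bijective, for Hopf *-algebras).  Since \<open>\<exists>\<close> cannot range over types, and a type variable for the test objects is
  quantified outside the whole statement, existence of a universal object that does not depend on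
  the type of the test objects is expressed in two parts: there is an object in this type that is
  universal for test objects in this type, and every such object is universal for test objects in
  an arbitrary type.
\<close>

type_synonym ('a, 'k) hopf_space = "(int \<times> 'a \<times> 'a) list \<Rightarrow> 'k"

end

theory Submission
  imports Defs
begin

text \<open>
  An element \<open>h\<close> of a Hopf algebra acting on \<open>A\<close> is determined, up to a Hopf ideal that acts
  trivially, by the function that sends a word \<open>(i\<^sub>1, a\<^sub>1, b\<^sub>1) \<dots> (i\<^sub>n, a\<^sub>n, b\<^sub>n)\<close> to the product
  over \<open>j\<close> of the \<open>b\<^sub>j\<close>-coordinates of \<open>S\<^bsup>i\<^sub>j\<^esup>(h\<^sub>j) \<cdot> a\<^sub>j\<close>, where \<open>h\<^sub>1 \<otimes> \<dots> \<otimes> h\<^sub>n\<close> is the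
  iterated coproduct of \<open>h\<close> and the \<open>b\<^sub>j\<close> run through a basis of \<open>A\<close>.  The universal Hopf algebra
  consists of all functions on words that can possibly arise in this way.  All of its structure can be
  read off from the words: \<open>\<Delta> \<phi>\<close> is \<open>(u, v) \<mapsto> \<phi> (u v)\<close>, the counit is the value at the empty word,
  the antipode reverses a word and raises every \<open>i\<^sub>j\<close> by one, and \<open>\<phi> \<cdot> a\<close> has the coordinates
  \<open>\<phi> (0, a, b)\<close>.

  To say which functions can arise, recall that every element of a coalgebra is a linear combination of
  entries of a comatrix, a finite matrix with \<open>\<Delta> c\<^sub>p\<^sub>q = \<Sum>r. c\<^sub>p\<^sub>r \<otimes> c\<^sub>r\<^sub>q\<close> and \<open>\<epsilon> c\<^sub>p\<^sub>q = \<delta>\<^sub>p\<^sub>q\<close>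
  (\<open>comatrix_spanning\<close>).  Only the operators \<open>R\<^sub>i\<^sub>p\<^sub>q\<close> by which \<open>S\<^bsup>i\<^esup>(c\<^sub>p\<^sub>q)\<close> acts on \<open>A\<close> enter the functions
  above, and the axioms of an action become conditions on these matrices of operators: \<open>R\<^sub>0\<close> is
  multiplicative as a map from \<open>A\<close> to the matrices over \<open>A\<close>, preserves the given functionals and fixes
  the given elements, and \<open>R\<^sub>i\<close> and \<open>R\<^sub>i\<^sub>+\<^sub>1\<close> are inverse matrices, with products of operators reversed
  for odd \<open>i\<close>.  Any family of operators with these properties is admitted (\<open>coeff_system\<close>), and the
  universal Hopf algebra is the span of the functions that arise from such families.  Tensor products,
  shifted transposes and (in the presence of involutions) conjugates of families are again admissible,
  which gives multiplication, antipode and involution.  For the antipode, this rests on the fact that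
  the inverse of a multiplicative matrix of operators is multiplicative in the opposite order
  (\<open>inverse_matrix_mult\<close>).

  The map from an acting Hopf algebra to functions on words is a morphism, essentially by construction;
  it preserves the antipode because inverses are unique (\<open>bialgebra_morphism_antipode\<close>).  It is the only
  morphism, because a function on words is recovered from its coproduct and its values on single
  letters, and the latter are coordinates of the action of powers of the antipode.

  Equality of tensors, which is defined by generators and relations, is made accessible by the fact
  that products of functionals separate tensors (\<open>tensor_eqI\<close>); on functions on words the
  evaluations suffice, so that coassociativity and the like are identities between numbers.
  Powers of the antipode are indexed by \<open>i \<ge> 0\<close> for Hopf algebras and by all integers for Hopf
  \<open>*\<close>-algebras, where the antipode is bijective with inverse \<open>h \<mapsto> S(h\<^sup>*)\<^sup>*\<close>.

  Finally, terminal objects are unique up to isomorphism, so the universal property against objects in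
  every type passes from the Hopf algebra of functions on words to any other one that is
  universal against objects in the same type (\<open>terminal_transport\<close>).
\<close>

section \<open>Tensors and multilinear maps\<close>

text \<open>
  A Hopf algebra occupies a subspace of its type and its operations are arbitrary elsewhere; so maps can
  only be linear on a subspace \<open>V\<close>.
\<close>
definition linear_on ::
    "('k::field \<Rightarrow> 'v::ab_group_add \<Rightarrow> 'v) \<Rightarrow> 'v set \<Rightarrow> ('k \<Rightarrow> 'w::ab_group_add \<Rightarrow> 'w) \<Rightarrow> ('v \<Rightarrow> 'w) \<Rightarrow> bool"
  where "linear_on s V s' f \<longleftrightarrow>
    (\<forall>x\<in>V. \<forall>y\<in>V. f (x + y) = f x + f y) \<and> (\<forall>c. \<forall>x\<in>V. f (s c x) = s' c (f x))"

definition bilinear_on ::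
    "('k::field \<Rightarrow> 'v::ab_group_add \<Rightarrow> 'v) \<Rightarrow> 'v set \<Rightarrow> ('k \<Rightarrow> 'w::ab_group_add \<Rightarrow> 'w) \<Rightarrow> ('v \<Rightarrow> 'v \<Rightarrow> 'w) \<Rightarrow> bool"
  where "bilinear_on s V s' B \<longleftrightarrow>
    (\<forall>x\<in>V. linear_on s V s' (B x)) \<and> (\<forall>y\<in>V. linear_on s V s' (\<lambda>x. B x y))"

definition trilinear_on ::
    "('k::field \<Rightarrow> 'v::ab_group_add \<Rightarrow> 'v) \<Rightarrow> 'v set \<Rightarrow> ('k \<Rightarrow> 'w::ab_group_add \<Rightarrow> 'w)
      \<Rightarrow> ('v \<Rightarrow> 'v \<Rightarrow> 'v \<Rightarrow> 'w) \<Rightarrow> bool"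
  where "trilinear_on s V s' B \<longleftrightarrow>
    (\<forall>x\<in>V. bilinear_on s V s' (B x)) \<and> (\<forall>y\<in>V. \<forall>z\<in>V. linear_on s V s' (\<lambda>x. B x y z))"

lemma linear_onI:
  assumes "\<And>x y. x \<in> V \<Longrightarrow> y \<in> V \<Longrightarrow> f (x + y) = f x + f y"
    and "\<And>c x. x \<in> V \<Longrightarrow> f (s c x) = s' c (f x)"
  shows "linear_on s V s' f"
  using assms by (auto simp: linear_on_def)

lemma linear_onD:
  assumes "linear_on s V s' f"
  shows "x \<in> V \<Longrightarrow> y \<in> V \<Longrightarrow> f (x + y) = f x + f y"
    and "x \<in> V \<Longrightarrow> f (s c x) = s' c (f x)"
  using assms by (auto simp: linear_on_def)

lemma bilinear_onI:
  assumes "\<And>x y y'. x \<in> V \<Longrightarrow> y \<in> V \<Longrightarrow> y' \<in> V \<Longrightarrow> B x (y + y') = B x y + B x y'"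
    and "\<And>c x y. x \<in> V \<Longrightarrow> y \<in> V \<Longrightarrow> B x (s c y) = s' c (B x y)"
    and "\<And>x x' y. x \<in> V \<Longrightarrow> x' \<in> V \<Longrightarrow> y \<in> V \<Longrightarrow> B (x + x') y = B x y + B x' y"
    and "\<And>c x y. x \<in> V \<Longrightarrow> y \<in> V \<Longrightarrow> B (s c x) y = s' c (B x y)"
  shows "bilinear_on s V s' B"
  using assms by (auto simp: bilinear_on_def linear_on_def)

lemma bilinear_onD:
  assumes "bilinear_on s V s' B"
  shows "x \<in> V \<Longrightarrow> y \<in> V \<Longrightarrow> y' \<in> V \<Longrightarrow> B x (y + y') = B x y + B x y'"
    and "x \<in> V \<Longrightarrow> y \<in> V \<Longrightarrow> B x (s c y) = s' c (B x y)"
    and "x \<in> V \<Longrightarrow> x' \<in> V \<Longrightarrow> y \<in> V \<Longrightarrow> B (x + x') y = B x y + B x' y"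
    and "x \<in> V \<Longrightarrow> y \<in> V \<Longrightarrow> B (s c x) y = s' c (B x y)"
  using assms by (auto simp: bilinear_on_def linear_on_def)

lemma trilinear_onI:
  assumes "\<And>x. x \<in> V \<Longrightarrow> bilinear_on s V s' (B x)"
    and "\<And>x x' y z. x \<in> V \<Longrightarrow> x' \<in> V \<Longrightarrow> y \<in> V \<Longrightarrow> z \<in> V \<Longrightarrow> B (x + x') y z = B x y z + B x' y z"
    and "\<And>c x y z. x \<in> V \<Longrightarrow> y \<in> V \<Longrightarrow> z \<in> V \<Longrightarrow> B (s c x) y z = s' c (B x y z)"
  shows "trilinear_on s V s' B"
  using assms by (auto simp: trilinear_on_def linear_on_def)

lemma trilinear_onD:
  assumes "trilinear_on s V s' B"
  shows "x \<in> V \<Longrightarrow> bilinear_on s V s' (B x)"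
    and "x \<in> V \<Longrightarrow> x' \<in> V \<Longrightarrow> y \<in> V \<Longrightarrow> z \<in> V \<Longrightarrow> B (x + x') y z = B x y z + B x' y z"
    and "x \<in> V \<Longrightarrow> y \<in> V \<Longrightarrow> z \<in> V \<Longrightarrow> B (s c x) y z = s' c (B x y z)"
  using assms by (auto simp: trilinear_on_def linear_on_def)

lemma bilinear_on_product:
  fixes f g :: "'v::ab_group_add \<Rightarrow> 'k::field"
  assumes "linear_on s V (*) f" "linear_on s V (*) g"
  shows "bilinear_on s V (*) (\<lambda>x y. f x * g y)"
  by (rule bilinear_onI) (simp_all add: linear_onD[OF assms(1)] linear_onD[OF assms(2)] algebra_simps)

lemma bilinear_on_add:
  fixes B B' :: "'v::ab_group_add \<Rightarrow> 'v \<Rightarrow> 'k::field"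
  assumes "bilinear_on s V (*) B" "bilinear_on s V (*) B'"
  shows "bilinear_on s V (*) (\<lambda>x y. B x y + B' x y)"
  by (rule bilinear_onI) (simp_all add: bilinear_onD[OF assms(1)] bilinear_onD[OF assms(2)] algebra_simps)

lemma bilinear_on_sum_list:
  fixes B :: "'i \<Rightarrow> 'v::ab_group_add \<Rightarrow> 'v \<Rightarrow> 'k::field"
  shows "(\<And>z. z \<in> set L \<Longrightarrow> bilinear_on s V (*) (B z)) \<Longrightarrow> bilinear_on s V (*) (\<lambda>x y. \<Sum>z\<leftarrow>L. B z x y)"
  by (induction L) (auto intro: bilinear_on_add bilinear_onI)

lemma bilinear_on_sum:
  fixes B :: "'i \<Rightarrow> 'v::ab_group_add \<Rightarrow> 'v \<Rightarrow> 'k::field"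
  shows "(\<And>z. z \<in> S \<Longrightarrow> bilinear_on s V (*) (B z)) \<Longrightarrow> bilinear_on s V (*) (\<lambda>x y. \<Sum>z\<in>S. B z x y)"
  by (induction S rule: infinite_finite_induct) (auto intro: bilinear_on_add bilinear_onI)

lemma lookup_free_scale [simp]:
  "Poly_Mapping.lookup (free_scale c p) w = c * Poly_Mapping.lookup p w"
  for c :: "'k::field"
  by transfer (simp add: when_def)

lemma vector_space_field: "vector_space ((*) :: 'k::field \<Rightarrow> 'k \<Rightarrow> 'k)"
  by unfold_locales (auto simp: algebra_simps)

lemma subspace_field_UNIV: "module.subspace ((*) :: 'k::field \<Rightarrow> 'k \<Rightarrow> 'k) UNIV"
proof -
  interpret vector_space "(*) :: 'k \<Rightarrow> 'k \<Rightarrow> 'k" by (rule vector_space_field)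
  show ?thesis by (rule subspace_UNIV)
qed

definition free_extension ::
    "('k::field \<Rightarrow> 'w::ab_group_add \<Rightarrow> 'w) \<Rightarrow> ('u \<Rightarrow> 'w) \<Rightarrow> ('u \<Rightarrow>\<^sub>0 'k) \<Rightarrow> 'w"
  where "free_extension s F p =
    (\<Sum>w\<in>Poly_Mapping.keys p. s (Poly_Mapping.lookup p w) (F w))"

context vector_space
begin

lemma free_extension_superset:
  assumes "finite S" "Poly_Mapping.keys p \<subseteq> S"
  shows "free_extension scale F p = (\<Sum>w\<in>S. scale (Poly_Mapping.lookup p w) (F w))"
  unfolding free_extension_def
  by (rule sum.mono_neutral_left) (use assms in \<open>auto simp: in_keys_iff\<close>)

lemma free_extension_add:
  "free_extension scale F (p + q) = free_extension scale F p + free_extension scale F q"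
proof -
  let ?S = "Poly_Mapping.keys p \<union> Poly_Mapping.keys q"
  have fin: "finite ?S" by simp
  have "Poly_Mapping.keys (p + q) \<subseteq> ?S" by (rule Poly_Mapping.keys_add)
  then show ?thesis
    by (simp add: free_extension_superset[OF fin] lookup_add scale_left_distrib sum.distrib)
qed

lemma free_extension_scale:
  "free_extension scale F (free_scale c p) = scale c (free_extension scale F p)"
proof -
  have "Poly_Mapping.keys (free_scale c p) \<subseteq> Poly_Mapping.keys p"
    by (auto simp: in_keys_iff)
  then show ?thesis
    by (simp add: free_extension_superset[of "Poly_Mapping.keys p"] scale_sum_right)
qed

lemma free_extension_hom: "module_hom free_scale scale (free_extension scale F)"
proof -
  interpret F: vector_space "free_scale :: 'a \<Rightarrow> _" by (rule vector_space_free_scale)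
  show ?thesis
    by unfold_locales (simp_all add: free_extension_add free_extension_scale)
qed

lemma free_extension_single: "free_extension scale F (Poly_Mapping.single w c) = scale c (F w)"
  by (cases "c = 0") (simp_all add: free_extension_def)

lemma free_extension_formal_sum: "free_extension scale F (formal_sum ws) = (\<Sum>w\<leftarrow>ws. F w)"
proof (induction ws)
  case Nil
  then show ?case by (simp add: formal_sum_def free_extension_def)
next
  case (Cons w ws)
  have "formal_sum (w # ws) = Poly_Mapping.single w 1 + (formal_sum ws :: _ \<Rightarrow>\<^sub>0 'a)"
    by (simp add: formal_sum_def)
  then show ?case using Cons by (simp add: free_extension_add free_extension_single)
qed

text \<open>
  Universal property of the tensor power: a map on words that is linear in every slot extends to the
  free vector space and kills the multilinearity relations, so it takes equal values on equal
  tensors.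
\<close>
lemma tensor_eq_multilinear:
  assumes add: "\<And>u v x y. \<lbrakk>set u \<subseteq> V; set v \<subseteq> V; x \<in> V; y \<in> V\<rbrakk> \<Longrightarrow>
      F (u @ [x + y] @ v) = F (u @ [x] @ v) + F (u @ [y] @ v)"
    and scl: "\<And>u v x c. \<lbrakk>set u \<subseteq> V; set v \<subseteq> V; x \<in> V\<rbrakk> \<Longrightarrow>
      F (u @ [s c x] @ v) = scale c (F (u @ [x] @ v))"
    and eq: "tensor_eq s V ws ws'"
  shows "(\<Sum>w\<leftarrow>ws. F w) = (\<Sum>w\<leftarrow>ws'. F w)"
proof -
  interpret \<Phi>: module_hom free_scale scale "free_extension scale F" by (rule free_extension_hom)
  have "module.span free_scale (tensor_relations s V) \<subseteq> {p. free_extension scale F p = 0}"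
  proof (rule \<Phi>.m1.span_minimal)
    show "tensor_relations s V \<subseteq> {p. free_extension scale F p = 0}"
      using add scl unfolding tensor_relations_def
      by (auto simp: \<Phi>.diff free_extension_single)
    show "\<Phi>.m1.subspace {p. free_extension scale F p = 0}"
      by (rule \<Phi>.subspace_kernel)
  qed
  then have "free_extension scale F (formal_sum ws - formal_sum ws') = 0"
    using eq by (auto simp: tensor_eq_def)
  then show ?thesis by (simp add: \<Phi>.diff free_extension_formal_sum)
qed

lemma tensor_eq_bilinear_words:
  assumes "bilinear_on s V scale B" and "tensor_eq s V ws ws'"
  shows "(\<Sum>w\<leftarrow>ws. case w of [x, y] \<Rightarrow> B x y | _ \<Rightarrow> 0) =
    (\<Sum>w\<leftarrow>ws'. case w of [x, y] \<Rightarrow> B x y | _ \<Rightarrow> 0)"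
proof (rule tensor_eq_multilinear[OF _ _ assms(2)], goal_cases)
  case (1 u v x y)
  then show ?case using bilinear_onD(1,3)[OF assms(1)]
    by (auto split: list.splits simp: append_eq_Cons_conv Cons_eq_append_conv)
next
  case (2 u v x c)
  then show ?case using bilinear_onD(2,4)[OF assms(1)]
    by (auto split: list.splits simp: append_eq_Cons_conv Cons_eq_append_conv)
qed

lemma tensor_eq_bilinear:
  assumes "bilinear_on s V scale B"
    and "tensor_eq s V [[x, y]. (x, y) \<leftarrow> L] [[x, y]. (x, y) \<leftarrow> L']"
  shows "(\<Sum>(x, y)\<leftarrow>L. B x y) = (\<Sum>(x, y)\<leftarrow>L'. B x y)"
  using tensor_eq_bilinear_words[OF assms] by (simp add: o_def case_prod_unfold)

lemma tensor_eq_trilinear_words: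
  assumes "trilinear_on s V scale B" and "tensor_eq s V ws ws'"
  shows "(\<Sum>w\<leftarrow>ws. case w of [x, y, z] \<Rightarrow> B x y z | _ \<Rightarrow> 0) =
    (\<Sum>w\<leftarrow>ws'. case w of [x, y, z] \<Rightarrow> B x y z | _ \<Rightarrow> 0)"
proof (rule tensor_eq_multilinear[OF _ _ assms(2)], goal_cases)
  case (1 u v x y)
  then show ?case
    using trilinear_onD(2)[OF assms(1)] bilinear_onD(1,3)[OF trilinear_onD(1)[OF assms(1)]]
    by (auto split: list.splits simp: append_eq_Cons_conv Cons_eq_append_conv)
next
  case (2 u v x c)
  then show ?case
    using trilinear_onD(3)[OF assms(1)] bilinear_onD(2,4)[OF trilinear_onD(1)[OF assms(1)]]
    by (auto split: list.splits simp: append_eq_Cons_conv Cons_eq_append_conv)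
qed

end

fun word_eval :: "('v \<Rightarrow> 'k::field) list \<Rightarrow> 'v list \<Rightarrow> 'k"
  where
    "word_eval [] [] = 1"
  | "word_eval (f # fs) (x # w) = f x * word_eval fs w"
  | "word_eval _ _ = 0"

lemma word_eval_append:
  "length fs = length w \<Longrightarrow> word_eval (fs @ gs) (w @ v) = word_eval fs w * word_eval gs v"
  by (induction fs w rule: list_induct2) auto

lemma word_eval_snoc:
  assumes "length w = length fs + 1 + length gs"
  shows "word_eval (fs @ f # gs) w =
    word_eval fs (take (length fs) w) * f (w ! length fs) * word_eval gs (drop (Suc (length fs)) w)"
proof -
  have "w = take (length fs) w @ (w ! length fs) # drop (Suc (length fs)) w"
    using assms by (simp add: id_take_nth_drop[symmetric])
  then have "word_eval (fs @ f # gs) w = word_eval (fs @ f # gs) (take (length fs) w @ (w ! length fs) # drop (Suc (length fs)) w)"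
    by simp
  also have "\<dots> = word_eval fs (take (length fs) w) * word_eval (f # gs) ((w ! length fs) # drop (Suc (length fs)) w)"
    by (rule word_eval_append) (use assms in simp)
  finally show ?thesis by simp
qed

lemma linear_on_sum_list:
  assumes "vector_space s" "module.subspace s V" "vector_space s'" "linear_on s V s' f"
    and "\<And>x. x \<in> set L \<Longrightarrow> v x \<in> V"
  shows "f (\<Sum>x\<leftarrow>L. v x) = (\<Sum>x\<leftarrow>L. f (v x)) \<and> (\<Sum>x\<leftarrow>L. v x) \<in> V"
proof -
  interpret S: vector_space s by fact
  interpret T: vector_space s' by fact
  have "f 0 = 0"
    using linear_onD(2)[OF assms(4), of 0 0] S.subspace_0[OF assms(2)] by simp
  then show ?thesis using assms(5)
    by (induction L) (auto simp: linear_onD(1)[OF assms(4)] S.subspace_0[OF assms(2)] S.subspace_add[OF assms(2)])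
qed

lemma linear_on_sum:
  assumes "vector_space s" "module.subspace s V" "vector_space s'" "linear_on s V s' f"
    and "\<And>x. x \<in> N \<Longrightarrow> v x \<in> V"
  shows "f (\<Sum>x\<in>N. v x) = (\<Sum>x\<in>N. f (v x))"
proof -
  interpret S: vector_space s by fact
  interpret T: vector_space s' by fact
  have 0: "f 0 = 0"
    using linear_onD(2)[OF assms(4), of 0 0] S.subspace_0[OF assms(2)] by simp
  show ?thesis
  proof (cases "finite N")
    case True
    then show ?thesis using assms(5)
      by (induction N rule: finite_induct)
        (auto simp: 0 linear_onD(1)[OF assms(4)] S.subspace_sum[OF assms(2)])
  qed (simp add: 0)
qed

locale carrier_space = vector_space s
  for s :: "'k::field \<Rightarrow> 'v::ab_group_add \<Rightarrow> 'v" +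
  fixes V :: "'v set"
  assumes subspace_V: "subspace V"
begin

definition coordinate_basis :: "'v set"
  where "coordinate_basis = (SOME B. B \<subseteq> V \<and> independent B \<and> V \<subseteq> span B)"

lemma coordinate_basis:
  "coordinate_basis \<subseteq> V" "independent coordinate_basis" "V \<subseteq> span coordinate_basis"
proof -
  obtain B where "B \<subseteq> V" "independent B" "V \<subseteq> span B"
    using maximal_independent_subset[of V] by auto
  then have "\<exists>B. B \<subseteq> V \<and> independent B \<and> V \<subseteq> span B" by blast
  from someI_ex[OF this] show
    "coordinate_basis \<subseteq> V" "independent coordinate_basis" "V \<subseteq> span coordinate_basis"
    by (auto simp: coordinate_basis_def)
qed

definition coord :: "'v \<Rightarrow> 'v \<Rightarrow> 'k"
  where "coord b v = representation coordinate_basis v b"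

lemma linear_on_coord: "linear_on s V (*) (coord b)"
  unfolding coord_def
  by (rule linear_onI)
    (simp_all add: representation_add representation_scale coordinate_basis(2)
      subsetD[OF coordinate_basis(3)])

lemma finite_coord: "finite {b. coord b v \<noteq> 0}"
  by (simp add: coord_def finite_representation)

lemma sum_coord:
  assumes "v \<in> V"
  shows "(\<Sum>b | coord b v \<noteq> 0. s (coord b v) b) = v"
  using sum_nonzero_representation_eq[OF coordinate_basis(2)] coordinate_basis(3) assms
  by (auto simp: coord_def)

lemma coord_nonzero: "coord b v \<noteq> 0 \<Longrightarrow> b \<in> V"
  using representation_ne_zero coordinate_basis(1) by (auto simp: coord_def)

lemma linear_functionals_separate:
  assumes "x \<in> V" "\<And>f. linear_on s V (*) f \<Longrightarrow> f x = (0::'k)"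
  shows "x = 0"
  using sum_coord[OF assms(1)] assms(2)[OF linear_on_coord] by simp

sublocale free: vector_space "free_scale :: 'k \<Rightarrow> ('v list \<Rightarrow>\<^sub>0 'k) \<Rightarrow> _"
  by (rule vector_space_free_scale)

abbreviation relation_span :: "('v list \<Rightarrow>\<^sub>0 'k) set"
  where "relation_span \<equiv> free.span (tensor_relations s V)"

definition prefix_map :: "'v \<Rightarrow> ('v list \<Rightarrow>\<^sub>0 'k) \<Rightarrow> ('v list \<Rightarrow>\<^sub>0 'k)"
  where "prefix_map b = free_extension free_scale (\<lambda>w. Poly_Mapping.single (b # w) 1)"

lemma prefix_map_hom: "module_hom free_scale free_scale (prefix_map b)"
  unfolding prefix_map_def by (rule free.free_extension_hom)

lemma lookup_sum_free: "Poly_Mapping.lookup (sum f S) w = (\<Sum>x\<in>S. Poly_Mapping.lookup (f x) w)"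
  by (rule Poly_Mapping.lookup_sum)

lemma lookup_prefix_map:
  "Poly_Mapping.lookup (prefix_map b p) u =
    (case u of [] \<Rightarrow> 0 | b' # u' \<Rightarrow> if b' = b then Poly_Mapping.lookup p u' else 0)"
  by (auto simp: prefix_map_def free_extension_def lookup_sum_free lookup_single when_def
      in_keys_iff split: list.split)

lemma free_scale_single: "free_scale c (Poly_Mapping.single w d) = Poly_Mapping.single w (c * d)"
  by (rule poly_mapping_eqI) (simp add: lookup_single when_def)

lemma prefix_map_single: "prefix_map b (Poly_Mapping.single w c) = Poly_Mapping.single (b # w) c"
  by (simp add: prefix_map_def free.free_extension_single free_scale_single)

text \<open>
  Hence a word can be brought into normal form letter by letter, starting from its end.
\<close>
lemma prefix_map_relation_span:
  assumes "b \<in> V" "p \<in> relation_span"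
  shows "prefix_map b p \<in> relation_span"
proof -
  interpret P: module_hom free_scale free_scale "prefix_map b" by (rule prefix_map_hom)
  have "relation_span \<subseteq> {p. prefix_map b p \<in> relation_span}"
  proof (rule free.span_minimal)
    show "tensor_relations s V \<subseteq> {p. prefix_map b p \<in> relation_span}"
    proof
      fix p assume "p \<in> tensor_relations s V"
      then consider u v x y where
          "p = Poly_Mapping.single (u @ [x + y] @ v) 1
            - Poly_Mapping.single (u @ [x] @ v) 1 - Poly_Mapping.single (u @ [y] @ v) 1"
          "set u \<subseteq> V" "set v \<subseteq> V" "x \<in> V" "y \<in> V"
        | u v x c where
          "p = Poly_Mapping.single (u @ [s c x] @ v) 1 - Poly_Mapping.single (u @ [x] @ v) c"
          "set u \<subseteq> V" "set v \<subseteq> V" "x \<in> V"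
        unfolding tensor_relations_def by blast
      then have "prefix_map b p \<in> tensor_relations s V"
      proof cases
        case 1
        then have "prefix_map b p = Poly_Mapping.single ((b # u) @ [x + y] @ v) 1
            - Poly_Mapping.single ((b # u) @ [x] @ v) 1 - Poly_Mapping.single ((b # u) @ [y] @ v) 1"
          "set (b # u) \<subseteq> V"
          using assms(1) by (simp_all add: P.diff prefix_map_single)
        then show ?thesis using 1 unfolding tensor_relations_def by blast
      next
        case 2
        then have "prefix_map b p =
            Poly_Mapping.single ((b # u) @ [s c x] @ v) 1 - Poly_Mapping.single ((b # u) @ [x] @ v) c"
          "set (b # u) \<subseteq> V"
          using assms(1) by (simp_all add: P.diff prefix_map_single)
        then show ?thesis using 2 unfolding tensor_relations_def by blast
      qed
      then show "p \<in> {p. prefix_map b p \<in> relation_span}" by (simp add: free.span_base)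
    qed
    show "free.subspace {p. prefix_map b p \<in> relation_span}"
      by (rule P.subspace_vimage[unfolded vimage_def]) (rule free.subspace_span)
  qed
  then show ?thesis using assms(2) by auto
qed

lemma single_linear_combination:
  assumes "finite S" "S \<subseteq> V" "set w \<subseteq> V"
  shows "Poly_Mapping.single ((\<Sum>b\<in>S. s (c b) b) # w) 1
      - (\<Sum>b\<in>S. free_scale (c b) (Poly_Mapping.single (b # w) 1)) \<in> relation_span"
  using assms
proof (induction S rule: finite_induct)
  case empty
  have "Poly_Mapping.single ([] @ [0 + 0] @ w) 1 - Poly_Mapping.single ([] @ [0] @ w) 1
      - Poly_Mapping.single ([] @ [0] @ w) (1::'k) \<in> tensor_relations s V"
    unfolding tensor_relations_def using empty subspace_0[OF subspace_V]
    by (intro UnI1 CollectI exI[of _ "[]"] exI[of _ w] exI[of _ 0]) auto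
  from free.span_neg[OF free.span_base[OF this]] show ?case by simp
next
  case (insert b S)
  let ?g = "\<lambda>x. Poly_Mapping.single (x # w) (1::'k)"
  let ?y = "\<Sum>b\<in>S. s (c b) b"
  have V: "b \<in> V" "s (c b) b \<in> V" "?y \<in> V"
    using insert subspace_V by (auto intro!: subspace_scale subspace_sum)
  have 1: "?g (s (c b) b + ?y) - ?g (s (c b) b) - ?g ?y \<in> relation_span"
    by (rule free.span_base) (use V insert.prems in
      \<open>unfold tensor_relations_def, intro UnI1 CollectI exI[of _ "[]"] exI[of _ w]
        exI[of _ "s (c b) b"] exI[of _ ?y], auto\<close>)
  have 2: "?g (s (c b) b) - Poly_Mapping.single (b # w) (c b) \<in> relation_span"
    by (rule free.span_base) (use V insert.prems in
      \<open>unfold tensor_relations_def, intro UnI2 CollectI exI[of _ "[]"] exI[of _ w]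
        exI[of _ b] exI[of _ "c b"], auto\<close>)
  have 3: "?g ?y - (\<Sum>b\<in>S. free_scale (c b) (?g b)) \<in> relation_span"
    using insert by auto
  from free.span_add[OF free.span_add[OF 1 2] 3] show ?case
    using insert by (simp add: free_scale_single algebra_simps)
qed

text \<open>The normal form of a word: its expansion into words over the basis.\<close>
fun expand :: "'v list \<Rightarrow> ('v list \<Rightarrow>\<^sub>0 'k)"
  where
    "expand [] = Poly_Mapping.single [] 1"
  | "expand (v # w) = (\<Sum>b | coord b v \<noteq> 0. free_scale (coord b v) (prefix_map b (expand w)))"

lemma single_expand:
  "set w \<subseteq> V \<Longrightarrow> Poly_Mapping.single w 1 - expand w \<in> relation_span"
proof (induction w)
  case Nil
  then show ?case by (simp add: free.span_zero)
next
  case (Cons v w)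
  let ?S = "{b. coord b v \<noteq> 0}"
  have S: "finite ?S" "?S \<subseteq> V" using finite_coord coord_nonzero by auto
  have 1: "Poly_Mapping.single (v # w) 1
      - (\<Sum>b\<in>?S. free_scale (coord b v) (Poly_Mapping.single (b # w) 1)) \<in> relation_span"
    using single_linear_combination[OF S, of w "\<lambda>b. coord b v"] sum_coord[of v] Cons.prems by simp
  have 2: "Poly_Mapping.single (b # w) 1 - prefix_map b (expand w) \<in> relation_span" if "b \<in> ?S" for b
  proof -
    interpret P: module_hom free_scale free_scale "prefix_map b" by (rule prefix_map_hom)
    have "Poly_Mapping.single w 1 - expand w \<in> relation_span" using Cons by simp
    then have "prefix_map b (Poly_Mapping.single w 1 - expand w) \<in> relation_span"
      by (rule prefix_map_relation_span[rotated]) (use S that in auto)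
    then show ?thesis by (simp add: P.diff prefix_map_single)
  qed
  have "(\<Sum>b\<in>?S. free_scale (coord b v) (Poly_Mapping.single (b # w) 1 - prefix_map b (expand w)))
      \<in> relation_span"
    by (intro free.span_sum free.span_scale 2)
  from free.span_add[OF 1 this] show ?case
    by (simp add: free.scale_right_diff_distrib sum_subtractf)
qed

lemma lookup_expand: "Poly_Mapping.lookup (expand w) bs = word_eval (map coord bs) w"
proof (induction w arbitrary: bs)
  case Nil
  then show ?case by (cases bs) (auto simp: lookup_single)
next
  case IH: (Cons v w)
  show ?case
  proof (cases bs)
    case Nil
    then show ?thesis by (simp add: lookup_sum_free lookup_prefix_map)
  next
    case (Cons b bs')
    have "Poly_Mapping.lookup (expand (v # w)) bs =
        (\<Sum>b' | coord b' v \<noteq> 0. if b' = b then coord b v * Poly_Mapping.lookup (expand w) bs' else 0)"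
      by (auto simp: lookup_sum_free lookup_prefix_map Cons intro!: sum.cong)
    also have "\<dots> = coord b v * Poly_Mapping.lookup (expand w) bs'"
      using finite_coord by (simp add: sum.delta)
    finally show ?thesis by (simp add: Cons IH.IH)
  qed
qed

lemma tensor_eqI_coord:
  assumes "\<And>w. w \<in> set ws \<union> set ws' \<Longrightarrow> set w \<subseteq> V"
    and "\<And>bs. (\<Sum>w\<leftarrow>ws. word_eval (map coord bs) w) = (\<Sum>w\<leftarrow>ws'. word_eval (map coord bs) w)"
  shows "tensor_eq s V ws ws'"
proof -
  have span: "formal_sum us - (\<Sum>w\<leftarrow>us. expand w) \<in> relation_span"
    if "\<And>w. w \<in> set us \<Longrightarrow> set w \<subseteq> V" for us
    using that
  proof (induction us)
    case (Cons w us)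
    from free.span_add[OF single_expand[of w] Cons.IH] Cons.prems show ?case
      by (simp add: formal_sum_def algebra_simps)
  qed (simp add: formal_sum_def free.span_zero)
  have lk: "Poly_Mapping.lookup (\<Sum>w\<leftarrow>us. expand w) bs = (\<Sum>w\<leftarrow>us. word_eval (map coord bs) w)" for us bs
    by (induction us) (simp_all add: lookup_add lookup_expand)
  have "(\<Sum>w\<leftarrow>ws. expand w) = (\<Sum>w\<leftarrow>ws'. expand w)"
    by (rule poly_mapping_eqI) (simp add: lk assms(2))
  then show ?thesis
    using free.span_diff[OF span[of ws] span[of ws']] assms(1) by (simp add: tensor_eq_def)
qed

text \<open>
  Tensors are separated by products of functionals.  If \<open>P\<close> separates the points of \<open>V\<close>, fixing
  functionals in all slots but one contracts the difference of two tensors to a vector of \<open>V\<close> that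
  \<open>P\<close> annihilates; so one may replace \<open>P\<close> by all functionals in one slot after the other, in
  particular by the coordinates of a basis.
\<close>
lemma tensor_eqI:
  assumes words: "\<And>w. w \<in> set ws \<union> set ws' \<Longrightarrow> set w \<subseteq> V \<and> length w = n"
    and P: "\<And>f. f \<in> P \<Longrightarrow> linear_on s V (*) f"
    and sep: "\<And>x. x \<in> V \<Longrightarrow> (\<And>f. f \<in> P \<Longrightarrow> f x = 0) \<Longrightarrow> x = 0"
    and eq: "\<And>fs. length fs = n \<Longrightarrow> set fs \<subseteq> P \<Longrightarrow>
        (\<Sum>w\<leftarrow>ws. word_eval fs w) = (\<Sum>w\<leftarrow>ws'. word_eval fs w)"
  shows "tensor_eq s V ws ws'"
proof -
  \<comment> \<open>arbitrary functionals in the slots of \<open>fs\<close>, elements of \<open>P\<close> in the slots of \<open>gs\<close>\<close>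
  have step: "(\<Sum>w\<leftarrow>ws. word_eval (fs @ gs) w) = (\<Sum>w\<leftarrow>ws'. word_eval (fs @ gs) w)"
    if "length fs + length gs = n" "\<And>f. f \<in> set fs \<Longrightarrow> linear_on s V (*) f" "set gs \<subseteq> P" for fs gs
    using that
  proof (induction fs arbitrary: gs rule: rev_induct)
    case Nil
    then show ?case using eq by simp
  next
    case (snoc f fs)
    define m where "m = length fs"
    define a where "a w = word_eval fs (take m w) * word_eval gs (drop (Suc m) w)" for w
    \<comment> \<open>contraction of a tensor with \<open>fs\<close> and \<open>gs\<close> in all slots but the \<open>m\<close>-th\<close>
    define z where "z us = (\<Sum>w\<leftarrow>us. s (a w) (w ! m))" for us
    have m: "w ! m \<in> V" "length w = length fs + 1 + length gs" if "w \<in> set ws \<union> set ws'" for w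
      using words[OF that] snoc.prems(1) nth_mem[of m w] by (auto simp: m_def)
    have z: "g (z us) = (\<Sum>w\<leftarrow>us. word_eval (fs @ g # gs) w) \<and> z us \<in> V"
      if "set us \<subseteq> set ws \<union> set ws'" "linear_on s V (*) g" for us g
    proof -
      have in_V: "s (a w) (w ! m) \<in> V" if "w \<in> set us" for w
        using m[of w] that \<open>set us \<subseteq> _\<close> subspace_scale[OF subspace_V] by auto
      have "g (z us) = (\<Sum>w\<leftarrow>us. g (s (a w) (w ! m))) \<and> z us \<in> V"
        unfolding z_def
        by (rule linear_on_sum_list[OF vector_space_axioms subspace_V vector_space_field that(2)])
          (rule in_V)
      moreover have "(\<Sum>w\<leftarrow>us. g (s (a w) (w ! m))) = (\<Sum>w\<leftarrow>us. word_eval (fs @ g # gs) w)"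
      proof (intro arg_cong[of _ _ sum_list] map_cong refl)
        fix w assume "w \<in> set us"
        then have "w \<in> set ws \<union> set ws'" using that(1) by auto
        from m[OF this] show "g (s (a w) (w ! m)) = word_eval (fs @ g # gs) w"
          by (simp add: word_eval_snoc linear_onD(2)[OF that(2)] a_def m_def)
      qed
      ultimately show ?thesis by simp
    qed
    have zV: "z ws \<in> V" "z ws' \<in> V" using z[OF _ linear_on_coord] by auto
    have "z ws - z ws' = 0"
    proof (rule sep)
      show "z ws - z ws' \<in> V" using zV subspace_diff[OF subspace_V] by auto
      fix g assume g: "g \<in> P"
      have "g (z ws) = g (z ws')"
        using snoc.IH[of "g # gs"] snoc.prems g z[OF _ P[OF g], of ws] z[OF _ P[OF g], of ws'] by auto
      moreover have "g (z ws - z ws' + z ws') = g (z ws - z ws') + g (z ws')"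
        using zV subspace_diff[OF subspace_V] by (intro linear_onD(1)[OF P[OF g]]) auto
      ultimately show "g (z ws - z ws') = 0" by simp
    qed
    then show ?case using z[of ws f] z[of ws' f] snoc.prems(2)[of f] by simp
  qed
  show ?thesis
  proof (rule tensor_eqI_coord)
    show "set w \<subseteq> V" if "w \<in> set ws \<union> set ws'" for w using words[OF that] by simp
    fix bs
    show "(\<Sum>w\<leftarrow>ws. word_eval (map coord bs) w) = (\<Sum>w\<leftarrow>ws'. word_eval (map coord bs) w)"
    proof (cases "length bs = n")
      case True
      then show ?thesis using step[of "map coord bs" "[]"] linear_on_coord by auto
    next
      case False
      have mismatch: "word_eval fs w = 0" if "length fs \<noteq> length w"
        for fs :: "('v \<Rightarrow> 'k) list" and w
        using that by (induction fs w rule: word_eval.induct) auto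
      then have "word_eval (map coord bs) w = 0" if "w \<in> set ws \<union> set ws'" for w
        using words[OF that] False mismatch[of "map coord bs" w] by simp
      then show ?thesis by (simp cong: map_cong)
    qed
  qed
qed

lemma tensor_eqI2:
  assumes "set L \<subseteq> V \<times> V" "set L' \<subseteq> V \<times> V"
    and P: "\<And>f. f \<in> P \<Longrightarrow> linear_on s V (*) f"
    and sep: "\<And>x. x \<in> V \<Longrightarrow> (\<And>f. f \<in> P \<Longrightarrow> f x = 0) \<Longrightarrow> x = 0"
    and eq: "\<And>f g. f \<in> P \<Longrightarrow> g \<in> P \<Longrightarrow> (\<Sum>(x, y)\<leftarrow>L. f x * g y) = (\<Sum>(x, y)\<leftarrow>L'. f x * g y)"
  shows "tensor_eq s V [[x, y]. (x, y) \<leftarrow> L] [[x, y]. (x, y) \<leftarrow> L']"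
proof (rule tensor_eqI[where n = 2 and P = P])
  fix fs :: "('v \<Rightarrow> 'k) list" assume "length fs = 2" "set fs \<subseteq> P"
  then obtain f g where "fs = [f, g]" "f \<in> P" "g \<in> P"
    by (auto simp: length_Suc_conv numeral_2_eq_2)
  then show "(\<Sum>w\<leftarrow>[[x, y]. (x, y) \<leftarrow> L]. word_eval fs w) = (\<Sum>w\<leftarrow>[[x, y]. (x, y) \<leftarrow> L']. word_eval fs w)"
    using eq[of f g] by (simp add: o_def case_prod_unfold)
qed (use assms in auto)

end

section \<open>Sweedler calculus and comatrices\<close>

lemma sum_list_concat_map:
  "sum_list (map f (concat (map g L))) = (\<Sum>x\<leftarrow>L. \<Sum>y\<leftarrow>g x. f y)"
  by (induction L) auto

sublocale hopf_algebra \<subseteq> V: carrier_space "smul H" "carrier H"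
  by (intro carrier_space.intro carrier_space_axioms.intro vector_space subspace)

context hopf_algebra
begin

abbreviation functional :: "('h \<Rightarrow> 'k) \<Rightarrow> bool"
  where "functional \<equiv> linear_on (smul H) (carrier H) (*)"

abbreviation bilinear :: "('k \<Rightarrow> 'w::ab_group_add \<Rightarrow> 'w) \<Rightarrow> ('h \<Rightarrow> 'h \<Rightarrow> 'w) \<Rightarrow> bool"
  where "bilinear s B \<equiv> bilinear_on (smul H) (carrier H) s B"

abbreviation trilinear :: "('k \<Rightarrow> 'w::ab_group_add \<Rightarrow> 'w) \<Rightarrow> ('h \<Rightarrow> 'h \<Rightarrow> 'h \<Rightarrow> 'w) \<Rightarrow> bool"
  where "trilinear s B \<equiv> trilinear_on (smul H) (carrier H) s B"

text \<open>
  \<open>B h\<^sub>1 h\<^sub>2\<close>, summed over a representative of \<open>\<Delta> h\<close>.  For bilinear \<open>B\<close> this depends on the tensor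
  only, and then the axioms on \<open>\<Delta>\<close> become equations between values of \<open>B\<close>.
\<close>
definition sweedler :: "('h \<Rightarrow> 'h \<Rightarrow> 'w::monoid_add) \<Rightarrow> 'h \<Rightarrow> 'w"
  where "sweedler B h = (\<Sum>(x, y)\<leftarrow>comul H h. B x y)"

lemma zero_closed [simp]: "0 \<in> carrier H"
  by (rule V.subspace_0[OF subspace])

lemma add_closed [simp]: "x \<in> carrier H \<Longrightarrow> y \<in> carrier H \<Longrightarrow> x + y \<in> carrier H"
  by (rule V.subspace_add[OF subspace])

lemma smul_closed [simp]: "x \<in> carrier H \<Longrightarrow> smul H c x \<in> carrier H"
  by (rule V.subspace_scale[OF subspace])

lemma sum_closed: "(\<And>x. x \<in> N \<Longrightarrow> f x \<in> carrier H) \<Longrightarrow> sum f N \<in> carrier H"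
  by (rule V.subspace_sum[OF subspace])

lemma sum_list_closed: "(\<And>x. x \<in> set L \<Longrightarrow> f x \<in> carrier H) \<Longrightarrow> (\<Sum>x\<leftarrow>L. f x) \<in> carrier H"
  by (induction L) auto

declare mul_closed [simp] unity_closed [simp] antipode_closed [simp]

lemma sweedler_closed:
  assumes "h \<in> carrier H" "\<And>x y. x \<in> carrier H \<Longrightarrow> y \<in> carrier H \<Longrightarrow> B x y \<in> carrier H"
  shows "sweedler B h \<in> carrier H"
  unfolding sweedler_def using comul_closed[OF assms(1)] assms(2)
  by (intro sum_list_closed) auto

lemma sweedler_cong:
  assumes "h \<in> carrier H" "\<And>x y. x \<in> carrier H \<Longrightarrow> y \<in> carrier H \<Longrightarrow> B x y = B' x y"
  shows "sweedler B h = sweedler B' h"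
  unfolding sweedler_def using comul_closed[OF assms(1)] assms(2)
  by (intro arg_cong[of _ _ sum_list] map_cong) auto

lemma sweedler_scale:
  assumes "Vector_Spaces.vector_space s"
  shows "sweedler (\<lambda>x y. s c (B x y)) h = s c (sweedler B h)"
proof -
  interpret S: Vector_Spaces.vector_space s by fact
  have "s c (\<Sum>z\<leftarrow>L. f z) = (\<Sum>z\<leftarrow>L. s c (f z))" for f and L :: "('h \<times> 'h) list"
    by (induction L) (simp_all add: S.scale_right_distrib)
  then show ?thesis by (simp add: sweedler_def case_prod_unfold)
qed

lemma sweedler_mult_left: "sweedler (\<lambda>x y. c * B x y) h = (c::'z::semiring_0) * sweedler B h"
  by (simp add: sweedler_def case_prod_unfold sum_list_const_mult)

lemma sweedler_linear_map:
  assumes "h \<in> carrier H" "Vector_Spaces.vector_space s" "module.subspace s W"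
    "Vector_Spaces.vector_space s'" "linear_on s W s' f"
    and "\<And>x y. x \<in> carrier H \<Longrightarrow> y \<in> carrier H \<Longrightarrow> B x y \<in> W"
  shows "f (sweedler B h) = sweedler (\<lambda>x y. f (B x y)) h"
proof -
  have "f (\<Sum>z\<leftarrow>comul H h. case z of (x, y) \<Rightarrow> B x y) =
      (\<Sum>z\<leftarrow>comul H h. f (case z of (x, y) \<Rightarrow> B x y))"
    using linear_on_sum_list[OF assms(2-5), of "comul H h" "\<lambda>(x, y). B x y"]
      comul_closed[OF assms(1)] assms(6) by auto
  then show ?thesis by (simp add: sweedler_def case_prod_unfold)
qed

lemma sweedler_linear:
  assumes "h \<in> carrier H" "Vector_Spaces.vector_space s'" "linear_on (smul H) (carrier H) s' f"
    and "\<And>x y. x \<in> carrier H \<Longrightarrow> y \<in> carrier H \<Longrightarrow> B x y \<in> carrier H"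
  shows "f (sweedler B h) = sweedler (\<lambda>x y. f (B x y)) h"
  by (rule sweedler_linear_map[OF assms(1) vector_space subspace assms(2-4)])

lemma sweedler_add:
  assumes "Vector_Spaces.vector_space s'" "bilinear s' B" "g \<in> carrier H" "h \<in> carrier H"
  shows "sweedler B (g + h) = sweedler B g + sweedler B h"
  using vector_space.tensor_eq_bilinear_words[OF assms(1,2) comul_add[OF assms(3,4)]]
  by (simp add: sweedler_def o_def case_prod_unfold)

lemma sweedler_smul:
  assumes "Vector_Spaces.vector_space s'" "bilinear s' B" "h \<in> carrier H"
  shows "sweedler B (smul H c h) = s' c (sweedler B h)"
proof -
  have "sweedler B (smul H c h) = sweedler (\<lambda>x y. B (smul H c x) y) h"
    using vector_space.tensor_eq_bilinear_words[OF assms(1,2) comul_smul[OF assms(3)]]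
    by (simp add: sweedler_def o_def case_prod_unfold)
  also have "\<dots> = sweedler (\<lambda>x y. s' c (B x y)) h"
    by (rule sweedler_cong[OF assms(3)]) (simp add: bilinear_onD(4)[OF assms(2)])
  finally show ?thesis by (simp add: sweedler_scale[OF assms(1)])
qed

lemma linear_on_sweedler:
  assumes "Vector_Spaces.vector_space s'" "bilinear s' B"
  shows "linear_on (smul H) (carrier H) s' (sweedler B)"
  by (rule linear_onI) (simp_all add: sweedler_add[OF assms] sweedler_smul[OF assms])

lemma sweedler_coassoc:
  assumes "Vector_Spaces.vector_space s'" "trilinear s' B" "h \<in> carrier H"
  shows "sweedler (\<lambda>x y. sweedler (\<lambda>u v. B u v y) x) h = sweedler (\<lambda>x y. sweedler (B x) y) h"
  using vector_space.tensor_eq_trilinear_words[OF assms(1,2) coassoc[OF assms(3)]]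
  by (simp add: sweedler_def o_def case_prod_unfold sum_list_concat_map)

lemma sweedler_mul:
  assumes "Vector_Spaces.vector_space s'" "bilinear s' B" "g \<in> carrier H" "h \<in> carrier H"
  shows "sweedler B (g \<odot> h) = sweedler (\<lambda>x y. sweedler (\<lambda>x' y'. B (x \<odot> x') (y \<odot> y')) h) g"
  using vector_space.tensor_eq_bilinear_words[OF assms(1,2) comul_mul[OF assms(3,4)]]
  by (simp add: sweedler_def o_def case_prod_unfold sum_list_concat_map)

lemma sweedler_unity:
  assumes "Vector_Spaces.vector_space s'" "bilinear s' B"
  shows "sweedler B \<one> = B \<one> \<one>"
  using vector_space.tensor_eq_bilinear_words[OF assms(1,2) comul_unity]
  by (simp add: sweedler_def o_def case_prod_unfold)

lemma sweedler_counit_left: "h \<in> carrier H \<Longrightarrow> sweedler (\<lambda>x y. smul H (counit H x) y) h = h"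
  using counit_left by (simp add: sweedler_def)

lemma sweedler_counit_right: "h \<in> carrier H \<Longrightarrow> sweedler (\<lambda>x y. smul H (counit H y) x) h = h"
  using counit_right by (simp add: sweedler_def)

lemma functional_counit: "functional (counit H)"
  by (rule linear_onI) (simp_all add: counit_add counit_smul)

lemma functional_eqI:
  assumes "x \<in> carrier H" "y \<in> carrier H" "\<And>f. functional f \<Longrightarrow> f x = f y"
  shows "x = y"
proof -
  have "f (x - y) = 0" if f: "functional f" for f
  proof -
    have "f (x - y + y) = f (x - y) + f y"
      by (rule linear_onD(1)[OF f]) (use assms V.subspace_diff[OF subspace] in auto)
    then show ?thesis using assms(3)[OF f] by simp
  qed
  then have "x - y = 0"
    using V.linear_functionals_separate[of "x - y"] assms V.subspace_diff[OF subspace] by auto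
  then show ?thesis by simp
qed

lemma functional_sum:
  assumes "functional f" "\<And>x. x \<in> N \<Longrightarrow> v x \<in> carrier H"
  shows "f (\<Sum>x\<in>N. v x) = (\<Sum>x\<in>N. f (v x))"
  by (rule linear_on_sum[OF vector_space subspace vector_space_field assms])

text \<open>
  The entries of a comatrix span a finite-dimensional coalgebra, with
  \<open>\<Delta> c\<^sub>p\<^sub>q = \<Sum>r. c\<^sub>p\<^sub>r \<otimes> c\<^sub>r\<^sub>q\<close> expressed by functionals.
\<close>
definition comatrix :: "'i set \<Rightarrow> ('i \<Rightarrow> 'i \<Rightarrow> 'h) \<Rightarrow> bool"
  where "comatrix N c \<longleftrightarrow> finite N \<and>
    (\<forall>p\<in>N. \<forall>q\<in>N. c p q \<in> carrier H \<and> counit H (c p q) = (if p = q then 1 else 0)) \<and>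
    (\<forall>f g. functional f \<longrightarrow> functional g \<longrightarrow> (\<forall>p\<in>N. \<forall>q\<in>N.
      sweedler (\<lambda>x y. f x * g y) (c p q) = (\<Sum>r\<in>N. f (c p r) * g (c r q))))"

lemma comatrixD:
  assumes "comatrix N c"
  shows "finite N" "p \<in> N \<Longrightarrow> q \<in> N \<Longrightarrow> c p q \<in> carrier H"
    and "p \<in> N \<Longrightarrow> q \<in> N \<Longrightarrow> counit H (c p q) = (if p = q then 1 else 0)"
  using assms by (auto simp: comatrix_def)

text \<open>
  The definition speaks of functionals only, but products of functionals separate tensors; so the
  coproduct of a comatrix may be used in bilinear maps to any vector space.
\<close>
lemma comatrix_sweedler:
  assumes c: "comatrix N c" and s': "Vector_Spaces.vector_space s'" and B: "bilinear s' B"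
    and pq: "p \<in> N" "q \<in> N"
  shows "sweedler B (c p q) = (\<Sum>r\<in>N. B (c p r) (c r q))"
proof -
  obtain rs where rs: "set rs = N" "distinct rs"
    using comatrixD(1)[OF c] finite_distinct_list by blast
  let ?L = "map (\<lambda>r. (c p r, c r q)) rs"
  have conv: "(\<Sum>(x, y)\<leftarrow>?L. F x y) = (\<Sum>r\<in>N. F (c p r) (c r q))" for F :: "'h \<Rightarrow> 'h \<Rightarrow> 'z::comm_monoid_add"
    using rs by (simp add: o_def sum_list_distinct_conv_sum_set)
  have "tensor_eq (smul H) (carrier H) [[x, y]. (x, y) \<leftarrow> comul H (c p q)] [[x, y]. (x, y) \<leftarrow> ?L]"
  proof (rule V.tensor_eqI2[where P = "{f. functional f}"])
    show "set (comul H (c p q)) \<subseteq> carrier H \<times> carrier H"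
      by (rule comul_closed) (use c pq in \<open>auto simp: comatrixD\<close>)
    show "set ?L \<subseteq> carrier H \<times> carrier H"
      using c pq rs by (auto simp: comatrixD)
    show "x = 0" if "x \<in> carrier H" "\<And>f. f \<in> {f. functional f} \<Longrightarrow> f x = 0" for x
      using V.linear_functionals_separate that by blast
    show "(\<Sum>(x, y)\<leftarrow>comul H (c p q). f x * g y) = (\<Sum>(x, y)\<leftarrow>?L. f x * g y)"
      if "f \<in> {f. functional f}" "g \<in> {f. functional f}" for f g
      using c pq that unfolding conv by (auto simp: comatrix_def sweedler_def)
  qed auto
  from vector_space.tensor_eq_bilinear[OF s' B this] show ?thesis
    unfolding conv by (simp add: sweedler_def)
qed

lemma bilinear_contract_right:
  assumes "functional f"
  shows "bilinear (smul H) (\<lambda>x y. smul H (f y) x)"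
  by (rule bilinear_onI) (simp_all add: linear_onD[OF assms] V.scale_left_distrib V.scale_right_distrib mult.commute)

lemma bilinear_contract_left:
  assumes "functional f"
  shows "bilinear (smul H) (\<lambda>x y. smul H (f x) y)"
  by (rule bilinear_onI) (simp_all add: linear_onD[OF assms] V.scale_left_distrib V.scale_right_distrib mult.commute)

text \<open>
  The transpose of the action of the convolution algebra of functionals on itself by right multiplication.
\<close>
definition hit :: "('h \<Rightarrow> 'k) \<Rightarrow> 'h \<Rightarrow> 'h"
  where "hit f = sweedler (\<lambda>x y. smul H (f y) x)"

definition convolution :: "('h \<Rightarrow> 'k) \<Rightarrow> ('h \<Rightarrow> 'k) \<Rightarrow> 'h \<Rightarrow> 'k"
  where "convolution f g = sweedler (\<lambda>x y. f x * g y)"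

lemma functional_convolution: "functional f \<Longrightarrow> functional g \<Longrightarrow> functional (convolution f g)"
  unfolding convolution_def
  by (intro linear_on_sweedler vector_space_field bilinear_on_product)

lemma linear_hit: "functional f \<Longrightarrow> linear_on (smul H) (carrier H) (smul H) (hit f)"
  unfolding hit_def by (intro linear_on_sweedler vector_space bilinear_contract_right)

lemma hit_closed: "h \<in> carrier H \<Longrightarrow> hit f h \<in> carrier H"
  unfolding hit_def by (rule sweedler_closed) auto

lemma functional_hit:
  assumes "functional f" "functional g" "h \<in> carrier H"
  shows "f (hit g h) = sweedler (\<lambda>x y. f x * g y) h"
proof -
  have "f (hit g h) = sweedler (\<lambda>x y. f (smul H (g y) x)) h"
    unfolding hit_def by (rule sweedler_linear[OF assms(3) vector_space_field assms(1)]) simp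
  also have "\<dots> = sweedler (\<lambda>x y. f x * g y) h"
    by (rule sweedler_cong[OF assms(3)]) (simp add: linear_onD[OF assms(1)])
  finally show ?thesis .
qed

lemma hit_hit:
  assumes f: "functional f" and g: "functional g" and h: "h \<in> carrier H"
  shows "hit f (hit g h) = hit (convolution f g) h"
proof -
  have "hit f (hit g h) = sweedler (\<lambda>x y. hit f (smul H (g y) x)) h"
    unfolding hit_def[of g] by (rule sweedler_linear[OF h vector_space linear_hit[OF f]]) simp
  also have "\<dots> = sweedler (\<lambda>x y. sweedler (\<lambda>u v. smul H (f v * g y) u) x) h"
  proof (rule sweedler_cong[OF h])
    fix x y assume x: "x \<in> carrier H" and "y \<in> carrier H"
    have "hit f (smul H (g y) x) = smul H (g y) (hit f x)"
      using linear_onD(2)[OF linear_hit[OF f]] x by simp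
    then show "hit f (smul H (g y) x) = sweedler (\<lambda>u v. smul H (f v * g y) u) x"
      unfolding hit_def sweedler_scale[OF vector_space, symmetric] by (simp add: mult.commute)
  qed
  also have "\<dots> = sweedler (\<lambda>x y. sweedler (\<lambda>u v. smul H (f u * g v) x) y) h"
    by (rule sweedler_coassoc[OF vector_space _ h], rule trilinear_onI, rule bilinear_onI)
      (simp_all add: linear_onD[OF f] linear_onD[OF g] algebra_simps V.scale_left_distrib)
  also have "\<dots> = hit (convolution f g) h"
    unfolding hit_def
  proof (rule sweedler_cong[OF h])
    fix x y assume x: "x \<in> carrier H" and y: "y \<in> carrier H"
    have "linear_on (*) UNIV (smul H) (\<lambda>c. smul H c x)"
      by (rule linear_onI) (simp_all add: V.scale_left_distrib)
    then show "sweedler (\<lambda>u v. smul H (f u * g v) x) y = smul H (convolution f g y) x"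
      unfolding convolution_def
      by (intro sweedler_linear_map[OF y vector_space_field subspace_field_UNIV vector_space, symmetric])
        auto
  qed
  finally show ?thesis .
qed

lemma hit_counit: "h \<in> carrier H \<Longrightarrow> hit (counit H) h = h"
  by (simp add: hit_def sweedler_counit_right)

text \<open>
  The fundamental theorem of coalgebras.  The orbit \<open>W\<close> of \<open>h\<close> under the functionals acting by
  \<open>h\<^sub>1 f(h\<^sub>2)\<close> is finite-dimensional, and the matrix of this action in a basis of \<open>W\<close> is given by
  evaluating functionals at the entries of a comatrix, whose span contains \<open>W\<close> and therefore \<open>h\<close>.
\<close>
theorem comatrix_spanning:
  assumes h: "h \<in> carrier H"
  shows "\<exists>(N :: 'h set) c z. comatrix N c \<and> h = (\<Sum>p\<in>N. \<Sum>q\<in>N. smul H (z p q) (c p q))"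
proof -
  \<comment> \<open>the right coideal generated by \<open>h\<close>\<close>
  define W where "W = {hit f h | f. functional f}"
  have WH: "W \<subseteq> carrier H" using hit_closed[OF h] by (auto simp: W_def)
  have hW: "h \<in> W" using hit_counit[OF h] functional_counit by (auto simp: W_def intro!: exI[of _ "counit H"])
  have W_hit: "hit f w \<in> W" if "functional f" "w \<in> W" for f w
    using that hit_hit[OF that(1) _ h] functional_convolution by (auto simp: W_def)
  let ?F = "fst ` set (comul H h)"
  \<comment> \<open>the left legs of one representative of \<open>\<Delta> h\<close> span a space that contains \<open>W\<close>\<close>
  have W_fin: "W \<subseteq> V.span ?F"
  proof
    fix w assume "w \<in> W"
    then obtain f where "w = (\<Sum>(x, y)\<leftarrow>comul H h. smul H (f y) x)"
      by (auto simp: W_def hit_def sweedler_def)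
    moreover have base: "a \<in> V.span ?F" if "(a, b) \<in> set (comul H h)" for a b
      by (rule V.span_base) (use that in force)
    moreover have "(\<Sum>(x, y)\<leftarrow>L. smul H (f y) x) \<in> V.span ?F" if "set L \<subseteq> set (comul H h)" for L
      using that by (induction L) (auto intro!: V.span_add V.span_scale V.span_zero intro: base)
    ultimately show "w \<in> V.span ?F" by auto
  qed
  obtain E where E: "E \<subseteq> W" "V.independent E" "W \<subseteq> V.span E"
    using V.maximal_independent_subset[of W] by auto
  have finE: "finite E"
    using V.independent_span_bound[of ?F E] E W_fin by auto
  obtain B where B: "E \<subseteq> B" "B \<subseteq> carrier H" "V.independent B" "carrier H \<subseteq> V.span B"
    using V.maximal_independent_subset_extend[OF order.trans[OF E(1) WH] E(2)] by blast
  define d where "d k v = V.representation B v k" for k v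
  have d: "functional (d k)" for k
    unfolding d_def
    by (rule linear_onI)
      (simp_all add: V.representation_add V.representation_scale B(3) subsetD[OF B(4)])
  have d_E: "d k j = (if k = j then 1 else 0)" if "k \<in> E" "j \<in> E" for k j
    using B that by (auto simp: d_def V.representation_basis)
  have expand: "(\<Sum>k\<in>E. smul H (d k w) k) = w" if "w \<in> W" for w
    using V.sum_representation_eq[of E w E] V.representation_extend[of B w E] that E B finE
    by (auto simp: d_def)
  have E_H: "k \<in> carrier H" if "k \<in> E" for k using that E WH by auto
  \<comment> \<open>\<open>\<Delta> j = \<Sum>k. k \<otimes> c\<^sub>k\<^sub>j\<close> for \<open>j\<close> in the basis \<open>E\<close>\<close>
  define c where "c k j = sweedler (\<lambda>x y. smul H (d k x) y) j" for k j
  have cH: "c k j \<in> carrier H" if "j \<in> E" for k j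
    unfolding c_def by (rule sweedler_closed) (use E_H that in auto)
  have gc: "g (c k j) = d k (hit g j)" if g: "functional g" and j: "j \<in> E" for g k j
  proof -
    have "g (c k j) = sweedler (\<lambda>x y. g (smul H (d k x) y)) j"
      unfolding c_def by (rule sweedler_linear[OF E_H[OF j] vector_space_field g]) simp
    also have "\<dots> = sweedler (\<lambda>x y. d k x * g y) j"
      by (rule sweedler_cong[OF E_H[OF j]]) (simp add: linear_onD[OF g])
    finally show ?thesis by (simp add: functional_hit[OF d g E_H[OF j]])
  qed
  have "comatrix E c"
    unfolding comatrix_def
  proof (intro conjI ballI allI impI)
    show "finite E" by (rule finE)
    fix k j assume k: "k \<in> E" and j: "j \<in> E"
    show "c k j \<in> carrier H" by (rule cH[OF j])
    show "counit H (c k j) = (if k = j then 1 else 0)"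
      using gc[OF functional_counit j] hit_counit[OF E_H[OF j]] d_E[OF k j] by simp
    fix f g assume f: "functional f" and g: "functional g"
    have "sweedler (\<lambda>x y. f x * g y) (c k j) = d k (hit f (hit g j))"
      using gc[OF functional_convolution[OF f g] j, of k] hit_hit[OF f g E_H[OF j]]
      by (simp add: convolution_def)
    also have "hit g j = (\<Sum>l\<in>E. smul H (d l (hit g j)) l)"
      using expand W_hit[OF g] E j by auto
    also have "hit f \<dots> = (\<Sum>l\<in>E. hit f (smul H (d l (hit g j)) l))"
      by (rule linear_on_sum[OF vector_space subspace vector_space linear_hit[OF f]]) (simp add: E_H)
    also have "\<dots> = (\<Sum>l\<in>E. smul H (g (c l j)) (hit f l))"
      by (intro sum.cong refl) (simp add: linear_onD(2)[OF linear_hit[OF f]] E_H gc[OF g j])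
    also have "d k \<dots> = (\<Sum>l\<in>E. f (c k l) * g (c l j))"
      using functional_sum[OF d, of E "\<lambda>l. smul H (g (c l j)) (hit f l)" k]
      by (simp add: hit_closed E_H linear_onD(2)[OF d] gc[OF f] mult.commute cong: sum.cong)
    finally show "sweedler (\<lambda>x y. f x * g y) (c k j) = (\<Sum>l\<in>E. f (c k l) * g (c l j))" .
  qed
  moreover have "h = (\<Sum>k\<in>E. \<Sum>j\<in>E. smul H (d j h * counit H k) (c k j))"
  proof -
    have "j = (\<Sum>k\<in>E. smul H (counit H k) (c k j))" if j: "j \<in> E" for j
    proof (rule functional_eqI)
      show "j \<in> carrier H" by (rule E_H[OF j])
      show "(\<Sum>k\<in>E. smul H (counit H k) (c k j)) \<in> carrier H"
        by (rule sum_closed) (simp add: cH j)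
      fix g assume g: "functional g"
      have "g j = g (sweedler (\<lambda>x y. smul H (counit H x) y) j)"
        by (simp add: sweedler_counit_left E_H j)
      also have "\<dots> = sweedler (\<lambda>x y. g (smul H (counit H x) y)) j"
        by (rule sweedler_linear[OF E_H[OF j] vector_space_field g]) simp
      also have "\<dots> = sweedler (\<lambda>x y. counit H x * g y) j"
        by (rule sweedler_cong[OF E_H[OF j]]) (simp add: linear_onD[OF g])
      also have "\<dots> = counit H (hit g j)"
        by (rule functional_hit[OF functional_counit g E_H[OF j], symmetric])
      also have "hit g j = (\<Sum>k\<in>E. smul H (d k (hit g j)) k)"
        using expand W_hit[OF g] E j by auto
      also have "counit H \<dots> = (\<Sum>k\<in>E. counit H (smul H (d k (hit g j)) k))"
        by (rule functional_sum[OF functional_counit]) (simp add: E_H)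
      also have "\<dots> = (\<Sum>k\<in>E. counit H k * g (c k j))"
        by (intro sum.cong refl) (simp add: counit_smul E_H gc[OF g j])
      also have "\<dots> = g (\<Sum>k\<in>E. smul H (counit H k) (c k j))"
        using functional_sum[OF g, of E "\<lambda>k. smul H (counit H k) (c k j)"]
        by (simp add: cH j linear_onD(2)[OF g])
      finally show "g j = g (\<Sum>k\<in>E. smul H (counit H k) (c k j))" .
    qed
    then have "smul H (d j h) j = (\<Sum>k\<in>E. smul H (d j h * counit H k) (c k j))" if "j \<in> E" for j
      using that V.scale_sum_right[of "d j h" "\<lambda>k. smul H (counit H k) (c k j)" E] by simp
    then have "h = (\<Sum>j\<in>E. \<Sum>k\<in>E. smul H (d j h * counit H k) (c k j))"
      using expand[OF hW] by simp
    then show ?thesis by (subst sum.swap)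
  qed
  ultimately show ?thesis
    by (intro exI[of _ E] exI[of _ c] exI[of _ "\<lambda>k j. d j h * counit H k"]) simp
qed

text \<open>
  It suffices to check linear statements on the entries of comatrices, whose coproducts are explicit.
\<close>
lemma comatrix_induct [consumes 1, case_names comatrix zero add smul]:
  assumes h: "h \<in> carrier H"
    and gen: "\<And>(N :: 'h set) c p q. comatrix N c \<Longrightarrow> p \<in> N \<Longrightarrow> q \<in> N \<Longrightarrow> P (c p q)"
    and zero: "P 0"
    and add: "\<And>g h. g \<in> carrier H \<Longrightarrow> h \<in> carrier H \<Longrightarrow> P g \<Longrightarrow> P h \<Longrightarrow> P (g + h)"
    and smul: "\<And>c h. h \<in> carrier H \<Longrightarrow> P h \<Longrightarrow> P (smul H c h)"
  shows "P h"
proof -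
  obtain N :: "'h set" and c z where c: "comatrix N c"
    and h_eq: "h = (\<Sum>p\<in>N. \<Sum>q\<in>N. smul H (z p q) (c p q))"
    using comatrix_spanning[OF h] by blast
  have sum: "(\<Sum>x\<in>M. f x) \<in> carrier H \<and> P (\<Sum>x\<in>M. f x)"
    if "finite M" "\<And>x. x \<in> M \<Longrightarrow> f x \<in> carrier H \<and> P (f x)" for f and M :: "'h set"
    using that by (induction M rule: finite_induct) (auto intro: zero add)
  have "h \<in> carrier H \<and> P h"
    unfolding h_eq using comatrixD[OF c] gen[OF c] by (intro sum) (auto intro: smul)
  then show ?thesis by simp
qed

lemma bilinear_antipode_left: "bilinear (smul H) (\<lambda>x y. antipode H x \<odot> y)"
  by (rule bilinear_onI)
    (simp_all add: antipode_add antipode_smul mul_add_left mul_add_right mul_smul_left mul_smul_right)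

lemma bilinear_antipode_right: "bilinear (smul H) (\<lambda>x y. x \<odot> antipode H y)"
  by (rule bilinear_onI)
    (simp_all add: antipode_add antipode_smul mul_add_left mul_add_right mul_smul_left mul_smul_right)

lemma comatrix_antipode_left:
  assumes "comatrix N c" "p \<in> N" "q \<in> N"
  shows "(\<Sum>r\<in>N. antipode H (c p r) \<odot> c r q) = (if p = q then \<one> else 0)"
  using comatrix_sweedler[OF assms(1) vector_space bilinear_antipode_left assms(2,3)]
    antipode_left[OF comatrixD(2)[OF assms]] comatrixD(3)[OF assms]
  by (auto simp: sweedler_def)

lemma comatrix_antipode_right:
  assumes "comatrix N c" "p \<in> N" "q \<in> N"
  shows "(\<Sum>r\<in>N. c p r \<odot> antipode H (c r q)) = (if p = q then \<one> else 0)"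
  using comatrix_sweedler[OF assms(1) vector_space bilinear_antipode_right assms(2,3)]
    antipode_right[OF comatrixD(2)[OF assms]] comatrixD(3)[OF assms]
  by (auto simp: sweedler_def)

lemma mul_zero [simp]: "x \<in> carrier H \<Longrightarrow> 0 \<odot> x = 0" "x \<in> carrier H \<Longrightarrow> x \<odot> 0 = 0"
  using mul_smul_left[of x x 0] mul_smul_right[of x x 0] by auto

lemma mul_sum_left:
  assumes "\<And>x. x \<in> N \<Longrightarrow> f x \<in> carrier H" "y \<in> carrier H"
  shows "(\<Sum>x\<in>N. f x) \<odot> y = (\<Sum>x\<in>N. f x \<odot> y)"
  by (rule linear_on_sum[OF vector_space subspace vector_space, of "\<lambda>x. x \<odot> y"])
    (use assms in \<open>auto intro!: linear_onI simp: mul_add_left mul_smul_left\<close>)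

lemma mul_sum_right:
  assumes "\<And>x. x \<in> N \<Longrightarrow> f x \<in> carrier H" "y \<in> carrier H"
  shows "y \<odot> (\<Sum>x\<in>N. f x) = (\<Sum>x\<in>N. y \<odot> f x)"
  by (rule linear_on_sum[OF vector_space subspace vector_space, of "\<lambda>x. y \<odot> x"])
    (use assms in \<open>auto intro!: linear_onI simp: mul_add_right mul_smul_right\<close>)

text \<open>\<open>x = x (y z) = (x y) z = z\<close> for matrices.\<close>
lemma matrix_inverse_unique:
  assumes N: "finite N"
    and closed: "\<And>p q. p \<in> N \<Longrightarrow> q \<in> N \<Longrightarrow> x p q \<in> carrier H \<and> y p q \<in> carrier H \<and> z p q \<in> carrier H"
    and left: "\<And>p q. p \<in> N \<Longrightarrow> q \<in> N \<Longrightarrow> (\<Sum>r\<in>N. x p r \<odot> y r q) = (if p = q then \<one> else 0)"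
    and right: "\<And>p q. p \<in> N \<Longrightarrow> q \<in> N \<Longrightarrow> (\<Sum>r\<in>N. y p r \<odot> z r q) = (if p = q then \<one> else 0)"
    and pq: "p \<in> N" "q \<in> N"
  shows "x p q = z p q"
proof -
  have "x p q = (\<Sum>r\<in>N. if r = q then x p r else 0)" using N pq by simp
  also have "\<dots> = (\<Sum>r\<in>N. x p r \<odot> (if r = q then \<one> else 0))"
    by (intro sum.cong refl) (use closed pq in \<open>auto simp: mul_unity_right\<close>)
  also have "\<dots> = (\<Sum>r\<in>N. x p r \<odot> (\<Sum>t\<in>N. y r t \<odot> z t q))"
    by (intro sum.cong refl) (use right pq in auto)
  also have "\<dots> = (\<Sum>r\<in>N. \<Sum>t\<in>N. (x p r \<odot> y r t) \<odot> z t q)"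
    using closed pq by (intro sum.cong refl) (simp add: mul_sum_right mul_assoc)
  also have "\<dots> = (\<Sum>t\<in>N. (\<Sum>r\<in>N. x p r \<odot> y r t) \<odot> z t q)"
    using closed pq by (subst sum.swap) (simp add: mul_sum_left)
  also have "\<dots> = (\<Sum>t\<in>N. if p = t then z t q else 0)"
    by (intro sum.cong refl) (use left closed pq in \<open>auto simp: mul_unity_left\<close>)
  also have "\<dots> = z p q" using N pq by simp
  finally show ?thesis .
qed

text \<open>Both \<open>\<Delta>\<close> and \<open>\<epsilon>\<close> are multiplicative.\<close>
lemma comatrix_mul:
  assumes c: "comatrix N c" and d: "comatrix M d"
  shows "comatrix (N \<times> M) (\<lambda>(p, p') (q, q'). c p q \<odot> d p' q')"
  unfolding comatrix_def
proof (intro conjI ballI allI impI)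
  show "finite (N \<times> M)" using comatrixD(1)[OF c] comatrixD(1)[OF d] by simp
  fix z w assume "z \<in> N \<times> M" "w \<in> N \<times> M"
  then obtain p p' q q' where zw: "z = (p, p')" "w = (q, q')"
    and in_N: "p \<in> N" "p' \<in> M" "q \<in> N" "q' \<in> M" by auto
  note cd = comatrixD(2,3)[OF c] comatrixD(2,3)[OF d]
  show "(case z of (p, p') \<Rightarrow> \<lambda>(q, q'). c p q \<odot> d p' q') w \<in> carrier H"
    using zw in_N cd by simp
  show "counit H ((case z of (p, p') \<Rightarrow> \<lambda>(q, q'). c p q \<odot> d p' q') w) = (if z = w then 1 else 0)"
    using zw in_N cd by (simp add: counit_mul)
  fix f g assume fg: "functional f" "functional g"
  let ?B = "\<lambda>x y. f x * g y"
  have inner: "sweedler (\<lambda>x' y'. ?B (x \<odot> x') (y \<odot> y')) (d p' q') =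
      (\<Sum>r'\<in>M. ?B (x \<odot> d p' r') (y \<odot> d r' q'))" if "x \<in> carrier H" "y \<in> carrier H" for x y
    by (rule comatrix_sweedler[OF d vector_space_field], rule bilinear_onI)
      (use that in_N in \<open>simp_all add: mul_add_right mul_smul_right linear_onD[OF fg(1)]
        linear_onD[OF fg(2)] algebra_simps\<close>)
  have "sweedler ?B (c p q \<odot> d p' q') =
      sweedler (\<lambda>x y. sweedler (\<lambda>x' y'. ?B (x \<odot> x') (y \<odot> y')) (d p' q')) (c p q)"
    by (rule sweedler_mul[OF vector_space_field bilinear_on_product[OF fg]])
      (use in_N cd in auto)
  also have "\<dots> = sweedler (\<lambda>x y. \<Sum>r'\<in>M. ?B (x \<odot> d p' r') (y \<odot> d r' q')) (c p q)"
    by (rule sweedler_cong) (use in_N cd inner in auto)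
  also have "\<dots> = (\<Sum>r\<in>N. \<Sum>r'\<in>M. ?B (c p r \<odot> d p' r') (c r q \<odot> d r' q'))"
    by (rule comatrix_sweedler[OF c vector_space_field], rule bilinear_onI)
      (use in_N cd in \<open>simp_all add: mul_add_left mul_smul_left linear_onD[OF fg(1)]
        linear_onD[OF fg(2)] algebra_simps sum.distrib sum_distrib_left\<close>)
  finally show "sweedler ?B ((case z of (p, p') \<Rightarrow> \<lambda>(q, q'). c p q \<odot> d p' q') w) =
      (\<Sum>r\<in>N \<times> M. f ((case z of (p, p') \<Rightarrow> \<lambda>(q, q'). c p q \<odot> d p' q') r) *
        g ((case r of (p, p') \<Rightarrow> \<lambda>(q, q'). c p q \<odot> d p' q') w))"
    by (simp add: zw sum.cartesian_product case_prod_unfold)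
qed

lemma antipode_unity: "antipode H \<one> = \<one>"
proof -
  have "sweedler (\<lambda>x y. antipode H x \<odot> y) \<one> = antipode H \<one> \<odot> \<one>"
    by (rule sweedler_unity[OF vector_space bilinear_antipode_left])
  moreover have "sweedler (\<lambda>x y. antipode H x \<odot> y) \<one> = \<one>"
    using antipode_left[OF unity_closed] by (simp add: sweedler_def counit_unity)
  ultimately show ?thesis by (simp add: mul_unity_right)
qed

text \<open>
  For comatrices \<open>c\<close> and \<open>d\<close>, both \<open>S(c\<^sub>p\<^sub>q d\<^sub>p\<^sub>'\<^sub>q\<^sub>')\<close> and \<open>S(d\<^sub>p\<^sub>'\<^sub>q\<^sub>') S(c\<^sub>p\<^sub>q)\<close> invert the matrix
  \<open>c\<^sub>p\<^sub>q d\<^sub>p\<^sub>'\<^sub>q\<^sub>'\<close>.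
\<close>
lemma antipode_mul:
  assumes "g \<in> carrier H" "h \<in> carrier H"
  shows "antipode H (g \<odot> h) = antipode H h \<odot> antipode H g"
  using assms(1)
proof (induction g rule: comatrix_induct)
  case gen: (comatrix N c p q)
  note c = gen(1)
  from assms(2) show ?case
  proof (induction h rule: comatrix_induct)
    case (comatrix M d p' q')
    note d = comatrix(1)
    note cd = comatrixD(2)[OF c] comatrixD(2)[OF d]
    note fin = comatrixD(1)[OF c] comatrixD(1)[OF d]
    let ?x = "\<lambda>(p, p') (q, q'). antipode H (c p q \<odot> d p' q')"
    let ?y = "\<lambda>(p, p') (q, q'). c p q \<odot> d p' q'"
    let ?z = "\<lambda>(p, p') (q, q'). antipode H (d p' q') \<odot> antipode H (c p q)"
    have "?x (p, p') (q, q') = ?z (p, p') (q, q')"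
    proof (rule matrix_inverse_unique[where N = "N \<times> M" and y = ?y and x = ?x and z = ?z])
      show "(\<Sum>r\<in>N \<times> M. ?x p r \<odot> ?y r q) = (if p = q then \<one> else 0)"
        if "p \<in> N \<times> M" "q \<in> N \<times> M" for p q
        using comatrix_antipode_left[OF comatrix_mul[OF c d] that]
        by (simp add: case_prod_unfold)
      show "(\<Sum>r\<in>N \<times> M. ?y z r \<odot> ?z r w) = (if z = w then \<one> else 0)"
        if "z \<in> N \<times> M" "w \<in> N \<times> M" for z w
      proof -
        obtain p p' q q' where zw: "z = (p, p')" "w = (q, q')" "p \<in> N" "p' \<in> M" "q \<in> N" "q' \<in> M"
          using \<open>z \<in> _\<close> \<open>w \<in> _\<close> by auto
        have "(\<Sum>r\<in>N \<times> M. ?y z r \<odot> ?z r w) =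
            (\<Sum>r\<in>N. \<Sum>r'\<in>M. (c p r \<odot> d p' r') \<odot> (antipode H (d r' q') \<odot> antipode H (c r q)))"
          by (simp add: zw sum.cartesian_product case_prod_unfold)
        also have "\<dots> = (\<Sum>r\<in>N. c p r \<odot> ((\<Sum>r'\<in>M. d p' r' \<odot> antipode H (d r' q')) \<odot> antipode H (c r q)))"
          using zw cd by (intro sum.cong refl) (simp add: mul_sum_left mul_sum_right mul_assoc)
        also have "\<dots> = (\<Sum>r\<in>N. if p' = q' then c p r \<odot> antipode H (c r q) else 0)"
          using zw cd comatrix_antipode_right[OF d, of p' q']
          by (intro sum.cong refl) (simp add: mul_unity_left)
        also have "\<dots> = (if z = w then \<one> else 0)"
          using zw comatrix_antipode_right[OF c, of p q] by (cases "p' = q'") auto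
        finally show ?thesis .
      qed
    qed (use comatrix gen cd fin in auto)
    then show ?case by simp
  next
    case (add h h')
    then show ?case using gen comatrixD(2)[OF c]
      by (simp add: mul_add_left mul_add_right antipode_add)
  next
    case (smul a h)
    then show ?case using gen comatrixD(2)[OF c]
      by (simp add: mul_smul_left mul_smul_right antipode_smul)
  qed (use gen comatrixD(2)[OF c] antipode_smul[of 0 0] in \<open>auto\<close>)
next
  case (add g g')
  then show ?case using assms(2) by (simp add: mul_add_left mul_add_right antipode_add)
next
  case (smul a g)
  then show ?case using assms(2) by (simp add: mul_smul_left mul_smul_right antipode_smul)
qed (use assms(2) antipode_smul[of 0 0] in auto)

lemma antipode_zero: "antipode H 0 = 0"
  using antipode_smul[of 0 0] by simp

lemma counit_antipode:
  assumes "h \<in> carrier H"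
  shows "counit H (antipode H h) = counit H h"
proof -
  have lin: "functional (\<lambda>h. counit H (antipode H h))"
    by (rule linear_onI) (simp_all add: antipode_add antipode_smul counit_add counit_smul)
  have "counit H (antipode H h) = sweedler (\<lambda>x y. counit H (antipode H x) * counit H y) h"
    using functional_hit[OF lin functional_counit assms] hit_counit[OF assms] by simp
  also have "\<dots> = sweedler (\<lambda>x y. counit H (antipode H x \<odot> y)) h"
    by (rule sweedler_cong[OF assms]) (simp add: counit_mul)
  also have "\<dots> = counit H (sweedler (\<lambda>x y. antipode H x \<odot> y) h)"
    by (rule sweedler_linear[OF assms vector_space_field functional_counit, symmetric]) simp
  also have "\<dots> = counit H h"
    using antipode_left[OF assms] by (simp add: sweedler_def counit_smul counit_unity)
  finally show ?thesis .
qed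

end

text \<open>
  A morphism of bialgebras maps comatrices to comatrices, hence inverses of comatrices to inverses
  of comatrices; so it commutes with the antipodes.
\<close>
lemma bialgebra_morphism_antipode:
  fixes H :: "('k::field, 'h::ab_group_add, 'm) hopf_scheme"
    and K :: "('k, 'g::ab_group_add, 'n) hopf_scheme"
  assumes "hopf_algebra H" "hopf_algebra K"
    and closed: "\<And>h. h \<in> carrier H \<Longrightarrow> \<psi> h \<in> carrier K"
    and lin: "linear_on (smul H) (carrier H) (smul K) \<psi>"
    and mul: "\<And>g h. g \<in> carrier H \<Longrightarrow> h \<in> carrier H \<Longrightarrow> \<psi> (g \<odot>\<^bsub>H\<^esub> h) = \<psi> g \<odot>\<^bsub>K\<^esub> \<psi> h"
    and one: "\<psi> \<one>\<^bsub>H\<^esub> = \<one>\<^bsub>K\<^esub>"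
    and comul: "\<And>h. h \<in> carrier H \<Longrightarrow>
          tensor_eq (smul K) (carrier K)
            [[x, y]. (x, y) \<leftarrow> comul K (\<psi> h)]
            [[\<psi> x, \<psi> y]. (x, y) \<leftarrow> comul H h]"
    and counit: "\<And>h. h \<in> carrier H \<Longrightarrow> counit K (\<psi> h) = counit H h"
    and h: "h \<in> carrier H"
  shows "\<psi> (antipode H h) = antipode K (\<psi> h)"
proof -
  interpret H: hopf_algebra H by fact
  interpret K: hopf_algebra K by fact
  have sw: "K.sweedler B (\<psi> h) = H.sweedler (\<lambda>x y. B (\<psi> x) (\<psi> y)) h"
    if "h \<in> carrier H" "vector_space s" "K.bilinear s B" for h B and s :: "'k \<Rightarrow> 'w::ab_group_add \<Rightarrow> 'w"
    using vector_space.tensor_eq_bilinear_words[OF that(2,3) comul[OF that(1)]]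
    by (simp add: H.sweedler_def K.sweedler_def o_def case_prod_unfold)
  have 0: "\<psi> 0 = 0" using linear_onD(2)[OF lin, of 0 0] by simp
  from h show ?thesis
  proof (induction h rule: H.comatrix_induct)
    case (comatrix N c p q)
    note c = H.comatrixD[OF comatrix(1)]
    have lin_c: "H.functional (\<lambda>x. f (\<psi> x))" if "K.functional f" for f
      by (rule linear_onI) (simp_all add: linear_onD[OF lin] linear_onD[OF that] closed)
    have psi_c: "K.comatrix N (\<lambda>p q. \<psi> (c p q))"
      unfolding K.comatrix_def
    proof (intro conjI ballI allI impI)
      fix p q f g assume pq: "p \<in> N" "q \<in> N" and fg: "K.functional f" "K.functional g"
      have "K.sweedler (\<lambda>x y. f x * g y) (\<psi> (c p q)) = H.sweedler (\<lambda>x y. f (\<psi> x) * g (\<psi> y)) (c p q)"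
        by (rule sw[OF c(2)[OF pq] vector_space_field bilinear_on_product[OF fg]])
      also have "\<dots> = (\<Sum>r\<in>N. f (\<psi> (c p r)) * g (\<psi> (c r q)))"
        by (rule H.comatrix_sweedler[OF comatrix(1) vector_space_field bilinear_on_product pq])
          (use lin_c fg in blast)+
      finally show "K.sweedler (\<lambda>x y. f x * g y) (\<psi> (c p q)) =
          (\<Sum>r\<in>N. f (\<psi> (c p r)) * g (\<psi> (c r q)))" .
    qed (simp_all add: c closed counit)
    show ?case
    proof (rule K.matrix_inverse_unique[OF c(1), where y = "\<lambda>p q. \<psi> (c p q)"
          and x = "\<lambda>p q. \<psi> (antipode H (c p q))" and z = "\<lambda>p q. antipode K (\<psi> (c p q))"])
      fix p q assume pq: "p \<in> N" "q \<in> N"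
      have "(\<Sum>r\<in>N. \<psi> (antipode H (c p r)) \<odot>\<^bsub>K\<^esub> \<psi> (c r q)) =
          (\<Sum>r\<in>N. \<psi> (antipode H (c p r) \<odot>\<^bsub>H\<^esub> c r q))"
        using pq by (intro sum.cong refl) (simp add: mul c)
      also have "\<dots> = \<psi> (\<Sum>r\<in>N. antipode H (c p r) \<odot>\<^bsub>H\<^esub> c r q)"
        by (rule linear_on_sum[OF H.vector_space H.subspace K.vector_space lin, symmetric])
          (simp add: c pq)
      also have "\<dots> = (if p = q then \<one>\<^bsub>K\<^esub> else 0)"
        by (simp add: H.comatrix_antipode_left[OF comatrix(1) pq] one 0)
      finally show "(\<Sum>r\<in>N. \<psi> (antipode H (c p r)) \<odot>\<^bsub>K\<^esub> \<psi> (c r q)) = (if p = q then \<one>\<^bsub>K\<^esub> else 0)" .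
      show "(\<Sum>r\<in>N. \<psi> (c p r) \<odot>\<^bsub>K\<^esub> antipode K (\<psi> (c r q))) = (if p = q then \<one>\<^bsub>K\<^esub> else 0)"
        by (rule K.comatrix_antipode_right[OF psi_c pq])
    qed (use comatrix c closed in auto)
  qed (simp_all add: 0 linear_onD[OF lin] closed H.antipode_zero K.antipode_zero H.antipode_add
      K.antipode_add H.antipode_smul K.antipode_smul)
qed

section \<open>Matrices of operators and their coefficient functions\<close>

text \<open>
  The antipode reverses products, so \<open>S\<^bsup>i\<^esup>(g h)\<close> acts as the product of the actions of \<open>S\<^bsup>i\<^esup>(g)\<close> and
  \<open>S\<^bsup>i\<^esup>(h)\<close> in an order that depends on the parity of \<open>i\<close>.
\<close>
definition twisted_comp :: "int \<Rightarrow> ('a \<Rightarrow> 'a) \<Rightarrow> ('a \<Rightarrow> 'a) \<Rightarrow> 'a \<Rightarrow> 'a"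
  where "twisted_comp i f g = (if even i then f \<circ> g else g \<circ> f)"

text \<open>
  The letter \<open>(i, a, b)\<close> stands for the functional that takes \<open>h\<close> to the \<open>b\<close>-coordinate of \<open>S\<^bsup>i\<^esup>(h) \<cdot> a\<close>,
  and words for convolution products of such functionals.
\<close>
type_synonym 'a word = "(int \<times> 'a \<times> 'a) list"

text \<open>
  The \<open>b\<close>-coordinate of \<open>S\<^bsup>i\<^esup>(g h) \<cdot> a\<close> is obtained by inserting an expansion into basis vectors \<open>c\<close>
  between the operators of \<open>g\<close> and \<open>h\<close>.  The left factor \<open>g\<close> acts last, from \<open>c\<close> to \<open>b\<close>, if \<open>i\<close> is even,
  and first, from \<open>a\<close> to \<open>c\<close>, if \<open>i\<close> is odd.
\<close>
fun left_letter :: "int \<times> 'a \<times> 'a \<Rightarrow> 'a \<Rightarrow> int \<times> 'a \<times> 'a"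
  where "left_letter (i, a, b) c = (if even i then (i, c, b) else (i, a, c))"

fun right_letter :: "int \<times> 'a \<times> 'a \<Rightarrow> 'a \<Rightarrow> int \<times> 'a \<times> 'a"
  where "right_letter (i, a, b) c = (if even i then (i, a, c) else (i, c, b))"

text \<open>
  The value of a product, with the intermediate basis vectors restricted to \<open>F\<close>.
\<close>
fun word_product :: "'a set \<Rightarrow> ('a word \<Rightarrow> 'k::field) \<Rightarrow> ('a word \<Rightarrow> 'k) \<Rightarrow> 'a word \<Rightarrow> 'k"
  where
    "word_product F \<phi> \<psi> [] = \<phi> [] * \<psi> []"
  | "word_product F \<phi> \<psi> (l # w) =
      (\<Sum>c\<in>F. word_product F (\<lambda>v. \<phi> (left_letter l c # v)) (\<lambda>v. \<psi> (right_letter l c # v)) w)"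

lemma sum_rotate:
  "(\<Sum>x\<in>A. \<Sum>y\<in>B. \<Sum>z\<in>C. f x y z) = (\<Sum>y\<in>B. \<Sum>z\<in>C. \<Sum>x\<in>A. f x y z)"
  by (rule trans[OF sum.swap], intro sum.cong refl, rule sum.swap)

lemma word_product_sum:
  "word_product F (\<lambda>v. \<Sum>j\<in>J. x j * \<Phi> j v) (\<lambda>v. \<Sum>k\<in>K. y k * \<Psi> k v) w =
    (\<Sum>j\<in>J. \<Sum>k\<in>K. x j * y k * word_product F (\<Phi> j) (\<Psi> k) w)"
proof (induction w arbitrary: \<Phi> \<Psi>)
  case Nil
  then show ?case by (simp add: sum_product algebra_simps)
next
  case (Cons l w)
  have "word_product F (\<lambda>v. \<Sum>j\<in>J. x j * \<Phi> j v) (\<lambda>v. \<Sum>k\<in>K. y k * \<Psi> k v) (l # w) =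
      (\<Sum>c\<in>F. \<Sum>j\<in>J. \<Sum>k\<in>K. x j * y k * word_product F (\<lambda>v. \<Phi> j (left_letter l c # v))
        (\<lambda>v. \<Psi> k (right_letter l c # v)) w)"
    by (simp add: Cons.IH)
  also have "\<dots> = (\<Sum>j\<in>J. \<Sum>k\<in>K. \<Sum>c\<in>F. x j * y k * word_product F (\<lambda>v. \<Phi> j (left_letter l c # v))
        (\<lambda>v. \<Psi> k (right_letter l c # v)) w)"
    by (rule sum_rotate)
  finally show ?case by (simp add: sum_distrib_left)
qed

lemma word_product_add_left:
  "word_product F (\<lambda>v. \<phi> v + \<phi>' v) \<psi> w = word_product F \<phi> \<psi> w + word_product F \<phi>' \<psi> w"
  by (induction w arbitrary: \<phi> \<phi>' \<psi>) (simp_all add: algebra_simps sum.distrib)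

lemma word_product_add_right:
  "word_product F \<phi> (\<lambda>v. \<psi> v + \<psi>' v) w = word_product F \<phi> \<psi> w + word_product F \<phi> \<psi>' w"
  by (induction w arbitrary: \<phi> \<psi> \<psi>') (simp_all add: algebra_simps sum.distrib)

lemma word_product_scale_left:
  "word_product F (\<lambda>v. c * \<phi> v) \<psi> w = c * word_product F \<phi> \<psi> w"
  by (induction w arbitrary: \<phi> \<psi>) (simp_all add: algebra_simps sum_distrib_left)

lemma word_product_scale_right:
  "word_product F \<phi> (\<lambda>v. c * \<psi> v) w = c * word_product F \<phi> \<psi> w"
  by (induction w arbitrary: \<phi> \<psi>) (simp_all add: algebra_simps sum_distrib_left)

text \<open>
  Every value of the functions in question involves finitely many basis vectors only, but no finite set
  serves for all of them; so the value of a product is the eventual one.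
\<close>
definition product_value :: "('a word \<Rightarrow> 'k::field) \<Rightarrow> ('a word \<Rightarrow> 'k) \<Rightarrow> 'a word \<Rightarrow> 'k \<Rightarrow> bool"
  where "product_value \<phi> \<psi> w v \<longleftrightarrow>
    (\<exists>F\<^sub>0. finite F\<^sub>0 \<and> (\<forall>F. finite F \<longrightarrow> F\<^sub>0 \<subseteq> F \<longrightarrow> word_product F \<phi> \<psi> w = v))"

definition coeff_mul :: "('a word \<Rightarrow> 'k::field) \<Rightarrow> ('a word \<Rightarrow> 'k) \<Rightarrow> 'a word \<Rightarrow> 'k"
  where "coeff_mul \<phi> \<psi> w = (THE v. product_value \<phi> \<psi> w v)"

lemma product_valueI:
  "finite F\<^sub>0 \<Longrightarrow> (\<And>F. finite F \<Longrightarrow> F\<^sub>0 \<subseteq> F \<Longrightarrow> word_product F \<phi> \<psi> w = v) \<Longrightarrow> product_value \<phi> \<psi> w v"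
  unfolding product_value_def by blast

lemma product_value_unique: "product_value \<phi> \<psi> w v \<Longrightarrow> product_value \<phi> \<psi> w v' \<Longrightarrow> v = v'"
  unfolding product_value_def by (metis finite_UnI sup_ge1 sup_ge2)

lemma coeff_mul_eqI: "product_value \<phi> \<psi> w v \<Longrightarrow> coeff_mul \<phi> \<psi> w = v"
  unfolding coeff_mul_def by (rule the_equality) (auto intro: product_value_unique)

lemma product_value_add_left:
  assumes "product_value \<phi> \<psi> w v" "product_value \<phi>' \<psi> w v'"
  shows "product_value (\<phi> + \<phi>') \<psi> w (v + v')"
proof -
  obtain F F' where F: "finite F" "finite F'"
    "\<And>G. finite G \<Longrightarrow> F \<subseteq> G \<Longrightarrow> word_product G \<phi> \<psi> w = v"
    "\<And>G. finite G \<Longrightarrow> F' \<subseteq> G \<Longrightarrow> word_product G \<phi>' \<psi> w = v'"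
    using assms unfolding product_value_def by metis
  then show ?thesis
    by (intro product_valueI[of "F \<union> F'"]) (auto simp: word_product_add_left plus_fun_def)
qed

lemma product_value_add_right:
  assumes "product_value \<phi> \<psi> w v" "product_value \<phi> \<psi>' w v'"
  shows "product_value \<phi> (\<psi> + \<psi>') w (v + v')"
proof -
  obtain F F' where F: "finite F" "finite F'"
    "\<And>G. finite G \<Longrightarrow> F \<subseteq> G \<Longrightarrow> word_product G \<phi> \<psi> w = v"
    "\<And>G. finite G \<Longrightarrow> F' \<subseteq> G \<Longrightarrow> word_product G \<phi> \<psi>' w = v'"
    using assms unfolding product_value_def by metis
  then show ?thesis
    by (intro product_valueI[of "F \<union> F'"]) (auto simp: word_product_add_right plus_fun_def)
qed

lemma product_value_scale_left:
  "product_value \<phi> \<psi> w v \<Longrightarrow> product_value (\<lambda>u. c * \<phi> u) \<psi> w (c * v)"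
  unfolding product_value_def by (metis word_product_scale_left)

lemma product_value_scale_right:
  "product_value \<phi> \<psi> w v \<Longrightarrow> product_value \<phi> (\<lambda>u. c * \<psi> u) w (c * v)"
  unfolding product_value_def by (metis word_product_scale_right)

text \<open>
  Functions are treated as vectors.  Expanding their sums pointwise would turn \<open>\<phi> + \<psi>\<close> into an
  abstraction to which the linearity rules no longer apply.
\<close>
declare plus_fun_apply [simp del]

text \<open>
  The powers of the antipode are indexed by \<open>I\<close>; the action has to preserve the functionals in \<open>T\<close> and
  to be trivial on \<open>Fix\<close>.
\<close>
locale measured_algebra = unital_algebra scale
  for scale :: "'k::field \<Rightarrow> 'a::{ring, monoid_mult} \<Rightarrow> 'a" +
  fixes I :: "int set" and basis :: "'a set" and T :: "('a \<Rightarrow> 'k) set" and Fix :: "'a set"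
  assumes independent_basis: "independent basis"
    and span_basis: "span basis = UNIV"
    and zero_in_I: "0 \<in> I"
    and succ_in_I: "i \<in> I \<Longrightarrow> i + 1 \<in> I"
    and linear_T: "t \<in> T \<Longrightarrow> linear_on scale UNIV (*) t"
    and one_in_Fix: "1 \<in> Fix"
begin

abbreviation operator :: "('a \<Rightarrow> 'a) \<Rightarrow> bool"
  where "operator \<equiv> linear_on scale UNIV scale"

definition coordinate :: "'a \<Rightarrow> 'a \<Rightarrow> 'k"
  where "coordinate b a = representation basis a b"

lemma in_span_basis: "a \<in> span basis"
  by (simp add: span_basis)

lemma linear_coordinate: "linear_on scale UNIV (*) (coordinate b)"
  unfolding coordinate_def
  by (rule linear_onI)
    (simp_all only: representation_add[OF independent_basis in_span_basis in_span_basis]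
      representation_scale[OF independent_basis in_span_basis])

lemma sum_coordinate: "(\<Sum>b | coordinate b a \<noteq> 0. scale (coordinate b a) b) = a"
  using sum_nonzero_representation_eq[OF independent_basis in_span_basis] by (simp add: coordinate_def)

lemma finite_coordinate: "finite {b. coordinate b a \<noteq> 0}"
  by (simp add: coordinate_def finite_representation)

lemma sum_coordinate_superset:
  assumes "finite F" "{b. coordinate b a \<noteq> 0} \<subseteq> F"
  shows "(\<Sum>b\<in>F. scale (coordinate b a) b) = a"
proof -
  have "(\<Sum>b\<in>F. scale (coordinate b a) b) = (\<Sum>b | coordinate b a \<noteq> 0. scale (coordinate b a) b)"
    by (rule sum.mono_neutral_right) (use assms in auto)
  then show ?thesis by (simp add: sum_coordinate)
qed

lemma coordinate_eqI:
  assumes "\<And>b. coordinate b x = coordinate b y"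
  shows "x = y"
proof -
  have "(\<Sum>b | coordinate b x \<noteq> 0. scale (coordinate b x) b) =
      (\<Sum>b | coordinate b y \<noteq> 0. scale (coordinate b y) b)"
    by (simp only: assms)
  then show ?thesis by (simp only: sum_coordinate)
qed

lemma operator_sum: "operator f \<Longrightarrow> f (\<Sum>x\<in>N. v x) = (\<Sum>x\<in>N. f (v x))"
  by (rule linear_on_sum[OF vector_space_axioms subspace_UNIV vector_space_axioms]) auto

lemma coordinate_sum: "coordinate b (\<Sum>x\<in>N. v x) = (\<Sum>x\<in>N. coordinate b (v x))"
  by (rule linear_on_sum[OF vector_space_axioms subspace_UNIV vector_space_field linear_coordinate]) auto

lemma T_sum: "t \<in> T \<Longrightarrow> t (\<Sum>x\<in>N. v x) = (\<Sum>x\<in>N. t (v x))"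
  by (rule linear_on_sum[OF vector_space_axioms subspace_UNIV vector_space_field linear_T]) auto

lemma coordinate_scale: "coordinate b (scale c a) = c * coordinate b a"
  using linear_onD(2)[OF linear_coordinate] by simp

lemma coordinate_add: "coordinate b (x + y) = coordinate b x + coordinate b y"
  using linear_onD(1)[OF linear_coordinate] by simp

lemma coordinate_zero [simp]: "coordinate b 0 = 0"
  using coordinate_scale[of b 0 0] by simp

lemma operator_zero: "operator f \<Longrightarrow> f 0 = 0"
  using linear_onD(2)[of scale UNIV scale f 0 0] by simp

lemma operator_comp: "operator f \<Longrightarrow> operator g \<Longrightarrow> operator (twisted_comp i f g)"
  by (rule linear_onI) (simp_all add: twisted_comp_def linear_onD[of scale UNIV scale])

text \<open>
  \<open>R i p q\<close> is thought of as the action of \<open>S\<^bsup>i\<^esup>(c\<^sub>p\<^sub>q)\<close> for a comatrix \<open>c\<close>.  The last two conditions state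
  the antipode axioms for \<open>S\<^bsup>i\<^esup>(c)\<close>.
\<close>
definition coeff_system :: "'i set \<Rightarrow> (int \<Rightarrow> 'i \<Rightarrow> 'i \<Rightarrow> 'a \<Rightarrow> 'a) \<Rightarrow> bool"
  where "coeff_system N R \<longleftrightarrow> finite N \<and>
    (\<forall>i\<in>I. \<forall>p\<in>N. \<forall>q\<in>N. operator (R i p q)) \<and>
    (\<forall>p\<in>N. \<forall>q\<in>N. \<forall>a b. R 0 p q (a * b) = (\<Sum>r\<in>N. R 0 p r a * R 0 r q b)) \<and>
    (\<forall>p\<in>N. \<forall>q\<in>N. \<forall>t\<in>T. \<forall>a. t (R 0 p q a) = (if p = q then t a else 0)) \<and>
    (\<forall>p\<in>N. \<forall>q\<in>N. \<forall>a\<in>Fix. R 0 p q a = (if p = q then a else 0)) \<and>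
    (\<forall>i\<in>I. \<forall>p\<in>N. \<forall>q\<in>N. \<forall>a.
      (\<Sum>r\<in>N. twisted_comp i (R i p r) (R (i + 1) r q) a) = (if p = q then a else 0) \<and>
      (\<Sum>r\<in>N. twisted_comp i (R (i + 1) p r) (R i r q) a) = (if p = q then a else 0))"

lemma coeff_systemD:
  assumes "coeff_system N R"
  shows "finite N"
    and "i \<in> I \<Longrightarrow> p \<in> N \<Longrightarrow> q \<in> N \<Longrightarrow> operator (R i p q)"
    and "p \<in> N \<Longrightarrow> q \<in> N \<Longrightarrow> R 0 p q (a * b) = (\<Sum>r\<in>N. R 0 p r a * R 0 r q b)"
    and "p \<in> N \<Longrightarrow> q \<in> N \<Longrightarrow> t \<in> T \<Longrightarrow> t (R 0 p q a) = (if p = q then t a else 0)"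
    and "p \<in> N \<Longrightarrow> q \<in> N \<Longrightarrow> a \<in> Fix \<Longrightarrow> R 0 p q a = (if p = q then a else 0)"
    and "i \<in> I \<Longrightarrow> p \<in> N \<Longrightarrow> q \<in> N \<Longrightarrow>
      (\<Sum>r\<in>N. twisted_comp i (R i p r) (R (i + 1) r q) a) = (if p = q then a else 0)"
    and "i \<in> I \<Longrightarrow> p \<in> N \<Longrightarrow> q \<in> N \<Longrightarrow>
      (\<Sum>r\<in>N. twisted_comp i (R (i + 1) p r) (R i r q) a) = (if p = q then a else 0)"
  using assms by (auto simp: coeff_system_def)

lemma coeff_systemI:
  assumes "finite N"
    and "\<And>i p q. i \<in> I \<Longrightarrow> p \<in> N \<Longrightarrow> q \<in> N \<Longrightarrow> operator (R i p q)"
    and "\<And>p q a b. p \<in> N \<Longrightarrow> q \<in> N \<Longrightarrow> R 0 p q (a * b) = (\<Sum>r\<in>N. R 0 p r a * R 0 r q b)"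
    and "\<And>p q t a. p \<in> N \<Longrightarrow> q \<in> N \<Longrightarrow> t \<in> T \<Longrightarrow> t (R 0 p q a) = (if p = q then t a else 0)"
    and "\<And>p q a. p \<in> N \<Longrightarrow> q \<in> N \<Longrightarrow> a \<in> Fix \<Longrightarrow> R 0 p q a = (if p = q then a else 0)"
    and "\<And>i p q a. i \<in> I \<Longrightarrow> p \<in> N \<Longrightarrow> q \<in> N \<Longrightarrow>
      (\<Sum>r\<in>N. twisted_comp i (R i p r) (R (i + 1) r q) a) = (if p = q then a else 0)"
    and "\<And>i p q a. i \<in> I \<Longrightarrow> p \<in> N \<Longrightarrow> q \<in> N \<Longrightarrow>
      (\<Sum>r\<in>N. twisted_comp i (R (i + 1) p r) (R i r q) a) = (if p = q then a else 0)"
  shows "coeff_system N R"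
  unfolding coeff_system_def by (intro conjI ballI allI assms)

text \<open>
  Letters with an index outside \<open>I\<close> have no meaning; a function that arises from a Hopf algebra is taken
  to vanish on them.
\<close>
fun entry :: "(int \<Rightarrow> 'i \<Rightarrow> 'i \<Rightarrow> 'a \<Rightarrow> 'a) \<Rightarrow> int \<times> 'a \<times> 'a \<Rightarrow> 'i \<Rightarrow> 'i \<Rightarrow> 'k"
  where "entry R (i, a, b) p q = (if i \<in> I then coordinate b (R i p q a) else 0)"

fun coeff :: "'i set \<Rightarrow> (int \<Rightarrow> 'i \<Rightarrow> 'i \<Rightarrow> 'a \<Rightarrow> 'a) \<Rightarrow> 'i \<Rightarrow> 'i \<Rightarrow> 'a word \<Rightarrow> 'k"
  where
    "coeff N R p q [] = (if p = q then 1 else 0)"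
  | "coeff N R p q (l # w) = (\<Sum>r\<in>N. entry R l p r * coeff N R r q w)"

lemma coeff_append:
  assumes "finite N" "p \<in> N"
  shows "coeff N R p q (u @ v) = (\<Sum>r\<in>N. coeff N R p r u * coeff N R r q v)"
  using assms(2)
proof (induction u arbitrary: p)
  case Nil
  have "(\<Sum>r\<in>N. coeff N R p r [] * coeff N R r q v) =
      (\<Sum>r\<in>N. if r = p then coeff N R r q v else 0)"
    by (intro sum.cong) auto
  then show ?case using Nil assms(1) by simp
next
  case (Cons l u)
  have "coeff N R p q ((l # u) @ v) =
      (\<Sum>s\<in>N. \<Sum>r\<in>N. entry R l p s * (coeff N R s r u * coeff N R r q v))"
    using Cons by (simp add: sum_distrib_left)
  also have "\<dots> = (\<Sum>r\<in>N. coeff N R p r (l # u) * coeff N R r q v)"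
    by (subst sum.swap) (simp add: sum_distrib_right mult.assoc)
  finally show ?case .
qed

lemma coeff_singleton:
  assumes "finite N" "q \<in> N"
  shows "coeff N R p q [l] = entry R l p q"
proof -
  have "coeff N R p q [l] = (\<Sum>r\<in>N. if r = q then entry R l p r else 0)"
    by (simp, intro sum.cong) auto
  then show ?thesis using assms by simp
qed

lemma coeff_reindex:
  assumes f: "bij_betw f N M"
    and R: "\<And>i p q. i \<in> I \<Longrightarrow> p \<in> N \<Longrightarrow> q \<in> N \<Longrightarrow> R' i (f p) (f q) = R i p q"
    and pq: "p \<in> N" "q \<in> N"
  shows "coeff M R' (f p) (f q) w = coeff N R p q w"
  using pq(1)
proof (induction w arbitrary: p)
  case Nil
  then show ?case using f pq(2) by (auto simp: bij_betw_def inj_on_eq_iff)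
next
  case (Cons l w)
  obtain i a b where l: "l = (i, a, b)" by (cases l) auto
  have "coeff M R' (f p) (f q) (l # w) =
      (\<Sum>r\<in>N. entry R' l (f p) (f r) * coeff M R' (f r) (f q) w)"
    by (simp add: sum.reindex_bij_betw[OF f, symmetric])
  also have "\<dots> = coeff N R p q (l # w)"
    by (simp, intro sum.cong refl) (use Cons R l in auto)
  finally show ?case .
qed

lemma coeff_cong:
  assumes "\<And>i p q. i \<in> I \<Longrightarrow> p \<in> N \<Longrightarrow> q \<in> N \<Longrightarrow> R' i p q = R i p q" "p \<in> N" "q \<in> N"
  shows "coeff N R' p q w = coeff N R p q w"
  using coeff_reindex[of id N N R' R] assms by simp

text \<open>
  Index sets of natural numbers suffice, since every finite index set is in bijection with one of these;
  without a fixed index type the union over all systems could not be formed.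
\<close>
inductive_set coeff_space :: "('a word \<Rightarrow> 'k) set"
  where
    coeff: "coeff_system N R \<Longrightarrow> p \<in> (N :: nat set) \<Longrightarrow> q \<in> N \<Longrightarrow>
      coeff N R p q \<in> coeff_space"
  | add: "\<phi> \<in> coeff_space \<Longrightarrow> \<psi> \<in> coeff_space \<Longrightarrow> \<phi> + \<psi> \<in> coeff_space"
  | scale: "\<phi> \<in> coeff_space \<Longrightarrow> (\<lambda>w. c * \<phi> w) \<in> coeff_space"

abbreviation "\<U> \<equiv> coeff_space"

lemma coeff_space_add: "\<phi> \<in> \<U> \<Longrightarrow> \<psi> \<in> \<U> \<Longrightarrow> \<phi> + \<psi> \<in> \<U>"
  using coeff_space.add by (simp add: plus_fun_def)

lemma coeff_space_induct [consumes 1, case_names coeff add scale]: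
  assumes "\<phi> \<in> \<U>"
    and "\<And>(N :: nat set) R p q. coeff_system N R \<Longrightarrow> p \<in> N \<Longrightarrow> q \<in> N \<Longrightarrow> P (coeff N R p q)"
    and "\<And>\<phi> \<psi>. \<phi> \<in> \<U> \<Longrightarrow> \<psi> \<in> \<U> \<Longrightarrow> P \<phi> \<Longrightarrow> P \<psi> \<Longrightarrow> P (\<phi> + \<psi>)"
    and "\<And>\<phi> c. \<phi> \<in> \<U> \<Longrightarrow> P \<phi> \<Longrightarrow> P (\<lambda>w. c * \<phi> w)"
  shows "P \<phi>"
  using assms(1)
proof (induction \<phi> rule: coeff_space.induct)
  case (add \<phi> \<psi>)
  then show ?case using assms(3) by (simp add: plus_fun_def)
qed (use assms in auto)

lemma coeff_system_reindex:
  assumes R: "coeff_system N R" and g: "bij_betw g M N"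
  shows "coeff_system M (\<lambda>i p q. R i (g p) (g q))"
proof (rule coeff_systemI)
  note D = coeff_systemD[OF R]
  have gN: "g p \<in> N" if "p \<in> M" for p using g that by (auto simp: bij_betw_def)
  have inj: "g p = g q \<longleftrightarrow> p = q" if "p \<in> M" "q \<in> M" for p q
    using g that by (auto simp: bij_betw_def inj_on_eq_iff)
  note sum = sum.reindex_bij_betw[OF g]
  show "finite M" using D(1) g by (simp add: bij_betw_finite)
  show "operator (R i (g p) (g q))" if "i \<in> I" "p \<in> M" "q \<in> M" for i p q
    using D(2) that gN by simp
  show "R 0 (g p) (g q) (a * b) = (\<Sum>r\<in>M. R 0 (g p) (g r) a * R 0 (g r) (g q) b)"
    if "p \<in> M" "q \<in> M" for p q a b
    using D(3)[of "g p" "g q"] that gN sum[of "\<lambda>r. R 0 (g p) r a * R 0 r (g q) b"] by simp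
  show "t (R 0 (g p) (g q) a) = (if p = q then t a else 0)" if "p \<in> M" "q \<in> M" "t \<in> T" for p q t a
    using D(4)[of "g p" "g q"] that gN inj by simp
  show "R 0 (g p) (g q) a = (if p = q then a else 0)" if "p \<in> M" "q \<in> M" "a \<in> Fix" for p q a
    using D(5)[of "g p" "g q"] that gN inj by simp
  show "(\<Sum>r\<in>M. twisted_comp i (R i (g p) (g r)) (R (i + 1) (g r) (g q)) a) = (if p = q then a else 0)"
    if "i \<in> I" "p \<in> M" "q \<in> M" for i p q a
    using D(6)[of i "g p" "g q"] that gN inj sum[of "\<lambda>r. twisted_comp i (R i (g p) r) (R (i + 1) r (g q)) a"]
    by simp
  show "(\<Sum>r\<in>M. twisted_comp i (R (i + 1) (g p) (g r)) (R i (g r) (g q)) a) = (if p = q then a else 0)"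
    if "i \<in> I" "p \<in> M" "q \<in> M" for i p q a
    using D(7)[of i "g p" "g q"] that gN inj sum[of "\<lambda>r. twisted_comp i (R (i + 1) (g p) r) (R i r (g q)) a"]
    by simp
qed

lemma coeff_in_space:
  assumes R: "coeff_system N R" and pq: "p \<in> N" "q \<in> N"
  shows "coeff N R p q \<in> \<U>"
proof -
  obtain h where h: "bij_betw h N {0..<card N}"
    using ex_bij_betw_finite_nat[OF coeff_systemD(1)[OF R]] by blast
  define g where "g = inv_into N h"
  have g: "bij_betw g {0..<card N} N" unfolding g_def by (rule bij_betw_inv_into[OF h])
  have gh: "g (h r) = r" if "r \<in> N" for r
    using h that by (simp add: g_def bij_betw_inv_into_left)
  let ?R = "\<lambda>i p q. R i (g p) (g q)"
  have "coeff {0..<card N} ?R (h p) (h q) \<in> \<U>"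
    by (rule coeff_space.coeff[OF coeff_system_reindex[OF R g]])
      (use h pq in \<open>auto simp: bij_betw_def\<close>)
  also have "coeff {0..<card N} ?R (h p) (h q) = coeff N R p q"
    using gh pq by (intro ext coeff_reindex[OF h]) auto
  finally show ?thesis .
qed

subsection \<open>Tensor products of systems\<close>

definition tensor_system ::
    "(int \<Rightarrow> 'i \<Rightarrow> 'i \<Rightarrow> 'a \<Rightarrow> 'a) \<Rightarrow> (int \<Rightarrow> 'j \<Rightarrow> 'j \<Rightarrow> 'a \<Rightarrow> 'a) \<Rightarrow> int \<Rightarrow> 'i \<times> 'j \<Rightarrow> 'i \<times> 'j \<Rightarrow> 'a \<Rightarrow> 'a"
  where "tensor_system R R' i p q = twisted_comp i (R i (fst p) (fst q)) (R' i (snd p) (snd q))"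

text \<open>
  This is the system of the comatrix \<open>c\<^sub>p\<^sub>q d\<^sub>p\<^sub>'\<^sub>q\<^sub>'\<close>.  For the inverse, the factors that belong to \<open>d\<close> meet
  in the middle and cancel first, then those that belong to \<open>c\<close>; it is the other way round in the
  second condition.
\<close>
lemma coeff_system_tensor:
  assumes R: "coeff_system N R" and R': "coeff_system M R'"
  shows "coeff_system (N \<times> M) (tensor_system R R')"
proof (rule coeff_systemI)
  note D = coeff_systemD[OF R] and D' = coeff_systemD[OF R']
  show "finite (N \<times> M)" using D(1) D'(1) by simp
  show "operator (tensor_system R R' i p q)" if "i \<in> I" "p \<in> N \<times> M" "q \<in> N \<times> M" for i p q
    unfolding tensor_system_def using that D(2) D'(2) by (intro operator_comp) auto
  fix p q assume "p \<in> N \<times> M" "q \<in> N \<times> M"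
  then obtain x x' y y' where pq: "p = (x, x')" "q = (y, y')" "x \<in> N" "x' \<in> M" "y \<in> N" "y' \<in> M"
    by auto
  show "tensor_system R R' 0 p q (a * b) =
      (\<Sum>r\<in>N \<times> M. tensor_system R R' 0 p r a * tensor_system R R' 0 r q b)" for a b
  proof -
    have "tensor_system R R' 0 p q (a * b) = (\<Sum>r'\<in>M. R 0 x y (R' 0 x' r' a * R' 0 r' y' b))"
      using pq D'(3) operator_sum[OF D(2)[OF zero_in_I]] by (simp add: tensor_system_def twisted_comp_def)
    also have "\<dots> = (\<Sum>r'\<in>M. \<Sum>r\<in>N. R 0 x r (R' 0 x' r' a) * R 0 r y (R' 0 r' y' b))"
      using pq D(3) by simp
    also have "\<dots> = (\<Sum>r\<in>N \<times> M. tensor_system R R' 0 p r a * tensor_system R R' 0 r q b)"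
      by (subst sum.swap) (simp add: sum.cartesian_product case_prod_unfold pq tensor_system_def twisted_comp_def)
    finally show ?thesis .
  qed
  show "t (tensor_system R R' 0 p q a) = (if p = q then t a else 0)" if "t \<in> T" for t a
    using pq D(4)[OF _ _ that] D'(4)[OF _ _ that] by (simp add: tensor_system_def twisted_comp_def)
  show "tensor_system R R' 0 p q a = (if p = q then a else 0)" if "a \<in> Fix" for a
    using that pq D(5) D'(5) operator_zero[OF D(2)[OF zero_in_I]]
    by (simp add: tensor_system_def twisted_comp_def)
  fix i a assume i: "i \<in> I"
  note op = D(2)[OF i] D(2)[OF succ_in_I[OF i]] D'(2)[OF i] D'(2)[OF succ_in_I[OF i]]
  have "(\<Sum>r\<in>N \<times> M. twisted_comp i (tensor_system R R' i p r) (tensor_system R R' (i + 1) r q) a) =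
      (\<Sum>r\<in>N. \<Sum>r'\<in>M. twisted_comp i (twisted_comp i (R i x r) (twisted_comp i (R' i x' r') (R' (i + 1) r' y')))
        (R (i + 1) r y) a)"
    by (cases "even i";
        simp add: sum.cartesian_product case_prod_unfold pq tensor_system_def twisted_comp_def)
  also have "\<dots> = (\<Sum>r\<in>N. twisted_comp i (twisted_comp i (R i x r)
        (\<lambda>a. \<Sum>r'\<in>M. twisted_comp i (R' i x' r') (R' (i + 1) r' y') a)) (R (i + 1) r y) a)"
    using pq op by (intro sum.cong refl) (simp add: twisted_comp_def operator_sum)
  also have "\<dots> = (\<Sum>r\<in>N. if x' = y' then twisted_comp i (R i x r) (R (i + 1) r y) a else 0)"
    using pq op D'(6)[OF i] by (intro sum.cong refl) (simp add: twisted_comp_def operator_zero)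
  also have "\<dots> = (if p = q then a else 0)"
    using pq D(6)[OF i] by (cases "x' = y'") simp_all
  finally show "(\<Sum>r\<in>N \<times> M. twisted_comp i (tensor_system R R' i p r) (tensor_system R R' (i + 1) r q) a) =
      (if p = q then a else 0)" .
  have "(\<Sum>r\<in>N \<times> M. twisted_comp i (tensor_system R R' (i + 1) p r) (tensor_system R R' i r q) a) =
      (\<Sum>r\<in>N. \<Sum>r'\<in>M. twisted_comp i (twisted_comp i (R' (i + 1) x' r')
        (twisted_comp i (R (i + 1) x r) (R i r y))) (R' i r' y') a)"
    by (cases "even i";
        simp add: sum.cartesian_product case_prod_unfold pq tensor_system_def twisted_comp_def)
  also have "\<dots> = (\<Sum>r'\<in>M. twisted_comp i (twisted_comp i (R' (i + 1) x' r')
        (\<lambda>a. \<Sum>r\<in>N. twisted_comp i (R (i + 1) x r) (R i r y) a)) (R' i r' y') a)"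
    using pq op by (subst sum.swap, intro sum.cong refl) (simp add: twisted_comp_def operator_sum)
  also have "\<dots> = (\<Sum>r'\<in>M. if x = y then twisted_comp i (R' (i + 1) x' r') (R' i r' y') a else 0)"
    using pq op D(7)[OF i] by (intro sum.cong refl) (simp add: twisted_comp_def operator_zero)
  also have "\<dots> = (if p = q then a else 0)"
    using pq D'(7)[OF i] by (cases "x = y") simp_all
  finally show "(\<Sum>r\<in>N \<times> M. twisted_comp i (tensor_system R R' (i + 1) p r) (tensor_system R R' i r q) a) =
      (if p = q then a else 0)" .
qed

lemma entry_tensor:
  assumes R: "coeff_system N R" and R': "coeff_system M R'"
    and pq: "p \<in> N" "q \<in> N" "p' \<in> M" "q' \<in> M"
    and F: "finite F" "{c. coordinate c (R i p q a) \<noteq> 0} \<subseteq> F" "{c. coordinate c (R' i p' q' a) \<noteq> 0} \<subseteq> F"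
  shows "entry (tensor_system R R') (i, a, b) (p, p') (q, q') =
    (\<Sum>c\<in>F. entry R (left_letter (i, a, b) c) p q * entry R' (right_letter (i, a, b) c) p' q')"
proof (cases "i \<in> I")
  case True
  note op = coeff_systemD(2)[OF R True pq(1,2)] coeff_systemD(2)[OF R' True pq(3,4)]
  have expand: "coordinate b (f x) = (\<Sum>c\<in>F. coordinate b (f c) * coordinate c x)"
    if "operator f" "{c. coordinate c x \<noteq> 0} \<subseteq> F" for f x
  proof -
    have "coordinate b (f x) = coordinate b (f (\<Sum>c\<in>F. scale (coordinate c x) c))"
      using sum_coordinate_superset[OF F(1) that(2)] by simp
    then show ?thesis
      by (simp add: operator_sum[OF that(1)] coordinate_sum linear_onD(2)[OF that(1)]
          coordinate_scale mult.commute)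
  qed
  show ?thesis
    using True expand[OF op(1) F(3)] expand[OF op(2) F(2)]
    by (simp add: tensor_system_def twisted_comp_def mult.commute)
qed (cases "even i"; simp)

text \<open>
  Between the two operators that a letter composes, the argument of the outer one is expanded into basis
  vectors, of which only those in the supports of finitely many vectors contribute.
\<close>
lemma coeff_tensor:
  assumes R: "coeff_system N R" and R': "coeff_system M R'"
    and pq: "p \<in> N" "q \<in> N" "p' \<in> M" "q' \<in> M"
  shows "product_value (coeff N R p q) (coeff M R' p' q') w
    (coeff (N \<times> M) (tensor_system R R') (p, p') (q, q') w)"
proof -
  define supp where "supp l = (case l of (i, a, b) \<Rightarrow>
    (\<Union>p\<in>N. \<Union>q\<in>N. {c. coordinate c (R i p q a) \<noteq> 0}) \<union>
    (\<Union>p\<in>M. \<Union>q\<in>M. {c. coordinate c (R' i p q a) \<noteq> 0}))" for l :: "int \<times> 'a \<times> 'a"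
  have fin: "finite N" "finite M" using R R' by (auto simp: coeff_systemD(1))
  have "finite (supp l)" for l
    using fin finite_coordinate by (cases l) (simp add: supp_def)
  then have "finite (\<Union>l\<in>set w. supp l)" by auto
  then show ?thesis
  proof (rule product_valueI)
    fix F assume "finite F" "(\<Union>l\<in>set w. supp l) \<subseteq> F"
    then show "word_product F (coeff N R p q) (coeff M R' p' q') w =
      coeff (N \<times> M) (tensor_system R R') (p, p') (q, q') w"
      using pq(1,3)
    proof (induction w arbitrary: p p')
      case Nil
      then show ?case by simp
    next
      case (Cons l w)
      have entry: "entry (tensor_system R R') l (p, p') (r, r') =
          (\<Sum>c\<in>F. entry R (left_letter l c) p r * entry R' (right_letter l c) p' r')"
        if "r \<in> N" "r' \<in> M" for r r'
      proof -
        obtain i a b where l: "l = (i, a, b)" by (cases l) auto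
        have "supp l \<subseteq> F" using Cons.prems(2) by auto
        moreover have "{c. coordinate c (R i p r a) \<noteq> 0} \<subseteq> supp l"
          "{c. coordinate c (R' i p' r' a) \<noteq> 0} \<subseteq> supp l"
          unfolding supp_def l using Cons.prems that by auto
        ultimately have "{c. coordinate c (R i p r a) \<noteq> 0} \<subseteq> F"
          "{c. coordinate c (R' i p' r' a) \<noteq> 0} \<subseteq> F" by auto
        then show ?thesis
          unfolding l using entry_tensor[OF R R' Cons.prems(3) that(1) Cons.prems(4) that(2) Cons.prems(1)]
          by blast
      qed
      have "word_product F (coeff N R p q) (coeff M R' p' q') (l # w) =
          (\<Sum>c\<in>F. \<Sum>r\<in>N. \<Sum>r'\<in>M. entry R (left_letter l c) p r * entry R' (right_letter l c) p' r' *
            word_product F (coeff N R r q) (coeff M R' r' q') w)"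
        by (simp add: word_product_sum)
      also have "\<dots> = (\<Sum>r\<in>N. \<Sum>r'\<in>M. \<Sum>c\<in>F. entry R (left_letter l c) p r * entry R' (right_letter l c) p' r' *
            word_product F (coeff N R r q) (coeff M R' r' q') w)"
        by (rule sum_rotate)
      also have "\<dots> = (\<Sum>r\<in>N. \<Sum>r'\<in>M. entry (tensor_system R R') l (p, p') (r, r') *
            coeff (N \<times> M) (tensor_system R R') (r, r') (q, q') w)"
        using Cons by (intro sum.cong refl) (simp add: entry sum_distrib_right)
      also have "\<dots> = coeff (N \<times> M) (tensor_system R R') (p, p') (q, q') (l # w)"
        by (simp add: sum.cartesian_product case_prod_unfold)
      finally show ?case .
    qed
  qed
qed

lemma coeff_mul_coeff:
  assumes "coeff_system N R" "coeff_system M R'"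
    and "p \<in> N" "q \<in> N" "p' \<in> M" "q' \<in> M"
  shows "coeff_mul (coeff N R p q) (coeff M R' p' q') =
    coeff (N \<times> M) (tensor_system R R') (p, p') (q, q')"
  using coeff_tensor[OF assms] by (intro ext coeff_mul_eqI)

lemma product_value_space:
  assumes "\<phi> \<in> \<U>" "\<psi> \<in> \<U>"
  shows "product_value \<phi> \<psi> w (coeff_mul \<phi> \<psi> w)"
proof -
  have "\<exists>v. product_value \<phi> \<psi> w v"
    using assms(1)
  proof (induction \<phi> rule: coeff_space_induct)
    case R: (coeff N R p q)
    from assms(2) show ?case
    proof (induction \<psi> rule: coeff_space_induct)
      case (coeff M R' p' q')
      then show ?case using coeff_tensor[OF R(1) coeff(1) R(2,3) coeff(2,3)] by blast
    qed (blast intro: product_value_add_right product_value_scale_right)+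
  qed (blast intro: product_value_add_left product_value_scale_left)+
  then show ?thesis using coeff_mul_eqI by metis
qed

lemma coeff_mul_add_left:
  assumes "\<phi> \<in> \<U>" "\<phi>' \<in> \<U>" "\<psi> \<in> \<U>"
  shows "coeff_mul (\<phi> + \<phi>') \<psi> = coeff_mul \<phi> \<psi> + coeff_mul \<phi>' \<psi>"
  by (rule ext, rule coeff_mul_eqI)
    (simp add: plus_fun_apply product_value_add_left product_value_space assms)

lemma coeff_mul_add_right:
  assumes "\<phi> \<in> \<U>" "\<psi> \<in> \<U>" "\<psi>' \<in> \<U>"
  shows "coeff_mul \<phi> (\<psi> + \<psi>') = coeff_mul \<phi> \<psi> + coeff_mul \<phi> \<psi>'"
  by (rule ext, rule coeff_mul_eqI)
    (simp add: plus_fun_apply product_value_add_right product_value_space assms)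

lemma coeff_mul_scale_left:
  assumes "\<phi> \<in> \<U>" "\<psi> \<in> \<U>"
  shows "coeff_mul (\<lambda>w. c * \<phi> w) \<psi> = (\<lambda>w. c * coeff_mul \<phi> \<psi> w)"
  by (rule ext, rule coeff_mul_eqI)
    (simp add: product_value_scale_left product_value_space assms)

lemma coeff_mul_scale_right:
  assumes "\<phi> \<in> \<U>" "\<psi> \<in> \<U>"
  shows "coeff_mul \<phi> (\<lambda>w. c * \<psi> w) = (\<lambda>w. c * coeff_mul \<phi> \<psi> w)"
  by (rule ext, rule coeff_mul_eqI)
    (simp add: product_value_scale_right product_value_space assms)

lemma coeff_mul_closed:
  assumes "\<phi> \<in> \<U>" "\<psi> \<in> \<U>"
  shows "coeff_mul \<phi> \<psi> \<in> \<U>"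
  using assms(1)
proof (induction \<phi> rule: coeff_space_induct)
  case R: (coeff N R p q)
  from assms(2) show ?case
  proof (induction \<psi> rule: coeff_space_induct)
    case (coeff M R' p' q')
    then show ?case
      using coeff_in_space[OF coeff_system_tensor[OF R(1) coeff(1)], of "(p, p')" "(q, q')"]
        coeff_mul_coeff[OF R(1) coeff(1) R(2,3) coeff(2,3)] R by simp
  next
    case (add \<psi> \<psi>')
    then show "coeff_mul (coeff N R p q) (\<psi> + \<psi>') \<in> \<U>"
      using coeff_mul_add_right[OF coeff_space.coeff[OF R] add(1,2)]
        coeff_space_add[OF add(3,4)] by simp
  next
    case (scale \<psi> c)
    then show ?case
      using coeff_mul_scale_right[OF coeff_space.coeff[OF R] scale(1)]
        coeff_space.scale[OF scale(2)] by simp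
  qed
qed (use assms(2) in \<open>simp_all add: coeff_mul_add_left coeff_mul_scale_left
      coeff_space.intros\<close>)

lemma coeff_mul_assoc:
  assumes "\<phi> \<in> \<U>" "\<psi> \<in> \<U>" "\<chi> \<in> \<U>"
  shows "coeff_mul (coeff_mul \<phi> \<psi>) \<chi> =
    coeff_mul \<phi> (coeff_mul \<psi> \<chi>)"
  using assms(1)
proof (induction \<phi> rule: coeff_space_induct)
  case R: (coeff N R p q)
  note R_space = coeff_space.coeff[OF R]
  from assms(2) show ?case
  proof (induction \<psi> rule: coeff_space_induct)
    case R': (coeff M R' p' q')
    note R'_space = coeff_space.coeff[OF R']
    from assms(3) show ?case
    proof (induction \<chi> rule: coeff_space_induct)
      case R'': (coeff L R'' p'' q'')
      let ?f = "\<lambda>((x, y), z). (x, (y, z))"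
      have f: "bij_betw ?f ((N \<times> M) \<times> L) (N \<times> (M \<times> L))"
        by (rule bij_betwI[of _ _ _ "\<lambda>(x, (y, z)). ((x, y), z)"]) auto
      have "coeff_mul (coeff_mul (coeff N R p q) (coeff M R' p' q'))
          (coeff L R'' p'' q'') =
        coeff ((N \<times> M) \<times> L) (tensor_system (tensor_system R R') R'') ((p, p'), p'') ((q, q'), q'')"
        using R R' R'' by (simp add: coeff_mul_coeff coeff_system_tensor)
      also have "\<dots> = coeff (N \<times> (M \<times> L)) (tensor_system R (tensor_system R' R''))
          (?f ((p, p'), p'')) (?f ((q, q'), q''))"
        by (rule ext, rule coeff_reindex[OF f, symmetric])
          (use R R' R'' in \<open>auto simp: tensor_system_def twisted_comp_def\<close>)
      also have "\<dots> = coeff_mul (coeff N R p q)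
          (coeff_mul (coeff M R' p' q') (coeff L R'' p'' q''))"
        using R R' R'' by (simp add: coeff_mul_coeff coeff_system_tensor)
      finally show ?case .
    next
      case (add \<phi> \<psi>)
      then show "coeff_mul (coeff_mul (coeff N R p q) (coeff M R' p' q')) (\<phi> + \<psi>) =
          coeff_mul (coeff N R p q) (coeff_mul (coeff M R' p' q') (\<phi> + \<psi>))"
        by (simp only: coeff_mul_add_right coeff_mul_closed R_space R'_space)
    qed (simp_all add: coeff_mul_scale_right coeff_mul_closed R_space R'_space)
  qed (use assms(3) in \<open>simp_all add: coeff_mul_add_right coeff_mul_scale_right
        coeff_mul_add_left coeff_mul_scale_left coeff_mul_closed R_space\<close>)
qed (use assms in \<open>simp_all add: coeff_mul_add_left coeff_mul_scale_left
      coeff_mul_closed\<close>)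

subsection \<open>The unit\<close>

definition trivial_system :: "int \<Rightarrow> unit \<Rightarrow> unit \<Rightarrow> 'a \<Rightarrow> 'a"
  where "trivial_system i p q = id"

definition unit_coeff :: "'a word \<Rightarrow> 'k"
  where "unit_coeff = coeff {()} trivial_system () ()"

lemma coeff_system_trivial: "coeff_system {()} trivial_system"
  by (rule coeff_systemI)
    (auto simp: trivial_system_def twisted_comp_def intro!: linear_onI)

lemma unit_coeff_space: "unit_coeff \<in> \<U>"
  unfolding unit_coeff_def by (rule coeff_in_space[OF coeff_system_trivial]) auto

lemma unit_coeff_simps:
  "unit_coeff [] = 1"
  "unit_coeff (l # w) = entry trivial_system l () () * unit_coeff w"
  by (simp_all add: unit_coeff_def)

lemma coeff_mul_unit_left:
  assumes "\<phi> \<in> \<U>"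
  shows "coeff_mul unit_coeff \<phi> = \<phi>"
  using assms
proof (induction \<phi> rule: coeff_space_induct)
  case R: (coeff N R p q)
  have f: "bij_betw (\<lambda>x. ((), x)) N ({()} \<times> N)" by (rule bij_betwI[of _ _ _ snd]) auto
  have "coeff_mul unit_coeff (coeff N R p q) =
      coeff ({()} \<times> N) (tensor_system trivial_system R) ((), p) ((), q)"
    unfolding unit_coeff_def
    by (rule coeff_mul_coeff[OF coeff_system_trivial R(1)]) (use R in auto)
  also have "\<dots> = coeff N R p q"
    by (rule ext, rule coeff_reindex[OF f])
      (use R in \<open>auto simp: tensor_system_def twisted_comp_def trivial_system_def\<close>)
  finally show ?case .
next
  case (add \<phi> \<psi>)
  then show "coeff_mul unit_coeff (\<phi> + \<psi>) = \<phi> + \<psi>"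
    by (simp only: coeff_mul_add_right unit_coeff_space)
qed (simp_all add: coeff_mul_scale_right unit_coeff_space)

lemma coeff_mul_unit_right:
  assumes "\<phi> \<in> \<U>"
  shows "coeff_mul \<phi> unit_coeff = \<phi>"
  using assms
proof (induction \<phi> rule: coeff_space_induct)
  case R: (coeff N R p q)
  have f: "bij_betw (\<lambda>x. (x, ())) N (N \<times> {()})" by (rule bij_betwI[of _ _ _ fst]) auto
  have "coeff_mul (coeff N R p q) unit_coeff =
      coeff (N \<times> {()}) (tensor_system R trivial_system) (p, ()) (q, ())"
    unfolding unit_coeff_def
    by (rule coeff_mul_coeff[OF R(1) coeff_system_trivial]) (use R in auto)
  also have "\<dots> = coeff N R p q"
    by (rule ext, rule coeff_reindex[OF f])
      (use R in \<open>auto simp: tensor_system_def twisted_comp_def trivial_system_def\<close>)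
  finally show ?case .
next
  case (add \<phi> \<psi>)
  then show "coeff_mul (\<phi> + \<psi>) unit_coeff = \<phi> + \<psi>"
    by (simp only: coeff_mul_add_left unit_coeff_space)
qed (simp_all add: coeff_mul_scale_left unit_coeff_space)

end

context measured_algebra
begin

section \<open>The Hopf algebra of coefficient functions\<close>

subsection \<open>Antipode\<close>

text \<open>
  Applying the matrix \<open>X\<close> to the right-hand side, which becomes a product of the factors \<open>X (Y a)\<close> and
  \<open>X (Y b)\<close>, gives \<open>m a b\<close>; now apply \<open>Y\<close>.
\<close>
lemma inverse_matrix_mult:
  assumes N: "finite N"
    and X: "\<And>p q. p \<in> N \<Longrightarrow> q \<in> N \<Longrightarrow> operator (X p q)"
    and Y: "\<And>p q. p \<in> N \<Longrightarrow> q \<in> N \<Longrightarrow> operator (Y p q)"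
    and XY: "\<And>p q a. p \<in> N \<Longrightarrow> q \<in> N \<Longrightarrow> (\<Sum>r\<in>N. X p r (Y r q a)) = (if p = q then a else 0)"
    and YX: "\<And>p q a. p \<in> N \<Longrightarrow> q \<in> N \<Longrightarrow> (\<Sum>r\<in>N. Y p r (X r q a)) = (if p = q then a else 0)"
    and mult: "\<And>p q a b. p \<in> N \<Longrightarrow> q \<in> N \<Longrightarrow> X p q (m a b) = (\<Sum>r\<in>N. m (X p r a) (X r q b))"
    and m: "\<And>f b. m (\<Sum>r\<in>N. f r) b = (\<Sum>r\<in>N. m (f r) b)" "\<And>f a. m a (\<Sum>r\<in>N. f r) = (\<Sum>r\<in>N. m a (f r))"
      "\<And>b. m 0 b = 0" "\<And>a. m a 0 = 0"
    and pq: "p \<in> N" "q \<in> N"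
  shows "Y p q (m a b) = (\<Sum>r\<in>N. m (Y r q a) (Y p r b))"
proof -
  define Z where "Z p = (\<Sum>r\<in>N. m (Y r q a) (Y p r b))" for p
  have XZ: "(\<Sum>t\<in>N. X s t (Z t)) = (if s = q then m a b else 0)" if s: "s \<in> N" for s
  proof -
    have "(\<Sum>t\<in>N. X s t (Z t)) = (\<Sum>t\<in>N. \<Sum>r\<in>N. \<Sum>u\<in>N. m (X s u (Y r q a)) (X u t (Y t r b)))"
      using s by (intro sum.cong refl) (simp add: Z_def operator_sum[OF X] mult)
    also have "\<dots> = (\<Sum>r\<in>N. \<Sum>u\<in>N. \<Sum>t\<in>N. m (X s u (Y r q a)) (X u t (Y t r b)))"
      by (rule sum_rotate)
    also have "\<dots> = (\<Sum>r\<in>N. \<Sum>u\<in>N. m (X s u (Y r q a)) (if u = r then b else 0))"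
      by (intro sum.cong refl) (simp add: m(2)[symmetric] XY)
    also have "\<dots> = (\<Sum>r\<in>N. m (X s r (Y r q a)) b)"
    proof (intro sum.cong refl)
      fix r assume r: "r \<in> N"
      have "(\<Sum>u\<in>N. m (X s u (Y r q a)) (if u = r then b else 0)) =
          (\<Sum>u\<in>N. if u = r then m (X s u (Y r q a)) b else 0)"
        by (intro sum.cong refl) (simp add: m)
      then show "(\<Sum>u\<in>N. m (X s u (Y r q a)) (if u = r then b else 0)) = m (X s r (Y r q a)) b"
        using N r by simp
    qed
    also have "\<dots> = (if s = q then m a b else 0)"
      using s pq by (simp add: m(1)[symmetric] XY m(3))
    finally show ?thesis .
  qed
  have "Y p q (m a b) = (\<Sum>s\<in>N. if s = q then Y p s (m a b) else 0)"
    using N pq by simp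
  also have "\<dots> = (\<Sum>s\<in>N. Y p s (\<Sum>t\<in>N. X s t (Z t)))"
    using pq by (intro sum.cong refl) (simp add: XZ operator_zero[OF Y])
  also have "\<dots> = (\<Sum>t\<in>N. \<Sum>s\<in>N. Y p s (X s t (Z t)))"
    using pq by (subst sum.swap) (simp add: operator_sum[OF Y])
  also have "\<dots> = Z p"
    using N pq by (simp add: YX)
  finally show ?thesis by (simp add: Z_def)
qed

text \<open>
  The system of the comatrix \<open>S(c\<^sub>q\<^sub>p)\<close>, since \<open>S\<close> reverses coproducts.
\<close>
definition shift_system :: "(int \<Rightarrow> 'i \<Rightarrow> 'i \<Rightarrow> 'a \<Rightarrow> 'a) \<Rightarrow> int \<Rightarrow> 'i \<Rightarrow> 'i \<Rightarrow> 'a \<Rightarrow> 'a"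
  where "shift_system R i p q = R (i + 1) q p"

lemma twisted_comp_succ: "twisted_comp (i + 1) f g = twisted_comp i g f"
  by (simp add: twisted_comp_def)

text \<open>
  Multiplicativity, invariance of functionals and triviality on \<open>Fix\<close> pass from a matrix of operators to
  its inverse.
\<close>
lemma coeff_system_shift:
  assumes R: "coeff_system N R"
  shows "coeff_system N (shift_system R)"
proof (rule coeff_systemI)
  note D = coeff_systemD[OF R]
  have one_in_I: "1 \<in> I" using succ_in_I[OF zero_in_I] by simp
  have XY: "(\<Sum>r\<in>N. R 0 p r (R 1 r q a)) = (if p = q then a else 0)"
    "(\<Sum>r\<in>N. R 1 p r (R 0 r q a)) = (if p = q then a else 0)" if "p \<in> N" "q \<in> N" for p q a
    using D(6,7)[OF zero_in_I that] by (simp_all add: twisted_comp_def)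
  show "finite N" by (rule D(1))
  show "operator (shift_system R i p q)" if "i \<in> I" "p \<in> N" "q \<in> N" for i p q
    using that D(2) succ_in_I by (simp add: shift_system_def)
  fix p q assume pq: "p \<in> N" "q \<in> N"
  have "R 1 q p (a * b) = (\<Sum>r\<in>N. R 1 r p a * R 1 q r b)" for a b
    by (rule inverse_matrix_mult[where X = "R 0" and Y = "R 1" and m = "(*)" and N = N])
      (use D(1) D(2)[OF zero_in_I] D(2)[OF one_in_I] XY D(3) pq
        in \<open>simp_all add: sum_distrib_left sum_distrib_right\<close>)
  then show "shift_system R 0 p q (a * b) = (\<Sum>r\<in>N. shift_system R 0 p r a * shift_system R 0 r q b)" for a b
    by (simp add: shift_system_def)
  show "t (shift_system R 0 p q a) = (if p = q then t a else 0)" if t: "t \<in> T" for t a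
  proof -
    have t0: "t 0 = 0" using linear_onD(2)[OF linear_T[OF t], of 0 0] by simp
    have "t (R 1 q p a) = (\<Sum>r\<in>N. if q = r then t (R 1 r p a) else 0)"
      using D(1) pq by simp
    also have "\<dots> = (\<Sum>r\<in>N. t (R 0 q r (R 1 r p a)))"
      using D(4)[OF pq(2) _ t] by (intro sum.cong refl) simp
    also have "\<dots> = t (if q = p then a else 0)"
      using XY(1)[OF pq(2,1)] by (simp add: T_sum[OF t, symmetric])
    finally show ?thesis using t0 by (auto simp: shift_system_def)
  qed
  show "shift_system R 0 p q a = (if p = q then a else 0)" if a: "a \<in> Fix" for a
  proof -
    have "R 1 q p a = (\<Sum>r\<in>N. if r = p then R 1 q r a else 0)"
      using D(1) pq by simp
    also have "\<dots> = (\<Sum>r\<in>N. R 1 q r (R 0 r p a))"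
      using D(5)[OF _ pq(1) a] operator_zero[OF D(2)[OF one_in_I pq(2)]] by (intro sum.cong refl) simp
    also have "\<dots> = (if q = p then a else 0)" by (rule XY(2)[OF pq(2,1)])
    finally show ?thesis by (auto simp: shift_system_def)
  qed
  fix i a assume i: "i \<in> I"
  show "(\<Sum>r\<in>N. twisted_comp i (shift_system R i p r) (shift_system R (i + 1) r q) a) =
      (if p = q then a else 0)"
    using D(7)[OF succ_in_I[OF i] pq(2,1)] by (auto simp: shift_system_def twisted_comp_succ)
  show "(\<Sum>r\<in>N. twisted_comp i (shift_system R (i + 1) p r) (shift_system R i r q) a) =
      (if p = q then a else 0)"
    using D(6)[OF succ_in_I[OF i] pq(2,1)] by (auto simp: shift_system_def twisted_comp_succ)
qed

definition shift_letter :: "int \<times> 'a \<times> 'a \<Rightarrow> int \<times> 'a \<times> 'a"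
  where "shift_letter l = (fst l + 1, snd l)"

definition coeff_antipode :: "('a word \<Rightarrow> 'k) \<Rightarrow> 'a word \<Rightarrow> 'k"
  where "coeff_antipode \<phi> w =
    (if \<forall>l\<in>set w. fst l \<in> I then \<phi> (rev (map shift_letter w)) else 0)"

lemma coeff_antipode_coeff:
  assumes N: "finite N" and pq: "p \<in> N" "q \<in> N"
  shows "coeff_antipode (coeff N R p q) = coeff N (shift_system R) q p"
proof
  fix w
  show "coeff_antipode (coeff N R p q) w = coeff N (shift_system R) q p w"
    using pq(2)
  proof (induction w arbitrary: q)
    case Nil
    then show ?case by (auto simp: coeff_antipode_def)
  next
    case (Cons l w)
    obtain i a b where l: "l = (i, a, b)" by (cases l) auto
    have "coeff_antipode (coeff N R p q) (l # w) =
        (\<Sum>r\<in>N. (if i \<in> I then entry R (i + 1, a, b) r q else 0) * coeff_antipode (coeff N R p r) w)"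
    proof -
      define ok where "ok = (\<forall>l\<in>set w. fst l \<in> I)"
      have "coeff_antipode \<phi> (l # w) =
          (if ok \<and> i \<in> I then \<phi> (rev (map shift_letter w) @ [(i + 1, a, b)]) else 0)"
        "coeff_antipode \<phi> w = (if ok then \<phi> (rev (map shift_letter w)) else 0)" for \<phi>
        by (auto simp: coeff_antipode_def ok_def l shift_letter_def)
      then show ?thesis
        using N pq(1) Cons.prems
        by (cases ok; cases "i \<in> I")
          (simp_all add: coeff_append coeff_singleton mult.commute
            del: entry.simps coeff.simps)
    qed
    also have "\<dots> = (\<Sum>r\<in>N. entry (shift_system R) l q r * coeff N (shift_system R) r p w)"
    proof (intro sum.cong refl arg_cong2[of _ _ _ _ "(*)"])
      show "(if i \<in> I then entry R (i + 1, a, b) r q else 0) = entry (shift_system R) l q r" for r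
        by (simp add: l shift_system_def succ_in_I)
    qed (rule Cons.IH)
    also have "\<dots> = coeff N (shift_system R) q p (l # w)" by simp
    finally show ?case .
  qed
qed

lemma coeff_antipode_add:
  "coeff_antipode (\<phi> + \<psi>) = coeff_antipode \<phi> + coeff_antipode \<psi>"
  by (rule ext) (simp add: coeff_antipode_def plus_fun_apply)

lemma coeff_antipode_scale:
  "coeff_antipode (\<lambda>w. c * \<phi> w) = (\<lambda>w. c * coeff_antipode \<phi> w)"
  by (rule ext) (simp add: coeff_antipode_def)

lemma coeff_antipode_closed: "\<phi> \<in> \<U> \<Longrightarrow> coeff_antipode \<phi> \<in> \<U>"
proof (induction \<phi> rule: coeff_space_induct)
  case (coeff N R p q)
  then show ?case
    using coeff_space.coeff[OF coeff_system_shift[OF coeff(1)], of q p]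
    by (simp add: coeff_antipode_coeff coeff_systemD(1))
qed (simp_all add: coeff_antipode_add coeff_antipode_scale coeff_space_add coeff_space.scale)

text \<open>
  Summing over \<open>r\<close> contracts the first letter of the word by the condition on inverses, which leaves a
  multiple of the same sum for the remaining word.
\<close>
lemma coeff_antipode_left:
  assumes R: "coeff_system N R" and pq: "p \<in> N" "q \<in> N"
  shows "(\<Sum>r\<in>N. coeff (N \<times> N) (tensor_system (shift_system R) R) (r, r) (p, q) w) =
    (if p = q then unit_coeff w else 0)"
proof (induction w)
  case Nil
  have "(\<Sum>r\<in>N. coeff (N \<times> N) (tensor_system (shift_system R) R) (r, r) (p, q) []) =
      (\<Sum>r\<in>N. if r = p then (if p = q then 1 else 0) else 0)"
    by (intro sum.cong refl) auto
  then show ?case using coeff_systemD(1)[OF R] pq by (simp add: unit_coeff_simps)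
next
  case (Cons l w)
  note fin = coeff_systemD(1)[OF R]
  obtain i a b where l: "l = (i, a, b)" by (cases l) auto
  let ?T = "tensor_system (shift_system R) R"
  have entry: "(\<Sum>r\<in>N. entry ?T l (r, r) (s, s')) = (if s = s' then entry trivial_system l () () else 0)"
    if "s \<in> N" "s' \<in> N" for s s'
  proof (cases "i \<in> I")
    case True
    have "(\<Sum>r\<in>N. entry ?T l (r, r) (s, s')) =
        coordinate b (\<Sum>r\<in>N. twisted_comp i (R (i + 1) s r) (R i r s') a)"
      using True by (simp add: l coordinate_sum tensor_system_def shift_system_def)
    then show ?thesis
      using True coeff_systemD(7)[OF R True that] by (simp add: l trivial_system_def)
  qed (simp add: l)
  have "(\<Sum>r\<in>N. coeff (N \<times> N) ?T (r, r) (p, q) (l # w)) =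
      (\<Sum>r\<in>N. \<Sum>s\<in>N. \<Sum>s'\<in>N. entry ?T l (r, r) (s, s') * coeff (N \<times> N) ?T (s, s') (p, q) w)"
    by (simp add: sum.cartesian_product)
  also have "\<dots> = (\<Sum>s\<in>N. \<Sum>s'\<in>N. \<Sum>r\<in>N. entry ?T l (r, r) (s, s') * coeff (N \<times> N) ?T (s, s') (p, q) w)"
    by (rule sum_rotate)
  also have "\<dots> = (\<Sum>s\<in>N. \<Sum>s'\<in>N. if s = s' then
      entry trivial_system l () () * coeff (N \<times> N) ?T (s, s') (p, q) w else 0)"
    by (intro sum.cong refl) (simp add: entry sum_distrib_right[symmetric])
  also have "\<dots> = entry trivial_system l () () * (\<Sum>s\<in>N. coeff (N \<times> N) ?T (s, s) (p, q) w)"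
    using fin by (simp add: sum_distrib_left)
  also have "\<dots> = (if p = q then unit_coeff (l # w) else 0)"
    by (simp add: Cons.IH unit_coeff_simps(2))
  finally show ?case .
qed

lemma coeff_antipode_right:
  assumes R: "coeff_system N R" and pq: "p \<in> N" "q \<in> N"
  shows "(\<Sum>r\<in>N. coeff (N \<times> N) (tensor_system R (shift_system R)) (p, q) (r, r) w) =
    (if p = q then unit_coeff w else 0)"
  using pq
proof (induction w arbitrary: p q)
  case Nil
  have "(\<Sum>r\<in>N. coeff (N \<times> N) (tensor_system R (shift_system R)) (p, q) (r, r) []) =
      (\<Sum>r\<in>N. if r = p then (if p = q then 1 else 0) else 0)"
    by (intro sum.cong refl) auto
  then show ?case using coeff_systemD(1)[OF R] Nil by (simp add: unit_coeff_simps)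
next
  case (Cons l w)
  note fin = coeff_systemD(1)[OF R]
  obtain i a b where l: "l = (i, a, b)" by (cases l) auto
  let ?T = "tensor_system R (shift_system R)"
  have entry: "(\<Sum>r\<in>N. entry ?T l (p, q) (r, r)) = (if p = q then entry trivial_system l () () else 0)"
  proof (cases "i \<in> I")
    case True
    have "(\<Sum>r\<in>N. entry ?T l (p, q) (r, r)) =
        coordinate b (\<Sum>r\<in>N. twisted_comp i (R i p r) (R (i + 1) r q) a)"
      using True by (simp add: l coordinate_sum tensor_system_def shift_system_def)
    then show ?thesis
      using True coeff_systemD(6)[OF R True Cons.prems] by (simp add: l trivial_system_def)
  qed (simp add: l)
  have "(\<Sum>r\<in>N. coeff (N \<times> N) ?T (p, q) (r, r) (l # w)) =
      (\<Sum>r\<in>N. \<Sum>s\<in>N. \<Sum>s'\<in>N. entry ?T l (p, q) (s, s') * coeff (N \<times> N) ?T (s, s') (r, r) w)"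
    by (simp add: sum.cartesian_product)
  also have "\<dots> = (\<Sum>s\<in>N. \<Sum>s'\<in>N. \<Sum>r\<in>N. entry ?T l (p, q) (s, s') * coeff (N \<times> N) ?T (s, s') (r, r) w)"
    by (rule sum_rotate)
  also have "\<dots> = (\<Sum>s\<in>N. \<Sum>s'\<in>N. if s = s' then entry ?T l (p, q) (s, s') * unit_coeff w else 0)"
    by (intro sum.cong refl) (simp add: Cons.IH sum_distrib_left[symmetric])
  also have "\<dots> = (\<Sum>s\<in>N. entry ?T l (p, q) (s, s)) * unit_coeff w"
    using fin by (simp add: sum_distrib_right)
  also have "\<dots> = (if p = q then unit_coeff (l # w) else 0)"
    by (simp add: entry unit_coeff_simps(2))
  finally show ?case .
qed

subsection \<open>Comultiplication\<close>

abbreviation scale_fun :: "'k \<Rightarrow> ('a word \<Rightarrow> 'k) \<Rightarrow> 'a word \<Rightarrow> 'k"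
  where "scale_fun c \<phi> \<equiv> (\<lambda>w. c * \<phi> w)"

lemma vector_space_functions: "Vector_Spaces.vector_space scale_fun"
  by unfold_locales (auto simp: algebra_simps fun_eq_iff plus_fun_apply)

lemma zero_space: "0 \<in> \<U>"
  using coeff_space.scale[OF unit_coeff_space, of 0] by (simp add: zero_fun_def)

lemma subspace_space: "module.subspace scale_fun \<U>"
proof -
  interpret W: Vector_Spaces.vector_space scale_fun by (rule vector_space_functions)
  show ?thesis
    by (rule W.subspaceI) (auto intro: zero_space coeff_space_add coeff_space.scale)
qed

lemma carrier_space_functions: "carrier_space scale_fun \<U>"
  by (intro carrier_space.intro carrier_space_axioms.intro vector_space_functions subspace_space)

lemma sum_list_fun_apply: "(\<Sum>x\<leftarrow>L. f x) w = (\<Sum>x\<leftarrow>L. f x w)"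
  by (induction L) (simp_all add: plus_fun_apply)

lemma sum_fun_apply: "(\<Sum>x\<in>S. f x) w = (\<Sum>x\<in>S. f x w)"
  by (induction S rule: infinite_finite_induct) (simp_all add: plus_fun_apply)

text \<open>Evaluations at words separate functions.\<close>
lemma tensor_eq_functions:
  assumes words: "\<And>w. w \<in> set ws \<union> set ws' \<Longrightarrow> set w \<subseteq> \<U> \<and> length w = n"
    and eq: "\<And>us. length us = n \<Longrightarrow>
      (\<Sum>w\<leftarrow>ws. word_eval (map (\<lambda>u \<phi>. \<phi> u) us) w) = (\<Sum>w\<leftarrow>ws'. word_eval (map (\<lambda>u \<phi>. \<phi> u) us) w)"
  shows "tensor_eq scale_fun \<U> ws ws'"
proof (rule carrier_space.tensor_eqI[OF carrier_space_functions words, where P = "range (\<lambda>u \<phi>. \<phi> u)"])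
  show "linear_on scale_fun \<U> (*) f" if "f \<in> range (\<lambda>u \<phi>. \<phi> u)" for f
    using that by (auto intro!: linear_onI simp: plus_fun_apply)
  show "x = 0" if "\<And>f. f \<in> range (\<lambda>u \<phi>. \<phi> u) \<Longrightarrow> f x = 0" for x :: "'a word \<Rightarrow> 'k"
    using that by (auto simp: fun_eq_iff)
  fix fs :: "(('a word \<Rightarrow> 'k) \<Rightarrow> 'k) list"
  assume "length fs = n" "set fs \<subseteq> range (\<lambda>u \<phi>. \<phi> u)"
  moreover from this(2) have "\<exists>us. fs = map (\<lambda>u \<phi>. \<phi> u) us"
    by (induction fs) (auto intro: exI[of _ "_ # _"] simp: Cons_eq_map_conv)
  ultimately show "(\<Sum>w\<leftarrow>ws. word_eval fs w) = (\<Sum>w\<leftarrow>ws'. word_eval fs w)"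
    using eq by auto
qed auto

lemma tensor_eq_functions2:
  assumes words: "\<And>w. w \<in> set ws \<union> set ws' \<Longrightarrow> set w \<subseteq> \<U> \<and> length w = 2"
    and eq: "\<And>u v. (\<Sum>w\<leftarrow>ws. word_eval [\<lambda>\<phi>. \<phi> u, \<lambda>\<phi>. \<phi> v] w) = (\<Sum>w\<leftarrow>ws'. word_eval [\<lambda>\<phi>. \<phi> u, \<lambda>\<phi>. \<phi> v] w)"
  shows "tensor_eq scale_fun \<U> ws ws'"
proof (rule tensor_eq_functions[OF words])
  fix us :: "'a word list" assume "length us = 2"
  then obtain u v where "us = [u, v]" by (auto simp: length_Suc_conv numeral_2_eq_2)
  then show "(\<Sum>w\<leftarrow>ws. word_eval (map (\<lambda>u \<phi>. \<phi> u) us) w) = (\<Sum>w\<leftarrow>ws'. word_eval (map (\<lambda>u \<phi>. \<phi> u) us) w)"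
    using eq by simp
qed auto

text \<open>
  A representative of the coproduct \<open>(u, v) \<mapsto> \<phi> (u @ v)\<close>.
\<close>
definition splitting :: "('a word \<Rightarrow> 'k) \<Rightarrow> (('a word \<Rightarrow> 'k) \<times> ('a word \<Rightarrow> 'k)) list \<Rightarrow> bool"
  where "splitting \<phi> L \<longleftrightarrow> set L \<subseteq> \<U> \<times> \<U> \<and> (\<forall>u v. \<phi> (u @ v) = (\<Sum>(x, y)\<leftarrow>L. x u * y v))"

lemma splittingD:
  assumes "splitting \<phi> L"
  shows "set L \<subseteq> \<U> \<times> \<U>" "\<phi> (u @ v) = (\<Sum>(x, y)\<leftarrow>L. x u * y v)"
  using assms by (auto simp: splitting_def)

lemma splitting_coeff:
  assumes R: "coeff_system N R" and pq: "p \<in> (N :: nat set)" "q \<in> N"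
    and rs: "set rs = N" "distinct rs"
  shows "splitting (coeff N R p q) (map (\<lambda>r. (coeff N R p r, coeff N R r q)) rs)"
  using rs pq coeff_systemD(1)[OF R] coeff_space.coeff[OF R]
  by (auto simp: splitting_def coeff_append o_def sum_list_distinct_conv_sum_set)

lemma splitting_add: "splitting \<phi> L \<Longrightarrow> splitting \<psi> L' \<Longrightarrow> splitting (\<phi> + \<psi>) (L @ L')"
  by (simp add: splitting_def plus_fun_apply)

lemma splitting_scale:
  "splitting \<phi> L \<Longrightarrow> splitting (scale_fun c \<phi>) (map (\<lambda>(x, y). (scale_fun c x, y)) L)"
  by (auto simp: splitting_def o_def case_prod_unfold mult.assoc sum_list_const_mult coeff_space.scale
      intro!: coeff_space.scale)

lemma splitting_exists: "\<phi> \<in> \<U> \<Longrightarrow> \<exists>L. splitting \<phi> L"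
proof (induction \<phi> rule: coeff_space_induct)
  case (coeff N R p q)
  then obtain rs where "set rs = N" "distinct rs"
    using finite_distinct_list coeff_systemD(1) by metis
  then show ?case using splitting_coeff[OF coeff] by blast
qed (blast intro: splitting_add splitting_scale)+

definition coeff_comul :: "('a word \<Rightarrow> 'k) \<Rightarrow> (('a word \<Rightarrow> 'k) \<times> ('a word \<Rightarrow> 'k)) list"
  where "coeff_comul \<phi> = (SOME L. splitting \<phi> L)"

lemma splitting_comul: "\<phi> \<in> \<U> \<Longrightarrow> splitting \<phi> (coeff_comul \<phi>)"
  unfolding coeff_comul_def by (rule someI_ex[OF splitting_exists])

lemma splitting_unique:
  assumes "splitting \<phi> L" "splitting \<phi> L'"
  shows "tensor_eq scale_fun \<U> [[x, y]. (x, y) \<leftarrow> L] [[x, y]. (x, y) \<leftarrow> L']"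
proof (rule tensor_eq_functions2)
  show "set w \<subseteq> \<U> \<and> length w = 2" if "w \<in> set [[x, y]. (x, y) \<leftarrow> L] \<union> set [[x, y]. (x, y) \<leftarrow> L']" for w
    using that splittingD(1)[OF assms(1)] splittingD(1)[OF assms(2)] by auto
  show "(\<Sum>w\<leftarrow>[[x, y]. (x, y) \<leftarrow> L]. word_eval [\<lambda>\<phi>. \<phi> u, \<lambda>\<phi>. \<phi> v] w) =
      (\<Sum>w\<leftarrow>[[x, y]. (x, y) \<leftarrow> L']. word_eval [\<lambda>\<phi>. \<phi> u, \<lambda>\<phi>. \<phi> v] w)" for u v
    using splittingD(2)[OF assms(1), of u v] splittingD(2)[OF assms(2), of u v]
    by (simp add: o_def case_prod_unfold)
qed

lemma splitting_bilinear:
  assumes "splitting \<phi> L" "splitting \<phi> L'" "Vector_Spaces.vector_space s" "bilinear_on scale_fun \<U> s B"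
  shows "(\<Sum>(x, y)\<leftarrow>L. B x y) = (\<Sum>(x, y)\<leftarrow>L'. B x y)"
  by (rule vector_space.tensor_eq_bilinear[OF assms(3,4) splitting_unique[OF assms(1,2)]])

lemma bilinear_product_antipode_left:
  "bilinear_on scale_fun \<U> scale_fun (\<lambda>x y. coeff_mul (coeff_antipode x) y)"
  by (rule bilinear_onI)
    (simp_all add: coeff_antipode_add coeff_antipode_scale coeff_antipode_closed
      coeff_mul_add_left coeff_mul_add_right coeff_mul_scale_left
      coeff_mul_scale_right)

lemma bilinear_product_antipode_right:
  "bilinear_on scale_fun \<U> scale_fun (\<lambda>x y. coeff_mul x (coeff_antipode y))"
  by (rule bilinear_onI)
    (simp_all add: coeff_antipode_add coeff_antipode_scale coeff_antipode_closed
      coeff_mul_add_left coeff_mul_add_right coeff_mul_scale_left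
      coeff_mul_scale_right)

text \<open>
  A bilinear expression in \<open>\<Delta> \<phi>\<close> is linear in \<open>\<phi>\<close> and independent of the representative; for the
  coefficients of a system, the coproduct may be taken to be that of a comatrix.
\<close>
lemma splitting_sum_induct:
  assumes \<phi>: "\<phi> \<in> \<U>" and L: "splitting \<phi> L"
    and s: "Vector_Spaces.vector_space s" and B: "bilinear_on scale_fun \<U> s B"
    and f: "linear_on scale_fun \<U> s f"
    and gen: "\<And>(N :: nat set) R p q. coeff_system N R \<Longrightarrow> p \<in> N \<Longrightarrow> q \<in> N \<Longrightarrow>
      (\<Sum>r\<in>N. B (coeff N R p r) (coeff N R r q)) = f (coeff N R p q)"
  shows "(\<Sum>(x, y)\<leftarrow>L. B x y) = f \<phi>"
proof -
  interpret S: Vector_Spaces.vector_space s by (rule s)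
  have "\<exists>L. splitting \<phi> L \<and> (\<Sum>(x, y)\<leftarrow>L. B x y) = f \<phi>"
    using \<phi>
  proof (induction \<phi> rule: coeff_space_induct)
    case (coeff N R p q)
    then obtain rs where rs: "set rs = N" "distinct rs"
      using finite_distinct_list coeff_systemD(1) by metis
    have "(\<Sum>(x, y)\<leftarrow>map (\<lambda>r. (coeff N R p r, coeff N R r q)) rs. B x y) = f (coeff N R p q)"
      using gen[OF coeff] rs by (simp add: o_def sum_list_distinct_conv_sum_set)
    then show ?case using splitting_coeff[OF coeff rs] by blast
  next
    case (add \<phi> \<psi>)
    then obtain L L' where "splitting \<phi> L" "(\<Sum>(x, y)\<leftarrow>L. B x y) = f \<phi>"
      "splitting \<psi> L'" "(\<Sum>(x, y)\<leftarrow>L'. B x y) = f \<psi>" by blast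
    then show ?case using add splitting_add[of \<phi> L \<psi> L'] linear_onD(1)[OF f, of \<phi> \<psi>]
      by (intro exI[of _ "L @ L'"]) simp
  next
    case (scale \<phi> c)
    then obtain L where L: "splitting \<phi> L" "(\<Sum>(x, y)\<leftarrow>L. B x y) = f \<phi>" by blast
    have "(\<Sum>(x, y)\<leftarrow>M. B (scale_fun c x) y) = s c (\<Sum>(x, y)\<leftarrow>M. B x y)"
      if "set M \<subseteq> \<U> \<times> \<U>" for M
      using that by (induction M) (auto simp: bilinear_onD(4)[OF B] S.scale_right_distrib)
    then have "(\<Sum>(x, y)\<leftarrow>map (\<lambda>(x, y). (scale_fun c x, y)) L. B x y) = f (scale_fun c \<phi>)"
      using L splittingD(1)[OF L(1)] linear_onD(2)[OF f scale(1)] by (simp add: o_def case_prod_unfold)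
    then show ?case using splitting_scale[OF L(1)] by blast
  qed
  then show ?thesis using splitting_bilinear[OF L _ s B] by metis
qed

lemma linear_product_left:
  "\<psi> \<in> \<U> \<Longrightarrow> linear_on scale_fun \<U> (*) (\<lambda>x. coeff_mul x \<psi> u)"
  by (rule linear_onI)
    (simp_all add: coeff_mul_add_left coeff_mul_scale_left plus_fun_apply)

lemma linear_product_right:
  "\<phi> \<in> \<U> \<Longrightarrow> linear_on scale_fun \<U> (*) (\<lambda>x. coeff_mul \<phi> x u)"
  by (rule linear_onI)
    (simp_all add: coeff_mul_add_right coeff_mul_scale_right plus_fun_apply)

text \<open>
  Both sides are bilinear in \<open>\<phi>\<close> and \<open>\<psi>\<close>, and for coefficients the claim is the multiplicativity of the
  coefficient matrix of the tensor product of systems under concatenation of words.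
\<close>
lemma splitting_product:
  assumes \<phi>: "\<phi> \<in> \<U>" "splitting \<phi> L" and \<psi>: "\<psi> \<in> \<U>" "splitting \<psi> L'"
  shows "(\<Sum>(x, y)\<leftarrow>L. \<Sum>(x', y')\<leftarrow>L'. coeff_mul x x' u * coeff_mul y y' v) =
    coeff_mul \<phi> \<psi> (u @ v)"
proof (rule splitting_sum_induct[OF \<phi> vector_space_field])
  let ?B = "\<lambda>z' x y. case z' of (x', y') \<Rightarrow> coeff_mul x x' u * coeff_mul y y' v"
  have "bilinear_on scale_fun \<U> (*) (?B z')" if "z' \<in> set L'" for z'
    using splittingD(1)[OF \<psi>(2)] that
    by (cases z') (auto intro!: bilinear_on_product linear_product_left)
  then show "bilinear_on scale_fun \<U> (*) (\<lambda>x y. \<Sum>z'\<leftarrow>L'. ?B z' x y)"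
    by (rule bilinear_on_sum_list)
  show "linear_on scale_fun \<U> (*) (\<lambda>\<phi>. coeff_mul \<phi> \<psi> (u @ v))"
    by (rule linear_product_left[OF \<psi>(1)])
  fix N :: "nat set" and R p q assume R: "coeff_system N R" "p \<in> N" "q \<in> N"
  let ?c = "coeff N R"
  note c = coeff_space.coeff[OF R(1)]
  have "(\<Sum>r\<in>N. \<Sum>z'\<leftarrow>L'. ?B z' (?c p r) (?c r q)) = (\<Sum>(x', y')\<leftarrow>L'. \<Sum>r\<in>N. ?B (x', y') (?c p r) (?c r q))"
    by (induction L') (auto simp: sum.distrib)
  also have "\<dots> = coeff_mul (?c p q) \<psi> (u @ v)"
  proof (rule splitting_sum_induct[OF \<psi> vector_space_field])
    have "bilinear_on scale_fun \<U> (*) (\<lambda>x' y'. ?B (x', y') (?c p r) (?c r q))" if "r \<in> N" for r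
      using R c that by (auto intro!: bilinear_on_product linear_product_right)
    then show "bilinear_on scale_fun \<U> (*) (\<lambda>x' y'. \<Sum>r\<in>N. ?B (x', y') (?c p r) (?c r q))"
      by (rule bilinear_on_sum)
    show "linear_on scale_fun \<U> (*) (\<lambda>\<psi>. coeff_mul (?c p q) \<psi> (u @ v))"
      by (rule linear_product_right[OF c[OF R(2,3)]])
    fix M :: "nat set" and R' p' q' assume R': "coeff_system M R'" "p' \<in> M" "q' \<in> M"
    have "(\<Sum>r'\<in>M. \<Sum>r\<in>N. ?B (coeff M R' p' r', coeff M R' r' q') (?c p r) (?c r q)) =
        (\<Sum>r\<in>N \<times> M. coeff (N \<times> M) (tensor_system R R') (p, p') r u *
          coeff (N \<times> M) (tensor_system R R') r (q, q') v)"
      using R R' by (subst sum.swap)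
        (simp add: coeff_mul_coeff sum.cartesian_product case_prod_unfold)
    then show "(\<Sum>r'\<in>M. \<Sum>r\<in>N. ?B (coeff M R' p' r', coeff M R' r' q') (?c p r) (?c r q)) =
        coeff_mul (?c p q) (coeff M R' p' q') (u @ v)"
      using R R' by (simp add: coeff_mul_coeff coeff_append coeff_systemD(1))
  qed
  finally show "(\<Sum>r\<in>N. \<Sum>z'\<leftarrow>L'. ?B z' (?c p r) (?c r q)) = coeff_mul (?c p q) \<psi> (u @ v)" .
qed

lemma splitting_antipode_left:
  assumes "\<phi> \<in> \<U>" "splitting \<phi> L"
  shows "(\<Sum>(x, y)\<leftarrow>L. coeff_mul (coeff_antipode x) y) = scale_fun (\<phi> []) unit_coeff"
proof (rule splitting_sum_induct[OF assms vector_space_functions bilinear_product_antipode_left])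
  show "linear_on scale_fun \<U> scale_fun (\<lambda>\<phi>. scale_fun (\<phi> []) unit_coeff)"
    by (rule linear_onI) (auto simp: plus_fun_apply fun_eq_iff algebra_simps)
  fix N :: "nat set" and R p q assume R: "coeff_system N R" and pq: "p \<in> N" "q \<in> N"
  have "(\<Sum>r\<in>N. coeff_mul (coeff_antipode (coeff N R p r)) (coeff N R r q)) =
      (\<Sum>r\<in>N. coeff (N \<times> N) (tensor_system (shift_system R) R) (r, r) (p, q))"
    using pq R by (intro sum.cong refl)
      (simp add: coeff_antipode_coeff coeff_systemD(1) coeff_mul_coeff
        coeff_system_shift)
  then show "(\<Sum>r\<in>N. coeff_mul (coeff_antipode (coeff N R p r)) (coeff N R r q)) =
      scale_fun (coeff N R p q []) unit_coeff"
    using coeff_antipode_left[OF R pq] by (simp add: fun_eq_iff sum_fun_apply)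
qed

lemma splitting_antipode_right:
  assumes "\<phi> \<in> \<U>" "splitting \<phi> L"
  shows "(\<Sum>(x, y)\<leftarrow>L. coeff_mul x (coeff_antipode y)) = scale_fun (\<phi> []) unit_coeff"
proof (rule splitting_sum_induct[OF assms vector_space_functions bilinear_product_antipode_right])
  show "linear_on scale_fun \<U> scale_fun (\<lambda>\<phi>. scale_fun (\<phi> []) unit_coeff)"
    by (rule linear_onI) (auto simp: plus_fun_apply fun_eq_iff algebra_simps)
  fix N :: "nat set" and R p q assume R: "coeff_system N R" and pq: "p \<in> N" "q \<in> N"
  have "(\<Sum>r\<in>N. coeff_mul (coeff N R p r) (coeff_antipode (coeff N R r q))) =
      (\<Sum>r\<in>N. coeff (N \<times> N) (tensor_system R (shift_system R)) (p, q) (r, r))"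
    using pq R by (intro sum.cong refl)
      (simp add: coeff_antipode_coeff coeff_systemD(1) coeff_mul_coeff
        coeff_system_shift)
  then show "(\<Sum>r\<in>N. coeff_mul (coeff N R p r) (coeff_antipode (coeff N R r q))) =
      scale_fun (coeff N R p q []) unit_coeff"
    using coeff_antipode_right[OF R pq] by (simp add: fun_eq_iff sum_fun_apply)
qed

lemma coeff_space_outside:
  assumes "\<phi> \<in> \<U>" "i \<notin> I"
  shows "\<phi> [(i, a, b)] = 0"
  using assms(1)
proof (induction \<phi> rule: coeff_space_induct)
  case (coeff N R p q)
  then show ?case using assms(2) coeff_systemD(1)[OF coeff(1)]
    by (simp only: coeff_singleton) simp
qed (simp_all add: plus_fun_apply)

subsection \<open>The action\<close>

text \<open>
  The vector whose \<open>b\<close>-coordinate is \<open>\<phi> [(0, a, b)]\<close>.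
\<close>
definition coeff_action :: "('a word \<Rightarrow> 'k) \<Rightarrow> 'a \<Rightarrow> 'a"
  where "coeff_action \<phi> a = (\<Sum>b | \<phi> [(0, a, b)] \<noteq> 0. scale (\<phi> [(0, a, b)]) b)"

lemma coeff_action_eqI:
  "(\<And>b. \<phi> [(0, a, b)] = coordinate b v) \<Longrightarrow> coeff_action \<phi> a = v"
  by (simp add: coeff_action_def sum_coordinate)

lemma coeff_action_coeff:
  assumes "finite N" "q \<in> N"
  shows "coeff_action (coeff N R p q) a = R 0 p q a"
  by (rule coeff_action_eqI) (simp only: coeff_singleton[OF assms], simp add: zero_in_I)

lemma coordinate_action:
  assumes "\<phi> \<in> \<U>"
  shows "coordinate b (coeff_action \<phi> a) = \<phi> [(0, a, b)]"
proof -
  from assms have "\<exists>v. \<forall>b. \<phi> [(0, a, b)] = coordinate b v"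
  proof (induction \<phi> rule: coeff_space_induct)
    case (coeff N R p q)
    then show ?case
      by (intro exI[of _ "R 0 p q a"])
        (simp only: coeff_singleton coeff_systemD(1), simp add: zero_in_I)
  next
    case (add \<phi> \<psi>)
    then obtain v v' where "\<forall>b. \<phi> [(0, a, b)] = coordinate b v" "\<forall>b. \<psi> [(0, a, b)] = coordinate b v'"
      by blast
    then show ?case by (intro exI[of _ "v + v'"]) (simp add: plus_fun_apply coordinate_add)
  next
    case (scale \<phi> c)
    then obtain v where "\<forall>b. \<phi> [(0, a, b)] = coordinate b v" by blast
    then show ?case by (intro exI[of _ "scale c v"]) (simp add: coordinate_scale)
  qed
  then obtain v where "\<forall>b. \<phi> [(0, a, b)] = coordinate b v" by blast
  then show ?thesis using coeff_action_eqI[of \<phi> a v] by simp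
qed

lemma coeff_action_add:
  "\<phi> \<in> \<U> \<Longrightarrow> \<psi> \<in> \<U> \<Longrightarrow>
    coeff_action (\<phi> + \<psi>) a = coeff_action \<phi> a + coeff_action \<psi> a"
  by (rule coeff_action_eqI) (simp add: coordinate_add coordinate_action plus_fun_apply)

lemma coeff_action_scale:
  "\<phi> \<in> \<U> \<Longrightarrow> coeff_action (scale_fun c \<phi>) a = scale c (coeff_action \<phi> a)"
  by (rule coeff_action_eqI) (simp add: coordinate_scale coordinate_action)

lemma coeff_action_operator: "\<phi> \<in> \<U> \<Longrightarrow> operator (coeff_action \<phi>)"
proof (induction \<phi> rule: coeff_space_induct)
  case (coeff N R p q)
  then have "coeff_action (coeff N R p q) = R 0 p q"
    by (intro ext coeff_action_coeff) (auto simp: coeff_systemD(1))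
  then show ?case using coeff_systemD(2)[OF coeff(1) zero_in_I coeff(2,3)] by simp
next
  case (add \<phi> \<psi>)
  show ?case
    by (rule linear_onI) (simp_all add: coeff_action_add[OF add(1,2)] linear_onD[OF add(3)]
        linear_onD[OF add(4)] scale_right_distrib)
next
  case (scale \<phi> c)
  show ?case
    by (rule linear_onI) (simp_all add: coeff_action_scale[OF scale(1)] linear_onD[OF scale(2)]
        scale_right_distrib mult.commute)
qed

lemma coeff_action_unit: "coeff_action unit_coeff a = a"
  unfolding unit_coeff_def
  by (subst coeff_action_coeff) (auto simp: trivial_system_def)

lemma coeff_action_product:
  assumes "\<phi> \<in> \<U>" "\<psi> \<in> \<U>"
  shows "coeff_action (coeff_mul \<phi> \<psi>) a = coeff_action \<phi> (coeff_action \<psi> a)"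
  using assms(1)
proof (induction \<phi> rule: coeff_space_induct)
  case R: (coeff N R p q)
  note R_space = coeff_space.coeff[OF R]
  note op = coeff_action_operator[OF R_space]
  from assms(2) show ?case
  proof (induction \<psi> rule: coeff_space_induct)
    case (coeff M R' p' q')
    then show ?case using R
      by (simp add: coeff_mul_coeff coeff_action_coeff coeff_systemD(1)
          tensor_system_def twisted_comp_def)
  next
    case (add \<psi> \<psi>')
    then show ?case
      by (simp add: coeff_mul_add_right R_space coeff_action_add coeff_mul_closed
          linear_onD[OF op])
  next
    case (scale \<psi> c)
    then show ?case
      by (simp add: coeff_mul_scale_right R_space coeff_action_scale coeff_mul_closed
          linear_onD[OF op])
  qed
qed (use assms(2) in \<open>simp_all add: coeff_mul_add_left coeff_action_add
      coeff_mul_closed coeff_mul_scale_left coeff_action_scale\<close>)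

lemma coeff_action_mult:
  assumes "\<phi> \<in> \<U>" "splitting \<phi> L"
  shows "coeff_action \<phi> (a * b) = (\<Sum>(x, y)\<leftarrow>L. coeff_action x a * coeff_action y b)"
proof (rule splitting_sum_induct[OF assms vector_space_axioms, symmetric])
  show "bilinear_on scale_fun \<U> scale (\<lambda>x y. coeff_action x a * coeff_action y b)"
    by (rule bilinear_onI)
      (simp_all add: coeff_action_add coeff_action_scale algebra_simps scale_mult_left scale_mult_right)
  show "linear_on scale_fun \<U> scale (\<lambda>\<phi>. coeff_action \<phi> (a * b))"
    by (rule linear_onI) (simp_all add: coeff_action_add coeff_action_scale)
  show "(\<Sum>r\<in>N. coeff_action (coeff N R p r) a * coeff_action (coeff N R r q) b) =
      coeff_action (coeff N R p q) (a * b)"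
    if "coeff_system N R" "p \<in> N" "q \<in> N" for N :: "nat set" and R p q
    using that coeff_systemD(3)[OF that]
    by (simp add: coeff_action_coeff coeff_systemD(1))
qed

lemma coeff_action_T:
  assumes t: "t \<in> T" and "\<phi> \<in> \<U>"
  shows "t (coeff_action \<phi> a) = \<phi> [] * t a"
  using assms(2)
proof (induction \<phi> rule: coeff_space_induct)
  case (coeff N R p q)
  then show ?case using coeff_systemD(4)[OF coeff t]
    by (simp add: coeff_action_coeff coeff_systemD(1))
next
  case (add \<phi> \<psi>)
  then show "t (coeff_action (\<phi> + \<psi>) a) = (\<phi> + \<psi>) [] * t a"
    by (simp only: coeff_action_add linear_onD[OF linear_T[OF t]] plus_fun_apply UNIV_I distrib_right)
qed (simp_all add: coeff_action_scale linear_onD[OF linear_T[OF t]])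

lemma coeff_action_Fix:
  assumes a: "a \<in> Fix" and "\<phi> \<in> \<U>"
  shows "coeff_action \<phi> a = scale (\<phi> []) a"
  using assms(2)
proof (induction \<phi> rule: coeff_space_induct)
  case (coeff N R p q)
  then show ?case using coeff_systemD(5)[OF coeff a]
    by (simp add: coeff_action_coeff coeff_systemD(1))
next
  case (add \<phi> \<psi>)
  then show "coeff_action (\<phi> + \<psi>) a = scale ((\<phi> + \<psi>) []) a"
    by (simp only: coeff_action_add plus_fun_apply scale_left_distrib)
qed (simp_all add: coeff_action_scale)

subsection \<open>The Hopf algebra\<close>

text \<open>The slot \<open>m\<close> leaves room for an involution.\<close>
definition universal_hopf :: "'m \<Rightarrow> ('k, 'a word \<Rightarrow> 'k, 'm) hopf_scheme"
  where "universal_hopf m =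
    \<lparr>carrier = \<U>, smul = scale_fun, mul = coeff_mul, unity = unit_coeff,
     comul = coeff_comul, counit = (\<lambda>\<phi>. \<phi> []), antipode = coeff_antipode, \<dots> = m\<rparr>"

lemma universal_hopf_simps [simp]:
  "carrier (universal_hopf m) = \<U>" "smul (universal_hopf m) = scale_fun"
  "mul (universal_hopf m) = coeff_mul" "unity (universal_hopf m) = unit_coeff"
  "comul (universal_hopf m) = coeff_comul" "counit (universal_hopf m) \<phi> = \<phi> []"
  "antipode (universal_hopf m) = coeff_antipode"
  by (simp_all add: universal_hopf_def)

lemma comul_closed: "\<phi> \<in> \<U> \<Longrightarrow> (x, y) \<in> set (coeff_comul \<phi>) \<Longrightarrow> x \<in> \<U> \<and> y \<in> \<U>"
  using splittingD(1)[OF splitting_comul] by blast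

lemma comul_eval:
  "\<phi> \<in> \<U> \<Longrightarrow> (\<Sum>z\<leftarrow>coeff_comul \<phi>. fst z u * snd z v) = \<phi> (u @ v)"
  using splittingD(2)[OF splitting_comul] by (simp add: case_prod_unfold)

text \<open>
  The axioms on \<open>\<Delta>\<close> hold because both sides take equal values at words; for coassociativity, the common
  value at \<open>(u, v, w)\<close> is \<open>\<phi> (u @ v @ w)\<close>.
\<close>
lemma hopf_algebra_universal: "hopf_algebra (universal_hopf m)"
proof (rule hopf_algebra.intro, unfold universal_hopf_simps)
  show "Vector_Spaces.vector_space scale_fun" by (rule vector_space_functions)
  show "module.subspace scale_fun \<U>" by (rule subspace_space)
  show "unit_coeff \<in> \<U>" by (rule unit_coeff_space)
  show "unit_coeff [] = 1" by (simp add: unit_coeff_simps)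
  fix g assume g: "g \<in> \<U>"
  have split_g: "splitting g (coeff_comul g)" by (rule splitting_comul[OF g])
  show "coeff_mul unit_coeff g = g" "coeff_mul g unit_coeff = g"
    by (rule coeff_mul_unit_left[OF g] coeff_mul_unit_right[OF g])+
  show "set (coeff_comul g) \<subseteq> \<U> \<times> \<U>" using comul_closed[OF g] by auto
  show "coeff_antipode g \<in> \<U>" by (rule coeff_antipode_closed[OF g])
  show "(\<Sum>(x, y)\<leftarrow>coeff_comul g. scale_fun (x []) y) = g"
    by (rule ext) (simp add: sum_list_fun_apply case_prod_unfold comul_eval[OF g])
  show "(\<Sum>(x, y)\<leftarrow>coeff_comul g. scale_fun (y []) x) = g"
    using comul_eval[OF g, of _ "[]"]
    by (intro ext) (simp add: sum_list_fun_apply case_prod_unfold mult.commute)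
  show "(\<Sum>(x, y)\<leftarrow>coeff_comul g. coeff_mul (coeff_antipode x) y) =
      scale_fun (g []) unit_coeff"
    by (rule splitting_antipode_left[OF g split_g])
  show "(\<Sum>(x, y)\<leftarrow>coeff_comul g. coeff_mul x (coeff_antipode y)) =
      scale_fun (g []) unit_coeff"
    by (rule splitting_antipode_right[OF g split_g])
  show "coeff_antipode (scale_fun c g) = scale_fun c (coeff_antipode g)" for c
    by (rule coeff_antipode_scale)
  show "tensor_eq scale_fun \<U> [[x, y]. (x, y) \<leftarrow> coeff_comul (scale_fun c g)]
      [[scale_fun c x, y]. (x, y) \<leftarrow> coeff_comul g]" for c
    using splitting_unique[OF splitting_comul[OF coeff_space.scale[OF g]] splitting_scale[OF split_g], of c]
    by (simp add: o_def case_prod_unfold)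
  show "tensor_eq scale_fun \<U>
      [[u, v, y]. (x, y) \<leftarrow> coeff_comul g, (u, v) \<leftarrow> coeff_comul x]
      [[x, u, v]. (x, y) \<leftarrow> coeff_comul g, (u, v) \<leftarrow> coeff_comul y]"
  proof (rule tensor_eq_functions[where n = 3])
    fix us :: "'a word list" assume "length us = 3"
    then obtain u v w where us: "us = [u, v, w]" by (auto simp: length_Suc_conv numeral_3_eq_3)
    have "(\<Sum>z\<leftarrow>coeff_comul g. \<Sum>z'\<leftarrow>coeff_comul (fst z). fst z' u * (snd z' v * snd z w)) =
        (\<Sum>z\<leftarrow>coeff_comul g. fst z (u @ v) * snd z w)"
    proof (intro arg_cong[of _ _ sum_list] map_cong refl)
      fix z assume "z \<in> set (coeff_comul g)"
      then have "fst z \<in> \<U>" using comul_closed[OF g, of "fst z" "snd z"] by simp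
      from comul_eval[OF this, of u v]
      show "(\<Sum>z'\<leftarrow>coeff_comul (fst z). fst z' u * (snd z' v * snd z w)) = fst z (u @ v) * snd z w"
        by (simp add: mult.assoc[symmetric] sum_list_mult_const)
    qed
    also have "\<dots> = g (u @ v @ w)" by (simp add: comul_eval[OF g])
    also have "\<dots> = (\<Sum>z\<leftarrow>coeff_comul g. fst z u * snd z (v @ w))" by (simp add: comul_eval[OF g])
    also have "\<dots> = (\<Sum>z\<leftarrow>coeff_comul g. \<Sum>z'\<leftarrow>coeff_comul (snd z). fst z u * (fst z' v * snd z' w))"
    proof (intro arg_cong[of _ _ sum_list] map_cong refl)
      fix z assume "z \<in> set (coeff_comul g)"
      then have "snd z \<in> \<U>" using comul_closed[OF g, of "fst z" "snd z"] by simp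
      from comul_eval[OF this, of v w]
      show "fst z u * snd z (v @ w) = (\<Sum>z'\<leftarrow>coeff_comul (snd z). fst z u * (fst z' v * snd z' w))"
        by (simp add: sum_list_const_mult)
    qed
    finally show "(\<Sum>w\<leftarrow>[[u, v, y]. (x, y) \<leftarrow> coeff_comul g, (u, v) \<leftarrow> coeff_comul x].
          word_eval (map (\<lambda>u \<phi>. \<phi> u) us) w) =
        (\<Sum>w\<leftarrow>[[x, u, v]. (x, y) \<leftarrow> coeff_comul g, (u, v) \<leftarrow> coeff_comul y].
          word_eval (map (\<lambda>u \<phi>. \<phi> u) us) w)"
      by (simp add: us sum_list_concat_map o_def case_prod_unfold)
  qed (auto dest!: comul_closed[OF g] dest: comul_closed)
  fix h assume h: "h \<in> \<U>"
  have split_h: "splitting h (coeff_comul h)" by (rule splitting_comul[OF h])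
  show "coeff_mul g h \<in> \<U>" by (rule coeff_mul_closed[OF g h])
  show "coeff_mul (scale_fun c g) h = scale_fun c (coeff_mul g h)"
    "coeff_mul g (scale_fun c h) = scale_fun c (coeff_mul g h)" for c
    by (rule coeff_mul_scale_left[OF g h] coeff_mul_scale_right[OF g h])+
  show "tensor_eq scale_fun \<U> [[x, y]. (x, y) \<leftarrow> coeff_comul (g + h)]
      ([[x, y]. (x, y) \<leftarrow> coeff_comul g] @ [[x, y]. (x, y) \<leftarrow> coeff_comul h])"
    using splitting_unique[OF splitting_comul[OF coeff_space_add[OF g h]] splitting_add[OF split_g split_h]]
    by simp
  show "tensor_eq scale_fun \<U> [[x, y]. (x, y) \<leftarrow> coeff_comul (coeff_mul g h)]
      [[coeff_mul x x', coeff_mul y y'].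
        (x, y) \<leftarrow> coeff_comul g, (x', y') \<leftarrow> coeff_comul h]"
  proof (rule tensor_eq_functions2)
    show "(\<Sum>w\<leftarrow>[[x, y]. (x, y) \<leftarrow> coeff_comul (coeff_mul g h)].
        word_eval [\<lambda>\<phi>. \<phi> u, \<lambda>\<phi>. \<phi> v] w) =
      (\<Sum>w\<leftarrow>[[coeff_mul x x', coeff_mul y y'].
        (x, y) \<leftarrow> coeff_comul g, (x', y') \<leftarrow> coeff_comul h].
        word_eval [\<lambda>\<phi>. \<phi> u, \<lambda>\<phi>. \<phi> v] w)" for u v
      using splitting_product[OF g split_g h split_h, of u v] comul_eval[OF coeff_mul_closed[OF g h], of u v]
      by (simp add: sum_list_concat_map o_def case_prod_unfold)
  qed (auto dest!: comul_closed[OF g] comul_closed[OF h] comul_closed[OF coeff_mul_closed[OF g h]]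
      intro: coeff_mul_closed)
  show "coeff_mul g h [] = g [] * h []"
    using coeff_mul_eqI[of g h "[]" "g [] * h []"] by (simp add: product_value_def) blast
  show "coeff_antipode (g + h) = coeff_antipode g + coeff_antipode h"
    by (rule coeff_antipode_add)
  fix k assume k: "k \<in> \<U>"
  show "coeff_mul (coeff_mul g h) k = coeff_mul g (coeff_mul h k)"
    by (rule coeff_mul_assoc[OF g h k])
  show "coeff_mul (g + h) k = coeff_mul g k + coeff_mul h k"
    by (rule coeff_mul_add_left[OF g h k])
  show "coeff_mul g (h + k) = coeff_mul g h + coeff_mul g k"
    by (rule coeff_mul_add_right[OF g h k])
next
  show "tensor_eq scale_fun \<U> [[x, y]. (x, y) \<leftarrow> coeff_comul unit_coeff]
      [[unit_coeff, unit_coeff]]"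
  proof (rule tensor_eq_functions2)
    show "(\<Sum>w\<leftarrow>[[x, y]. (x, y) \<leftarrow> coeff_comul unit_coeff]. word_eval [\<lambda>\<phi>. \<phi> u, \<lambda>\<phi>. \<phi> v] w) =
      (\<Sum>w\<leftarrow>[[unit_coeff, unit_coeff]]. word_eval [\<lambda>\<phi>. \<phi> u, \<lambda>\<phi>. \<phi> v] w)" for u v
      using comul_eval[OF unit_coeff_space, of u v]
        coeff_append[of "{()}" "()" trivial_system "()" u v]
      by (simp add: o_def case_prod_unfold unit_coeff_def)
  qed (auto dest!: comul_closed[OF unit_coeff_space] simp: unit_coeff_space)
qed (simp_all add: plus_fun_apply)

lemma hopf_action_universal:
  assumes "\<And>t. \<tau> = Some t \<Longrightarrow> t \<in> T" "\<And>B. A' = Some B \<Longrightarrow> B \<subseteq> Fix"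
  shows "hopf_action scale \<tau> A' (universal_hopf m) coeff_action"
proof (rule hopf_action.intro, unfold universal_hopf_simps)
  fix g a assume g: "g \<in> \<U>"
  note op = coeff_action_operator[OF g]
  show "coeff_action g (a + b) = coeff_action g a + coeff_action g b" for b
    using linear_onD(1)[OF op] by simp
  show "coeff_action g (scale c a) = scale c (coeff_action g a)" for c
    using linear_onD(2)[OF op] by simp
  show "coeff_action (scale_fun c g) a = scale c (coeff_action g a)" for c
    by (rule coeff_action_scale[OF g])
  show "coeff_action g (a * b) = (\<Sum>(x, y)\<leftarrow>coeff_comul g. coeff_action x a * coeff_action y b)" for b
    by (rule coeff_action_mult[OF g splitting_comul[OF g]])
  show "coeff_action g 1 = scale (g []) 1"
    by (rule coeff_action_Fix[OF one_in_Fix g])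
  show "t (coeff_action g a) = g [] * t a" if "\<tau> = Some t" for t
    by (rule coeff_action_T[OF assms(1)[OF that] g])
  show "coeff_action g a = scale (g []) a" if "A' = Some B" "a \<in> B" for B
    by (rule coeff_action_Fix[OF _ g]) (use assms(2)[OF that(1)] that in auto)
  fix h assume h: "h \<in> \<U>"
  show "coeff_action (g + h) a = coeff_action g a + coeff_action h a"
    by (rule coeff_action_add[OF g h])
  show "coeff_action (coeff_mul g h) a = coeff_action g (coeff_action h a)"
    by (rule coeff_action_product[OF g h])
qed (simp_all add: coeff_action_unit)

end

section \<open>The universal morphism\<close>

declare zero_fun_apply [simp del]

text \<open>
  The map \<open>\<sigma> i\<close> is the power \<open>S\<^bsup>i\<^esup>\<close> of the antipode; it is a parameter because the way to define negative
  powers depends on what makes the antipode invertible.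
\<close>
locale acting_hopf_algebra =
  measured_algebra scale I basis T Fix + H: hopf_algebra H + hopf_action scale \<tau> A' H act
  for scale :: "'k::field \<Rightarrow> 'a::{ring, monoid_mult} \<Rightarrow> 'a"
    and I basis T Fix \<tau> A' and H :: "('k, 'h::ab_group_add, 'm) hopf_scheme" (structure) and act +
  fixes \<sigma> :: "int \<Rightarrow> 'h \<Rightarrow> 'h"
  assumes \<sigma>_zero: "h \<in> carrier H \<Longrightarrow> \<sigma> 0 h = h"
    and \<sigma>_closed: "i \<in> I \<Longrightarrow> h \<in> carrier H \<Longrightarrow> \<sigma> i h \<in> carrier H"
    and \<sigma>_linear: "i \<in> I \<Longrightarrow> linear_on (smul H) (carrier H) (smul H) (\<sigma> i)"
    and \<sigma>_unity: "i \<in> I \<Longrightarrow> \<sigma> i \<one> = \<one>"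
    and \<sigma>_mul: "i \<in> I \<Longrightarrow> g \<in> carrier H \<Longrightarrow> h \<in> carrier H \<Longrightarrow>
      \<sigma> i (g \<odot> h) = (if even i then \<sigma> i g \<odot> \<sigma> i h else \<sigma> i h \<odot> \<sigma> i g)"
    and \<sigma>_succ: "i \<in> I \<Longrightarrow> h \<in> carrier H \<Longrightarrow> \<sigma> (i + 1) h = \<sigma> i (antipode H h)"
    and act_T: "t \<in> T \<Longrightarrow> h \<in> carrier H \<Longrightarrow> t (act h a) = counit H h * t a"
    and act_Fix: "a \<in> Fix \<Longrightarrow> h \<in> carrier H \<Longrightarrow> act h a = scale (counit H h) a"
begin

lemma operator_act: "h \<in> carrier H \<Longrightarrow> operator (act h)"
  by (rule linear_onI) (simp_all add: act_add_right act_scale_right)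

lemma linear_act: "linear_on (smul H) (carrier H) scale (\<lambda>h. act h a)"
  by (rule linear_onI) (simp_all add: act_add_left act_smul_left)

lemma act_sum: "(\<And>x. x \<in> N \<Longrightarrow> f x \<in> carrier H) \<Longrightarrow> act (\<Sum>x\<in>N. f x) a = (\<Sum>x\<in>N. act (f x) a)"
  by (rule linear_on_sum[OF H.vector_space H.subspace vector_space_axioms linear_act])

lemma act_zero: "act 0 a = 0"
  using linear_onD(2)[OF linear_act, of 0 0 a] by simp

lemma \<sigma>_sum:
  "i \<in> I \<Longrightarrow> (\<And>x. x \<in> N \<Longrightarrow> f x \<in> carrier H) \<Longrightarrow> \<sigma> i (\<Sum>x\<in>N. f x) = (\<Sum>x\<in>N. \<sigma> i (f x))"
  by (rule linear_on_sum[OF H.vector_space H.subspace H.vector_space \<sigma>_linear])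

lemma \<sigma>_0: "i \<in> I \<Longrightarrow> \<sigma> i 0 = 0"
  using linear_onD(2)[OF \<sigma>_linear, of i 0 0] by simp

lemma act_\<sigma>_mul:
  assumes "i \<in> I" "g \<in> carrier H" "h \<in> carrier H"
  shows "act (\<sigma> i (g \<odot> h)) = twisted_comp i (act (\<sigma> i g)) (act (\<sigma> i h))"
  using assms by (auto simp: fun_eq_iff \<sigma>_mul twisted_comp_def act_mul \<sigma>_closed)

definition comatrix_system :: "('i \<Rightarrow> 'i \<Rightarrow> 'h) \<Rightarrow> int \<Rightarrow> 'i \<Rightarrow> 'i \<Rightarrow> 'a \<Rightarrow> 'a"
  where "comatrix_system c i p q = act (\<sigma> i (c p q))"

lemma bilinear_act_mult: "H.bilinear scale (\<lambda>x y. act x a * act y b)"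
  by (rule bilinear_onI)
    (simp_all add: act_add_left act_smul_left algebra_simps scale_mult_left scale_mult_right)

text \<open>
  The axioms of the action, and for the inverses the antipode axioms under \<open>\<sigma> i\<close>, which preserves or
  reverses products.
\<close>
lemma coeff_system_comatrix:
  assumes c: "H.comatrix N c"
  shows "coeff_system N (comatrix_system c)"
proof (rule coeff_systemI)
  note C = H.comatrixD[OF c]
  show "finite N" by (rule C(1))
  fix p q assume pq: "p \<in> N" "q \<in> N"
  show "operator (comatrix_system c i p q)" if "i \<in> I" for i
    unfolding comatrix_system_def using that pq by (intro operator_act \<sigma>_closed C(2))
  have "act (c p q) (a * b) = (\<Sum>r\<in>N. act (c p r) a * act (c r q) b)" for a b
    using H.comatrix_sweedler[OF c vector_space_axioms bilinear_act_mult pq, of a b]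
      act_mult[OF C(2)[OF pq]] by (simp add: H.sweedler_def)
  then show "comatrix_system c 0 p q (a * b) =
      (\<Sum>r\<in>N. comatrix_system c 0 p r a * comatrix_system c 0 r q b)" for a b
    using pq by (simp add: comatrix_system_def \<sigma>_zero C)
  show "t (comatrix_system c 0 p q a) = (if p = q then t a else 0)" if "t \<in> T" for t a
    using pq act_T[OF that] by (simp add: comatrix_system_def \<sigma>_zero C)
  show "comatrix_system c 0 p q a = (if p = q then a else 0)" if "a \<in> Fix" for a
    using pq act_Fix[OF that] by (simp add: comatrix_system_def \<sigma>_zero C)
  fix i a assume i: "i \<in> I"
  have delta: "act (\<sigma> i (if p = q then \<one> else 0)) a = (if p = q then a else 0)"
    by (simp add: \<sigma>_unity \<sigma>_0 i act_unity act_zero)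
  have "(\<Sum>r\<in>N. twisted_comp i (comatrix_system c i p r) (comatrix_system c (i + 1) r q) a) =
      (\<Sum>r\<in>N. act (\<sigma> i (c p r \<odot> antipode H (c r q))) a)"
    using pq by (intro sum.cong refl) (simp add: comatrix_system_def \<sigma>_succ i C act_\<sigma>_mul)
  also have "\<dots> = act (\<sigma> i (\<Sum>r\<in>N. c p r \<odot> antipode H (c r q))) a"
    using pq by (simp add: \<sigma>_sum act_sum \<sigma>_closed i C)
  finally show "(\<Sum>r\<in>N. twisted_comp i (comatrix_system c i p r) (comatrix_system c (i + 1) r q) a) =
      (if p = q then a else 0)"
    using delta by (simp add: H.comatrix_antipode_right[OF c pq])
  have "(\<Sum>r\<in>N. twisted_comp i (comatrix_system c (i + 1) p r) (comatrix_system c i r q) a) =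
      (\<Sum>r\<in>N. act (\<sigma> i (antipode H (c p r) \<odot> c r q)) a)"
    using pq by (intro sum.cong refl) (simp add: comatrix_system_def \<sigma>_succ i C act_\<sigma>_mul)
  also have "\<dots> = act (\<sigma> i (\<Sum>r\<in>N. antipode H (c p r) \<odot> c r q)) a"
    using pq by (simp add: \<sigma>_sum act_sum \<sigma>_closed i C)
  finally show "(\<Sum>r\<in>N. twisted_comp i (comatrix_system c (i + 1) p r) (comatrix_system c i r q) a) =
      (if p = q then a else 0)"
    using delta by (simp add: H.comatrix_antipode_left[OF c pq])
qed

fun letter_value :: "int \<times> 'a \<times> 'a \<Rightarrow> 'h \<Rightarrow> 'k"
  where "letter_value (i, a, b) h = (if i \<in> I then coordinate b (act (\<sigma> i h) a) else 0)"

text \<open>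
  The recursion makes linearity evident.  On the entries of a comatrix it is the recursion of the
  coefficients of the associated system.
\<close>
primrec word_value :: "'a word \<Rightarrow> 'h \<Rightarrow> 'k"
  where
    "word_value [] = counit H"
  | "word_value (l # w) = H.sweedler (\<lambda>x y. letter_value l x * word_value w y)"

definition universal_map :: "'h \<Rightarrow> 'a word \<Rightarrow> 'k"
  where "universal_map h w = word_value w h"

lemma functional_letter_value: "H.functional (letter_value l)"
proof -
  obtain i a b where l: "l = (i, a, b)" by (cases l) auto
  show ?thesis
    by (cases "i \<in> I"; rule linear_onI)
      (simp_all add: l linear_onD[OF \<sigma>_linear] act_add_left act_smul_left \<sigma>_closed coordinate_add
        coordinate_scale)
qed

lemma functional_word_value: "H.functional (word_value w)"
proof (induction w)
  case Nil
  then show ?case using H.functional_counit by simp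
next
  case (Cons l w)
  then show ?case
    using H.linear_on_sweedler[OF vector_space_field bilinear_on_product[OF functional_letter_value Cons]]
    by simp
qed

lemma word_value_singleton:
  assumes "h \<in> carrier H"
  shows "word_value [l] h = letter_value l h"
  using H.functional_hit[OF functional_letter_value H.functional_counit assms] H.hit_counit[OF assms]
  by simp

lemma word_value_append:
  assumes "h \<in> carrier H"
  shows "word_value (u @ v) h = H.sweedler (\<lambda>x y. word_value u x * word_value v y) h"
  using assms
proof (induction u arbitrary: h)
  case Nil
  have "word_value v h = word_value v (H.sweedler (\<lambda>x y. smul H (counit H x) y) h)"
    using Nil by (simp add: H.sweedler_counit_left)
  also have "\<dots> = H.sweedler (\<lambda>x y. word_value v (smul H (counit H x) y)) h"
    by (rule H.sweedler_linear[OF Nil vector_space_field functional_word_value]) simp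
  also have "\<dots> = H.sweedler (\<lambda>x y. counit H x * word_value v y) h"
    by (rule H.sweedler_cong[OF Nil]) (simp add: linear_onD[OF functional_word_value])
  finally show ?case by simp
next
  case (Cons l u)
  let ?B = "\<lambda>x y z. letter_value l x * (word_value u y * word_value v z)"
  have "word_value ((l # u) @ v) h = H.sweedler (\<lambda>x y. H.sweedler (?B x) y) h"
    using Cons.prems
    by (simp, intro H.sweedler_cong) (simp_all add: Cons.IH H.sweedler_mult_left)
  also have "\<dots> = H.sweedler (\<lambda>x y. H.sweedler (\<lambda>x' y'. ?B x' y' y) x) h"
    by (rule H.sweedler_coassoc[OF vector_space_field _ Cons.prems, symmetric],
        rule trilinear_onI, rule bilinear_onI)
      (simp_all add: linear_onD[OF functional_letter_value] linear_onD[OF functional_word_value] algebra_simps)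
  also have "\<dots> = H.sweedler (\<lambda>x y. word_value (l # u) x * word_value v y) h"
  proof (intro H.sweedler_cong Cons.prems)
    fix x y
    have "H.sweedler (\<lambda>x' y'. ?B x' y' y) x =
        H.sweedler (\<lambda>x' y'. word_value v y * (letter_value l x' * word_value u y')) x"
      by (simp add: algebra_simps)
    then show "H.sweedler (\<lambda>x' y'. ?B x' y' y) x = word_value (l # u) x * word_value v y"
      by (simp add: H.sweedler_mult_left mult.commute)
  qed
  finally show ?case .
qed

lemma universal_map_comatrix:
  assumes c: "H.comatrix N c" and pq: "p \<in> N" "q \<in> N"
  shows "universal_map (c p q) = coeff N (comatrix_system c) p q"
proof
  fix w
  show "universal_map (c p q) w = coeff N (comatrix_system c) p q w"
    using pq(1)
  proof (induction w arbitrary: p)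
    case Nil
    then show ?case using pq(2) H.comatrixD(3)[OF c] by (simp add: universal_map_def)
  next
    case (Cons l w)
    obtain i a b where l: "l = (i, a, b)" by (cases l) auto
    have "universal_map (c p q) (l # w) = (\<Sum>r\<in>N. letter_value l (c p r) * word_value w (c r q))"
      unfolding universal_map_def word_value.simps
      by (rule H.comatrix_sweedler[OF c vector_space_field _ Cons.prems pq(2)])
        (rule bilinear_on_product[OF functional_letter_value functional_word_value])
    then show ?case
      using Cons.IH by (simp add: universal_map_def l comatrix_system_def cong: sum.cong)
  qed
qed

lemma universal_map_add:
  "g \<in> carrier H \<Longrightarrow> h \<in> carrier H \<Longrightarrow> universal_map (g + h) = universal_map g + universal_map h"
  by (rule ext) (simp add: universal_map_def plus_fun_apply linear_onD[OF functional_word_value])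

lemma universal_map_smul:
  "h \<in> carrier H \<Longrightarrow> universal_map (smul H c h) = scale_fun c (universal_map h)"
  by (rule ext) (simp add: universal_map_def linear_onD[OF functional_word_value])

lemma universal_map_zero: "universal_map 0 = 0"
  using universal_map_smul[of 0 0] by (simp add: zero_fun_def)

lemma universal_map_closed: "h \<in> carrier H \<Longrightarrow> universal_map h \<in> \<U>"
proof (induction h rule: H.comatrix_induct)
  case (comatrix N c p q)
  then show ?case
    using coeff_in_space[OF coeff_system_comatrix[OF comatrix(1)] comatrix(2,3)]
    by (simp add: universal_map_comatrix)
qed (simp_all add: universal_map_add universal_map_smul universal_map_zero coeff_space_add
    coeff_space.scale zero_space)

lemma product_zero: "\<phi> \<in> \<U> \<Longrightarrow> coeff_mul 0 \<phi> = 0" "\<phi> \<in> \<U> \<Longrightarrow> coeff_mul \<phi> 0 = 0"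
  using coeff_mul_scale_left[OF zero_space, of \<phi> 0] coeff_mul_scale_right[OF _ zero_space, of \<phi> 0]
  by (auto simp: zero_fun_def)

text \<open>The product of two comatrices acts by the tensor product of their systems.\<close>
lemma universal_map_mul:
  assumes "g \<in> carrier H" "h \<in> carrier H"
  shows "universal_map (g \<odot> h) = coeff_mul (universal_map g) (universal_map h)"
  using assms(1)
proof (induction g rule: H.comatrix_induct)
  case c: (comatrix N c p q)
  note C = H.comatrixD[OF c(1)]
  from assms(2) show ?case
  proof (induction h rule: H.comatrix_induct)
    case (comatrix M d p' q')
    note D = H.comatrixD[OF comatrix(1)]
    let ?cd = "\<lambda>(p, p') (q, q'). c p q \<odot> d p' q'"
    have "universal_map (?cd (p, p') (q, q')) =
        coeff (N \<times> M) (comatrix_system ?cd) (p, p') (q, q')"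
      by (rule universal_map_comatrix[OF H.comatrix_mul[OF c(1) comatrix(1)]])
        (use c comatrix in auto)
    also have "\<dots> = coeff (N \<times> M)
        (tensor_system (comatrix_system c) (comatrix_system d)) (p, p') (q, q')"
      by (rule ext, rule coeff_cong)
        (use c comatrix C D in \<open>auto simp: comatrix_system_def tensor_system_def act_\<sigma>_mul\<close>)
    also have "\<dots> = coeff_mul (universal_map (c p q)) (universal_map (d p' q'))"
      using c comatrix by (simp add: universal_map_comatrix coeff_mul_coeff
          coeff_system_comatrix)
    finally show ?case by simp
  next
    case (add g h)
    then show ?case using c C
      by (simp add: H.mul_add_right universal_map_add coeff_mul_add_right universal_map_closed)
  next
    case (smul a h)
    then show ?case using c C
      by (simp add: H.mul_smul_right universal_map_smul coeff_mul_scale_right universal_map_closed)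
  qed (use c C in \<open>simp add: universal_map_zero product_zero universal_map_closed\<close>)
next
  case (add g g')
  then show ?case using assms(2)
    by (simp add: H.mul_add_left universal_map_add coeff_mul_add_left universal_map_closed)
next
  case (smul a g)
  then show ?case using assms(2)
    by (simp add: H.mul_smul_left universal_map_smul coeff_mul_scale_left universal_map_closed)
qed (use assms(2) in \<open>simp add: universal_map_zero product_zero universal_map_closed\<close>)

lemma universal_map_unity: "universal_map \<one> = unit_coeff"
proof
  fix w
  show "universal_map \<one> w = unit_coeff w"
  proof (induction w)
    case Nil
    then show ?case by (simp add: universal_map_def H.counit_unity unit_coeff_simps)
  next
    case (Cons l w)
    obtain i a b where l: "l = (i, a, b)" by (cases l) auto
    have "universal_map \<one> (l # w) = letter_value l \<one> * universal_map \<one> w"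
      unfolding universal_map_def word_value.simps
      by (rule H.sweedler_unity[OF vector_space_field])
        (rule bilinear_on_product[OF functional_letter_value functional_word_value])
    then show ?case
      using Cons by (simp add: unit_coeff_simps l \<sigma>_unity act_unity trivial_system_def)
  qed
qed

lemma universal_map_comul:
  assumes "h \<in> carrier H"
  shows "tensor_eq scale_fun \<U> [[x, y]. (x, y) \<leftarrow> coeff_comul (universal_map h)]
    [[universal_map x, universal_map y]. (x, y) \<leftarrow> comul H h]"
proof (rule tensor_eq_functions2)
  show "(\<Sum>w\<leftarrow>[[x, y]. (x, y) \<leftarrow> coeff_comul (universal_map h)]. word_eval [\<lambda>\<phi>. \<phi> u, \<lambda>\<phi>. \<phi> v] w) =
      (\<Sum>w\<leftarrow>[[universal_map x, universal_map y]. (x, y) \<leftarrow> comul H h]. word_eval [\<lambda>\<phi>. \<phi> u, \<lambda>\<phi>. \<phi> v] w)" for u v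
    using comul_eval[OF universal_map_closed[OF assms], of u v] word_value_append[OF assms, of u v]
    by (simp add: o_def case_prod_unfold universal_map_def H.sweedler_def)
qed (auto dest!: comul_closed[OF universal_map_closed[OF assms]] subsetD[OF H.comul_closed[OF assms]]
    intro: universal_map_closed)

lemma hopf_morphism_universal_map: "hopf_morphism H (universal_hopf m) universal_map"
proof (rule hopf_morphism.intro, unfold universal_hopf_simps)
  fix g assume g: "g \<in> carrier H"
  show "universal_map g \<in> \<U>" by (rule universal_map_closed[OF g])
  show "universal_map (smul H c g) = scale_fun c (universal_map g)" for c
    by (rule universal_map_smul[OF g])
  show "tensor_eq scale_fun \<U> [[x, y]. (x, y) \<leftarrow> coeff_comul (universal_map g)]
    [[universal_map x, universal_map y]. (x, y) \<leftarrow> comul H g]" by (rule universal_map_comul[OF g])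
  show "universal_map g [] = counit H g" by (simp add: universal_map_def)
  have "universal_map (antipode H g) = antipode (universal_hopf m) (universal_map g)"
    by (rule bialgebra_morphism_antipode[OF H.hopf_algebra_axioms hopf_algebra_universal _ _ _ _ _ _ g])
      (auto intro!: linear_onI simp: universal_map_closed universal_map_add universal_map_smul
        universal_map_mul universal_map_unity universal_map_comul, simp add: universal_map_def)
  then show "universal_map (antipode H g) = coeff_antipode (universal_map g)" by simp
  fix h assume h: "h \<in> carrier H"
  show "universal_map (g + h) = universal_map g + universal_map h" by (rule universal_map_add[OF g h])
  show "universal_map (g \<odot> h) = coeff_mul (universal_map g) (universal_map h)"
    by (rule universal_map_mul[OF g h])
qed (rule universal_map_unity)

lemma universal_map_letter: "h \<in> carrier H \<Longrightarrow> universal_map h [l] = letter_value l h"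
  using word_value_singleton by (simp add: universal_map_def)

lemma action_universal_map:
  assumes "h \<in> carrier H"
  shows "coeff_action (universal_map h) a = act h a"
  by (rule coeff_action_eqI) (simp add: universal_map_letter assms zero_in_I \<sigma>_zero)

text \<open>
  A coefficient function is determined by its values on single letters and its comultiplication.
\<close>
lemma universal_map_unique:
  assumes \<psi>: "hopf_morphism H (universal_hopf m) \<psi>"
    and action: "\<forall>h\<in>carrier H. \<forall>a. act h a = coeff_action (\<psi> h) a"
    and power: "\<And>h i a b. h \<in> carrier H \<Longrightarrow> i \<in> I \<Longrightarrow> \<psi> h [(i, a, b)] = \<psi> (\<sigma> i h) [(0, a, b)]"
    and h: "h \<in> carrier H"
  shows "\<psi> h = universal_map h"
proof
  interpret \<psi>: hopf_morphism H "universal_hopf m" \<psi> by fact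
  have closed: "\<psi> h \<in> \<U>" if "h \<in> carrier H" for h
    using \<psi>.map_closed[OF that] by simp
  have letter: "\<psi> h [l] = letter_value l h" if h: "h \<in> carrier H" for h l
  proof -
    obtain i a b where l: "l = (i, a, b)" by (cases l) auto
    show ?thesis
    proof (cases "i \<in> I")
      case True
      have "coordinate b (act (\<sigma> i h) a) = \<psi> (\<sigma> i h) [(0, a, b)]"
        using action coordinate_action[OF closed] \<sigma>_closed[OF True h] by simp
      then show ?thesis using power[OF h True] True by (simp add: l)
    next
      case False
      then show ?thesis using coeff_space_outside[OF closed[OF h]] by (simp add: l)
    qed
  qed
  fix w
  show "\<psi> h w = universal_map h w"
    using h
  proof (induction w arbitrary: h)
    case Nil
    then show ?case using \<psi>.map_counit by (simp add: universal_map_def)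
  next
    case (Cons l w)
    have B: "bilinear_on scale_fun \<U> (*) (\<lambda>x y. x [l] * y w)"
      by (rule bilinear_onI) (simp_all add: plus_fun_apply algebra_simps)
    have \<psi>h: "\<psi> h \<in> \<U>" using \<psi>.map_closed[OF Cons.prems] by simp
    have "\<psi> h (l # w) = (\<Sum>z\<leftarrow>coeff_comul (\<psi> h). fst z [l] * snd z w)"
      using comul_eval[OF \<psi>h, of "[l]" w] by simp
    also have "\<dots> = (\<Sum>z\<leftarrow>comul H h. \<psi> (fst z) [l] * \<psi> (snd z) w)"
      using vector_space.tensor_eq_bilinear_words[OF vector_space_field B, of _ _]
        \<psi>.map_comul[OF Cons.prems]
      by (fastforce simp: o_def case_prod_unfold)
    also have "\<dots> = H.sweedler (\<lambda>x y. \<psi> x [l] * \<psi> y w) h"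
      by (simp add: H.sweedler_def case_prod_unfold)
    also have "\<dots> = H.sweedler (\<lambda>x y. letter_value l x * universal_map y w) h"
      by (rule H.sweedler_cong[OF Cons.prems]) (simp add: letter Cons.IH)
    finally show ?case by (simp add: universal_map_def)
  qed
qed

text \<open>
  The common part of both universal properties; \<open>Mor\<close> singles out the morphisms.
\<close>
lemma universal_map_ex1:
  assumes "Mor (restrict universal_map (carrier H))"
    and unique: "\<And>\<psi> h. Mor \<psi> \<Longrightarrow> (\<forall>h\<in>carrier H. \<forall>a. act h a = coeff_action (\<psi> h) a) \<Longrightarrow>
      h \<in> carrier H \<Longrightarrow> \<psi> h = universal_map h"
  shows "\<exists>!\<psi>. \<psi> \<in> extensional (carrier H) \<and> Mor \<psi> \<and>
    (\<forall>h\<in>carrier H. \<forall>a. act h a = coeff_action (\<psi> h) a)"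
proof (rule ex1I[of _ "restrict universal_map (carrier H)"])
  fix \<psi> assume \<psi>: "\<psi> \<in> extensional (carrier H) \<and> Mor \<psi> \<and>
    (\<forall>h\<in>carrier H. \<forall>a. act h a = coeff_action (\<psi> h) a)"
  show "\<psi> = restrict universal_map (carrier H)"
  proof (rule extensionalityI)
    fix h assume h: "h \<in> carrier H"
    have "\<psi> h = universal_map h" by (rule unique) (use \<psi> h in blast)+
    then show "\<psi> h = restrict universal_map (carrier H) h" using h by simp
  qed (use \<psi> in auto)
qed (simp add: assms(1) action_universal_map)

end

section \<open>Terminal objects\<close>

lemma tensor_eq_refl: "tensor_eq s V ws ws"
proof -
  interpret vector_space free_scale by (rule vector_space_free_scale)
  show ?thesis by (simp add: tensor_eq_def span_zero)
qed

lemma tensor_eq_trans: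
  fixes s :: "'k::field \<Rightarrow> 'v::ab_group_add \<Rightarrow> 'v"
  assumes "tensor_eq s V ws ws'" "tensor_eq s V ws' ws''"
  shows "tensor_eq s V ws ws''"
proof -
  interpret vector_space "free_scale :: 'k \<Rightarrow> ('v list \<Rightarrow>\<^sub>0 'k) \<Rightarrow> _" by (rule vector_space_free_scale)
  show ?thesis using span_add[OF assms[unfolded tensor_eq_def]] by (simp add: tensor_eq_def)
qed

lemma tensor_eq_map:
  assumes "carrier_space s' V'" and f: "linear_on s V s' f" "\<And>x. x \<in> V \<Longrightarrow> f x \<in> V'"
    and L: "set L \<subseteq> V \<times> V" "set L' \<subseteq> V \<times> V"
    and eq: "tensor_eq s V [[x, y]. (x, y) \<leftarrow> L] [[x, y]. (x, y) \<leftarrow> L']"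
  shows "tensor_eq s' V' [[f x, f y]. (x, y) \<leftarrow> L] [[f x, f y]. (x, y) \<leftarrow> L']"
proof -
  interpret V': carrier_space s' V' by fact
  let ?f = "map (\<lambda>(x, y). (f x, f y))"
  have "tensor_eq s' V' [[x, y]. (x, y) \<leftarrow> ?f L] [[x, y]. (x, y) \<leftarrow> ?f L']"
  proof (rule V'.tensor_eqI2[where P = "{g. linear_on s' V' (*) g}"])
    fix g h assume "g \<in> {g. linear_on s' V' (*) g}" "h \<in> {g. linear_on s' V' (*) g}"
    then have gh: "linear_on s' V' (*) g" "linear_on s' V' (*) h" by auto
    have "bilinear_on s V (*) (\<lambda>x y. g (f x) * h (f y))"
      by (rule bilinear_onI)
        (simp_all add: linear_onD[OF f(1)] f(2) linear_onD[OF gh(1)] linear_onD[OF gh(2)] algebra_simps)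
    from vector_space.tensor_eq_bilinear[OF vector_space_field this eq]
    show "(\<Sum>(x, y)\<leftarrow>?f L. g x * h y) = (\<Sum>(x, y)\<leftarrow>?f L'. g x * h y)"
      by (simp add: o_def case_prod_unfold)
  qed (use L f(2) V'.linear_functionals_separate in auto)
  then show ?thesis by (simp add: o_def case_prod_unfold)
qed

lemma hopf_morphism_linear: "hopf_morphism H K \<psi> \<Longrightarrow> linear_on (smul H) (carrier H) (smul K) \<psi>"
  by (rule linear_onI) (simp_all add: hopf_morphism.map_add hopf_morphism.map_smul)

lemma hopf_morphism_cong:
  assumes "hopf_algebra H" "hopf_morphism H K \<psi>" and eq: "\<And>h. h \<in> carrier H \<Longrightarrow> \<psi>' h = \<psi> h"
  shows "hopf_morphism H K \<psi>'"
proof -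
  interpret H: hopf_algebra H by fact
  interpret \<psi>: hopf_morphism H K \<psi> by fact
  show ?thesis
  proof
    fix h assume h: "h \<in> carrier H"
    have words: "[[\<psi>' x, \<psi>' y]. (x, y) \<leftarrow> comul H h] = [[\<psi> x, \<psi> y]. (x, y) \<leftarrow> comul H h]"
      using H.comul_closed[OF h] eq by (intro map_cong refl) auto
    show "tensor_eq (smul K) (carrier K) [[x, y]. (x, y) \<leftarrow> comul K (\<psi>' h)]
        [[\<psi>' x, \<psi>' y]. (x, y) \<leftarrow> comul H h]"
      unfolding words eq[OF h] by (rule \<psi>.map_comul[OF h])
  qed (simp_all add: eq \<psi>.map_closed \<psi>.map_add \<psi>.map_smul \<psi>.map_mul \<psi>.map_unity \<psi>.map_counit
      \<psi>.map_antipode)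
qed

lemma hopf_morphism_id: "hopf_algebra H \<Longrightarrow> hopf_morphism H H (\<lambda>h. h)"
  by unfold_locales (auto intro: tensor_eq_refl)

lemma hopf_morphism_compose:
  assumes "hopf_algebra H" "hopf_algebra K" "hopf_algebra L" "hopf_morphism H K \<psi>" "hopf_morphism K L \<chi>"
  shows "hopf_morphism H L (\<lambda>h. \<chi> (\<psi> h))"
proof -
  interpret H: hopf_algebra H by fact
  interpret K: hopf_algebra K by fact
  interpret L: hopf_algebra L by fact
  interpret \<psi>: hopf_morphism H K \<psi> by fact
  interpret \<chi>: hopf_morphism K L \<chi> by fact
  show ?thesis
  proof
    fix h assume h: "h \<in> carrier H"
    let ?L = "map (\<lambda>(x, y). (\<psi> x, \<psi> y)) (comul H h)"
    have "tensor_eq (smul L) (carrier L) [[\<chi> x, \<chi> y]. (x, y) \<leftarrow> comul K (\<psi> h)] [[\<chi> x, \<chi> y]. (x, y) \<leftarrow> ?L]"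
    proof (rule tensor_eq_map[OF L.V.carrier_space_axioms hopf_morphism_linear[OF \<open>hopf_morphism K L \<chi>\<close>] \<chi>.map_closed])
      show "set (comul K (\<psi> h)) \<subseteq> carrier K \<times> carrier K"
        by (rule K.comul_closed[OF \<psi>.map_closed[OF h]])
      show "set ?L \<subseteq> carrier K \<times> carrier K"
        using H.comul_closed[OF h] \<psi>.map_closed by auto
      show "tensor_eq (smul K) (carrier K) [[x, y]. (x, y) \<leftarrow> comul K (\<psi> h)] [[x, y]. (x, y) \<leftarrow> ?L]"
        using \<psi>.map_comul[OF h] by (simp add: o_def case_prod_unfold)
    qed
    then show "tensor_eq (smul L) (carrier L) [[x, y]. (x, y) \<leftarrow> comul L (\<chi> (\<psi> h))]
        [[\<chi> (\<psi> x), \<chi> (\<psi> y)]. (x, y) \<leftarrow> comul H h]"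
      using tensor_eq_trans[OF \<chi>.map_comul[OF \<psi>.map_closed[OF h]]] by (simp add: o_def case_prod_unfold)
  qed (simp_all add: \<psi>.map_closed \<psi>.map_add \<psi>.map_smul \<psi>.map_mul \<psi>.map_unity \<psi>.map_counit
      \<psi>.map_antipode \<chi>.map_closed \<chi>.map_add \<chi>.map_smul \<chi>.map_mul \<chi>.map_unity \<chi>.map_counit
      \<chi>.map_antipode)
qed

text \<open>
  Two terminal objects \<open>U\<close> and \<open>H\<close> are isomorphic, so whatever maps uniquely to \<open>U\<close> maps uniquely
  to \<open>H\<close>.  The predicates single out the morphisms between the objects in question; \<open>C\<close> and \<open>C'\<close>
  are the carriers of \<open>H\<close> and of the test object.
\<close>
lemma terminal_transport:
  assumes f: "mor_HU f" and g: "mor_UH g"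
    and unique_H: "\<exists>!\<psi>. \<psi> \<in> extensional C \<and> mor_HH \<psi>"
    and id: "mor_HH (restrict (\<lambda>h. h) C)"
    and comp: "mor_HU f \<Longrightarrow> mor_UH g \<Longrightarrow> mor_HH (restrict (\<lambda>h. g (f h)) C)"
    and unique_U: "\<exists>!\<pi>. \<pi> \<in> extensional C' \<and> mor_U \<pi>"
    and to_H: "\<And>\<pi>. mor_U \<pi> \<Longrightarrow> mor_UH g \<Longrightarrow> mor_H (restrict (\<lambda>x. g (\<pi> x)) C')"
    and to_U: "\<And>\<psi>. mor_H \<psi> \<Longrightarrow> mor_HU f \<Longrightarrow> mor_U (restrict (\<lambda>x. f (\<psi> x)) C')"
    and closed: "\<And>\<psi> x. mor_H \<psi> \<Longrightarrow> x \<in> C' \<Longrightarrow> \<psi> x \<in> C"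
  shows "\<exists>!\<psi>. \<psi> \<in> extensional C' \<and> mor_H \<psi>"
proof -
  have "restrict (\<lambda>h. g (f h)) C = restrict (\<lambda>h. h) C"
    using unique_H id comp[OF f g] restrict_extensional by blast
  then have gf: "g (f h) = h" if "h \<in> C" for h
    using that by (metis restrict_apply')
  obtain \<pi> where \<pi>: "mor_U \<pi>" "\<And>\<pi>'. \<pi>' \<in> extensional C' \<Longrightarrow> mor_U \<pi>' \<Longrightarrow> \<pi>' = \<pi>"
    using unique_U by blast
  show ?thesis
  proof (rule ex1I[of _ "restrict (\<lambda>x. g (\<pi> x)) C'"])
    show "restrict (\<lambda>x. g (\<pi> x)) C' \<in> extensional C' \<and> mor_H (restrict (\<lambda>x. g (\<pi> x)) C')"
      using to_H[OF \<pi>(1) g] by simp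
    fix \<psi> assume \<psi>: "\<psi> \<in> extensional C' \<and> mor_H \<psi>"
    then have "restrict (\<lambda>x. f (\<psi> x)) C' = \<pi>"
      using \<pi>(2) to_U[OF _ f] by simp
    then have "f (\<psi> x) = \<pi> x" if "x \<in> C'" for x
      using that by (metis restrict_apply')
    then show "\<psi> = restrict (\<lambda>x. g (\<pi> x)) C'"
      using \<psi> gf closed by (intro extensionalityI[of _ C']) (auto, metis)
  qed
qed

definition action_morphism ::
    "('k::field, 'h::ab_group_add, 'm) hopf_scheme \<Rightarrow> ('h \<Rightarrow> 'a \<Rightarrow> 'a) \<Rightarrow>
      ('k, 'g::ab_group_add, 'n) hopf_scheme \<Rightarrow> ('g \<Rightarrow> 'a \<Rightarrow> 'a) \<Rightarrow> ('h \<Rightarrow> 'g) \<Rightarrow> bool"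
  where "action_morphism H act K act' \<psi> \<longleftrightarrow>
    hopf_morphism H K \<psi> \<and> (\<forall>h\<in>carrier H. \<forall>a. act h a = act' (\<psi> h) a)"

lemma action_morphism_id:
  "hopf_algebra H \<Longrightarrow> action_morphism H act H act (restrict (\<lambda>h. h) (carrier H))"
  using hopf_morphism_cong[OF _ hopf_morphism_id, of H "restrict (\<lambda>h. h) (carrier H)"]
  by (simp add: action_morphism_def)

lemma action_morphism_compose:
  assumes "hopf_algebra H" "hopf_algebra K" "hopf_algebra L"
    and "action_morphism H act\<^sub>H K act\<^sub>K \<psi>" "action_morphism K act\<^sub>K L act\<^sub>L \<chi>"
  shows "action_morphism H act\<^sub>H L act\<^sub>L (restrict (\<lambda>h. \<chi> (\<psi> h)) (carrier H))"
  using assms hopf_morphism_cong[OF assms(1) hopf_morphism_compose[OF assms(1-3)],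
      of \<psi> \<chi> "restrict (\<lambda>h. \<chi> (\<psi> h)) (carrier H)"] hopf_morphism.map_closed[of H K \<psi>]
  by (auto simp: action_morphism_def)

lemma universal_hopf_algebra_transport:
  fixes U H :: "('k::field, 'h::ab_group_add) hopf"
  assumes U: "universal_hopf_algebra TYPE('h) scale \<tau> A' U act\<^sub>U"
    and Ut: "universal_hopf_algebra TYPE('t::ab_group_add) scale \<tau> A' U act\<^sub>U"
    and H: "universal_hopf_algebra TYPE('h) scale \<tau> A' H act\<^sub>H"
  shows "universal_hopf_algebra TYPE('t) scale \<tau> A' H act\<^sub>H"
  unfolding universal_hopf_algebra_def action_morphism_def[symmetric]
proof (intro conjI allI impI)
  note universal = universal_hopf_algebra_def action_morphism_def[symmetric]
  have hopf: "hopf_algebra U" "hopf_algebra H" "hopf_action scale \<tau> A' U act\<^sub>U" "hopf_action scale \<tau> A' H act\<^sub>H"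
    using U H by (auto simp: universal_hopf_algebra_def)
  then show "hopf_algebra H" "hopf_action scale \<tau> A' H act\<^sub>H" by auto
  obtain f where f: "action_morphism H act\<^sub>H U act\<^sub>U f"
    using U hopf unfolding universal by blast
  obtain g where g: "action_morphism U act\<^sub>U H act\<^sub>H g"
    using H hopf unfolding universal by blast
  fix H' :: "('k, 't) hopf" and act' assume H': "hopf_algebra H' \<and> hopf_action scale \<tau> A' H' act'"
  show "\<exists>!\<psi>. \<psi> \<in> extensional (carrier H') \<and> action_morphism H' act' H act\<^sub>H \<psi>"
  proof (rule terminal_transport[where C = "carrier H" and f = f and g = g
        and mor_HU = "action_morphism H act\<^sub>H U act\<^sub>U" and mor_UH = "action_morphism U act\<^sub>U H act\<^sub>H"
        and mor_HH = "action_morphism H act\<^sub>H H act\<^sub>H" and mor_U = "action_morphism H' act' U act\<^sub>U"])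
    show "\<exists>!\<psi>. \<psi> \<in> extensional (carrier H) \<and> action_morphism H act\<^sub>H H act\<^sub>H \<psi>"
      using H hopf unfolding universal by blast
    show "action_morphism H act\<^sub>H H act\<^sub>H (restrict (\<lambda>h. h) (carrier H))"
      by (rule action_morphism_id[OF hopf(2)])
    show "\<exists>!\<pi>. \<pi> \<in> extensional (carrier H') \<and> action_morphism H' act' U act\<^sub>U \<pi>"
      using Ut H' unfolding universal by blast
    show "\<psi> x \<in> carrier H" if "action_morphism H' act' H act\<^sub>H \<psi>" "x \<in> carrier H'" for \<psi> x
      using that by (auto simp: action_morphism_def hopf_morphism.map_closed)
  qed (use f g hopf H' in \<open>blast intro: action_morphism_compose\<close>)+
qed

definition star_action_morphism ::
    "('h::ab_group_add, 'm) star_hopf_scheme \<Rightarrow> ('h \<Rightarrow> 'a \<Rightarrow> 'a) \<Rightarrow>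
      ('g::ab_group_add, 'n) star_hopf_scheme \<Rightarrow> ('g \<Rightarrow> 'a \<Rightarrow> 'a) \<Rightarrow> ('h \<Rightarrow> 'g) \<Rightarrow> bool"
  where "star_action_morphism H act K act' \<psi> \<longleftrightarrow>
    hopf_star_morphism H K \<psi> \<and> (\<forall>h\<in>carrier H. \<forall>a. act h a = act' (\<psi> h) a)"

lemma star_action_morphism_iff:
  "star_action_morphism H act K act' \<psi> \<longleftrightarrow>
    action_morphism H act K act' \<psi> \<and> (\<forall>h\<in>carrier H. \<psi> (invol H h) = invol K (\<psi> h))"
  by (auto simp: star_action_morphism_def action_morphism_def hopf_star_morphism_def
      hopf_star_morphism_axioms_def)

lemma star_action_morphism_compose:
  assumes "hopf_star_algebra H" "hopf_star_algebra K" "hopf_star_algebra L"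
    and "star_action_morphism H act\<^sub>H K act\<^sub>K \<psi>" "star_action_morphism K act\<^sub>K L act\<^sub>L \<chi>"
  shows "star_action_morphism H act\<^sub>H L act\<^sub>L (restrict (\<lambda>h. \<chi> (\<psi> h)) (carrier H))"
proof -
  have "hopf_algebra H" "hopf_algebra K" "hopf_algebra L"
    using assms by (auto simp: hopf_star_algebra_def)
  then have "action_morphism H act\<^sub>H L act\<^sub>L (restrict (\<lambda>h. \<chi> (\<psi> h)) (carrier H))"
    by (rule action_morphism_compose) (use assms in \<open>auto simp: star_action_morphism_iff\<close>)
  moreover have "\<psi> h \<in> carrier K" if "h \<in> carrier H" for h
    using assms that by (auto simp: star_action_morphism_iff action_morphism_def hopf_morphism.map_closed)
  ultimately show ?thesis
    using assms hopf_star_algebra.invol_closed[OF assms(1)] by (auto simp: star_action_morphism_iff)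
qed

lemma universal_hopf_star_algebra_transport:
  fixes U H :: "'h::ab_group_add star_hopf"
  assumes U: "universal_hopf_star_algebra TYPE('h) scale \<tau> A' star U act\<^sub>U"
    and Ut: "universal_hopf_star_algebra TYPE('t::ab_group_add) scale \<tau> A' star U act\<^sub>U"
    and H: "universal_hopf_star_algebra TYPE('h) scale \<tau> A' star H act\<^sub>H"
  shows "universal_hopf_star_algebra TYPE('t) scale \<tau> A' star H act\<^sub>H"
  unfolding universal_hopf_star_algebra_def star_action_morphism_def[symmetric]
proof (intro conjI allI impI)
  note universal = universal_hopf_star_algebra_def star_action_morphism_def[symmetric]
  have hopf: "hopf_star_algebra U" "hopf_star_algebra H" "hopf_star_action scale \<tau> A' star U act\<^sub>U" "hopf_star_action scale \<tau> A' star H act\<^sub>H"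
    using U H by (auto simp: universal_hopf_star_algebra_def)
  then show "hopf_star_algebra H" "hopf_star_action scale \<tau> A' star H act\<^sub>H" by auto
  obtain f where f: "star_action_morphism H act\<^sub>H U act\<^sub>U f"
    using U hopf unfolding universal by blast
  obtain g where g: "star_action_morphism U act\<^sub>U H act\<^sub>H g"
    using H hopf unfolding universal by blast
  fix H' :: "'t star_hopf" and act' assume H': "hopf_star_algebra H' \<and> hopf_star_action scale \<tau> A' star H' act'"
  show "\<exists>!\<psi>. \<psi> \<in> extensional (carrier H') \<and> star_action_morphism H' act' H act\<^sub>H \<psi>"
  proof (rule terminal_transport[where C = "carrier H" and f = f and g = g
        and mor_HU = "star_action_morphism H act\<^sub>H U act\<^sub>U" and mor_UH = "star_action_morphism U act\<^sub>U H act\<^sub>H"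
        and mor_HH = "star_action_morphism H act\<^sub>H H act\<^sub>H" and mor_U = "star_action_morphism H' act' U act\<^sub>U"])
    show "\<exists>!\<psi>. \<psi> \<in> extensional (carrier H) \<and> star_action_morphism H act\<^sub>H H act\<^sub>H \<psi>"
      using H hopf unfolding universal by blast
    show "star_action_morphism H act\<^sub>H H act\<^sub>H (restrict (\<lambda>h. h) (carrier H))"
      using action_morphism_id[OF hopf_star_algebra.axioms(1)[OF hopf(2)], of act\<^sub>H]
        hopf_star_algebra.invol_closed[OF hopf(2)]
      by (simp add: star_action_morphism_iff)
    show "\<exists>!\<pi>. \<pi> \<in> extensional (carrier H') \<and> star_action_morphism H' act' U act\<^sub>U \<pi>"
      using Ut H' unfolding universal by blast
    show "\<psi> x \<in> carrier H" if "star_action_morphism H' act' H act\<^sub>H \<psi>" "x \<in> carrier H'" for \<psi> x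
      using that by (auto simp: star_action_morphism_iff action_morphism_def hopf_morphism.map_closed)
  qed (use f g hopf H' in \<open>blast intro: star_action_morphism_compose\<close>)+
qed

section \<open>Algebras without involution\<close>

context hopf_algebra
begin

abbreviation antipode_power :: "nat \<Rightarrow> 'h \<Rightarrow> 'h"
  where "antipode_power n \<equiv> antipode H ^^ n"

lemma antipode_power_closed: "h \<in> carrier H \<Longrightarrow> antipode_power n h \<in> carrier H"
  by (induction n) auto

lemma antipode_power_linear:
  "linear_on (smul H) (carrier H) (smul H) (antipode_power n)"
  by (induction n)
    (auto intro!: linear_onI simp: antipode_power_closed antipode_add antipode_smul
      linear_onD[of "smul H" "carrier H" "smul H" "antipode_power _"])

lemma antipode_power_unity: "antipode_power n \<one> = \<one>"
  by (induction n) (auto simp: antipode_unity)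

lemma antipode_power_mul:
  "g \<in> carrier H \<Longrightarrow> h \<in> carrier H \<Longrightarrow> antipode_power n (g \<odot> h) =
    (if even n then antipode_power n g \<odot> antipode_power n h else antipode_power n h \<odot> antipode_power n g)"
  by (induction n) (auto simp: antipode_mul antipode_power_closed)

end

lemma hopf_morphism_antipode_power:
  assumes "hopf_algebra H" "hopf_morphism H K \<psi>" "h \<in> carrier H"
  shows "\<psi> ((antipode H ^^ n) h) = (antipode K ^^ n) (\<psi> h)"
  by (induction n)
    (auto simp: hopf_morphism.map_antipode[OF assms(2)] hopf_algebra.antipode_power_closed[OF assms(1,3)])

context measured_algebra
begin

lemma antipode_power_letter:
  "i \<in> I \<Longrightarrow> (coeff_antipode ^^ n) \<phi> [(i, a, b)] = \<phi> [(i + int n, a, b)]"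
proof (induction n arbitrary: i)
  case (Suc n)
  have "(coeff_antipode ^^ Suc n) \<phi> [(i, a, b)] = (coeff_antipode ^^ n) \<phi> [(i + 1, a, b)]"
    using Suc.prems by (simp add: coeff_antipode_def shift_letter_def)
  then show ?case using Suc.IH[OF succ_in_I[OF Suc.prems]] by (simp add: algebra_simps)
qed simp

theorem universal_hopf_algebra_coeffs:
  assumes I: "I = {0..}" and T: "T = {t. \<tau> = Some t}"
    and Fix: "Fix = insert 1 {a. \<exists>B. A' = Some B \<and> a \<in> B}"
  shows "universal_hopf_algebra TYPE('t::ab_group_add) scale \<tau> A' (universal_hopf ()) coeff_action"
  unfolding universal_hopf_algebra_def
proof (intro conjI allI impI hopf_algebra_universal hopf_action_universal)
  show "t \<in> T" if "\<tau> = Some t" for t using that by (simp add: T)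
  show "B \<subseteq> Fix" if "A' = Some B" for B using that by (auto simp: Fix)
  fix H' :: "('k, 't) hopf" and act'
  assume "hopf_algebra H' \<and> hopf_action scale \<tau> A' H' act'"
  then interpret H': hopf_algebra H' + act': hopf_action scale \<tau> A' H' act' by auto
  let ?\<sigma> = "\<lambda>i. antipode H' ^^ nat i"
  interpret acting_hopf_algebra scale I basis T Fix \<tau> A' H' act' ?\<sigma>
  proof unfold_locales
    fix i g h assume i: "i \<in> I" and g: "g \<in> carrier H'"
    show "?\<sigma> i g \<in> carrier H'" by (rule H'.antipode_power_closed[OF g])
    have "nat (i + 1) = Suc (nat i)" using i by (simp add: I)
    then show "?\<sigma> (i + 1) g = ?\<sigma> i (antipode H' g)" by (simp add: funpow_swap1)
    assume h: "h \<in> carrier H'"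
    show "?\<sigma> i (g \<odot>\<^bsub>H'\<^esub> h) = (if even i then ?\<sigma> i g \<odot>\<^bsub>H'\<^esub> ?\<sigma> i h else ?\<sigma> i h \<odot>\<^bsub>H'\<^esub> ?\<sigma> i g)"
      using i H'.antipode_power_mul[OF g h] by (simp add: I even_nat_iff)
  next
    show "linear_on (smul H') (carrier H') (smul H') (?\<sigma> i)" for i
      by (rule H'.antipode_power_linear)
    show "act' h a = scale (counit H' h) a" if "a \<in> Fix" "h \<in> carrier H'" for a h
      using that act'.act_one act'.act_subalgebra by (auto simp: Fix)
  qed (use act'.act_functional in \<open>auto simp: H'.antipode_power_unity T\<close>)
  show "\<exists>!\<psi>. \<psi> \<in> extensional (carrier H') \<and> hopf_morphism H' (universal_hopf ()) \<psi> \<and>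
      (\<forall>h\<in>carrier H'. \<forall>a. act' h a = coeff_action (\<psi> h) a)"
  proof (rule universal_map_ex1)
    show "hopf_morphism H' (universal_hopf ()) (restrict universal_map (carrier H'))"
      by (rule hopf_morphism_cong[OF H'.hopf_algebra_axioms hopf_morphism_universal_map]) simp
    fix \<psi> assume \<psi>: "hopf_morphism H' (universal_hopf ()) \<psi>"
    have "\<psi> h [(i, a, b)] = \<psi> (?\<sigma> i h) [(0, a, b)]" if "h \<in> carrier H'" "i \<in> I" for h i a b
    proof -
      have "0 \<le> i" using that(2) I by simp
      then show ?thesis
        using hopf_morphism_antipode_power[OF H'.hopf_algebra_axioms \<psi> that(1), of "nat i"]
          antipode_power_letter[OF zero_in_I, of "nat i" "\<psi> h" a b] by simp
    qed
    then show "\<psi> h = universal_map h"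
      if "\<forall>h\<in>carrier H'. \<forall>a. act' h a = coeff_action (\<psi> h) a" "h \<in> carrier H'" for h
      using universal_map_unique[OF \<psi> that(1) _ that(2)] by blast
  qed
qed

end

section \<open>Algebras with involution\<close>

lemma cnj_sum_list: "cnj (\<Sum>x\<leftarrow>L. f x) = (\<Sum>x\<leftarrow>L. cnj (f x))"
  by (induction L) simp_all

context hopf_star_algebra
begin

declare invol_closed [simp]

lemma invol_unity: "invol H \<one> = \<one>"
proof -
  have "invol H \<one> \<odot> y = y" if y: "y \<in> carrier H" for y
  proof -
    have "invol H \<one> \<odot> y = invol H (invol H y \<odot> \<one>)"
      using y by (simp add: invol_mul invol_invol)
    then show ?thesis using y by (simp add: mul_unity_right invol_invol)
  qed
  from this[OF unity_closed] show ?thesis by (simp add: mul_unity_right)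
qed

lemma invol_zero: "invol H 0 = 0"
  using invol_smul[of 0 0] by simp

lemma sweedler_invol:
  assumes "Vector_Spaces.vector_space s'" "bilinear s' B" "h \<in> carrier H"
  shows "sweedler B (invol H h) = sweedler (\<lambda>x y. B (invol H x) (invol H y)) h"
  using vector_space.tensor_eq_bilinear_words[OF assms(1,2) comul_invol[OF assms(3)]]
  by (simp add: sweedler_def o_def case_prod_unfold)

lemma counit_invol:
  assumes h: "h \<in> carrier H"
  shows "counit H (invol H h) = cnj (counit H h)"
proof -
  \<comment> \<open>\<open>e\<close> is another counit, and counits are unique\<close>
  define e where "e h = cnj (counit H (invol H h))" for h
  have e: "functional e"
    unfolding e_def by (rule linear_onI) (simp_all add: invol_add invol_smul counit_add counit_smul)
  have "e h = sweedler (\<lambda>x y. e x * counit H y) h"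
    using functional_hit[OF e functional_counit h] hit_counit[OF h] by simp
  also have "\<dots> = counit H (invol H (sweedler (\<lambda>x y. smul H (counit H x) y) (invol H h)))"
  proof -
    have anti: "counit H (invol H (\<Sum>z\<leftarrow>L. smul H (counit H (invol H (fst z))) (invol H (snd z)))) =
        (\<Sum>z\<leftarrow>L. e (fst z) * counit H (snd z))"
      "(\<Sum>z\<leftarrow>L. smul H (counit H (invol H (fst z))) (invol H (snd z))) \<in> carrier H"
      if "set L \<subseteq> carrier H \<times> carrier H" for L
      using that by (induction L)
        (auto simp: invol_zero counit_add invol_add invol_smul counit_smul invol_invol e_def
          linear_onD(2)[OF functional_counit, of 0 0, simplified])
    show ?thesis
      unfolding sweedler_invol[OF vector_space bilinear_contract_left[OF functional_counit] h]
      using anti[OF comul_closed[OF h]] by (simp add: sweedler_def case_prod_unfold)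
  qed
  also have "\<dots> = counit H h"
    using h by (simp add: sweedler_counit_left invol_invol)
  finally show ?thesis unfolding e_def by (metis complex_cnj_cnj)
qed

lemma antipode_invol_antipode:
  assumes "h \<in> carrier H"
  shows "antipode H (invol H (antipode H h)) = invol H h"
  using antipode_invol_involutive[OF assms] invol_invol[of "antipode H (invol H (antipode H h))"] assms
  by simp

text \<open>The inverse of the antipode is \<open>h \<mapsto> S(h\<^sup>*)\<^sup>*\<close>.\<close>
definition antipode_int_power :: "int \<Rightarrow> 'h \<Rightarrow> 'h"
  where "antipode_int_power i h =
    (if 0 \<le> i then antipode_power (nat i) h else invol H (antipode_power (nat (- i)) (invol H h)))"

lemma antipode_int_power_closed: "h \<in> carrier H \<Longrightarrow> antipode_int_power i h \<in> carrier H"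
  by (simp add: antipode_int_power_def antipode_power_closed)

lemma antipode_int_power_linear: "linear_on (smul H) (carrier H) (smul H) (antipode_int_power i)"
  by (rule linear_onI)
    (simp_all add: antipode_int_power_def linear_onD[OF antipode_power_linear] invol_add invol_smul
      antipode_power_closed)

lemma antipode_int_power_unity: "antipode_int_power i \<one> = \<one>"
  by (simp add: antipode_int_power_def antipode_power_unity invol_unity)

lemma antipode_int_power_mul:
  assumes "g \<in> carrier H" "h \<in> carrier H"
  shows "antipode_int_power i (g \<odot> h) = (if even i then antipode_int_power i g \<odot> antipode_int_power i h
    else antipode_int_power i h \<odot> antipode_int_power i g)"
  using assms
  by (auto simp: antipode_int_power_def antipode_power_mul antipode_power_closed invol_mul even_nat_iff)

lemma antipode_int_power_succ:
  assumes h: "h \<in> carrier H"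
  shows "antipode_int_power (i + 1) h = antipode_int_power i (antipode H h)"
proof (cases "0 \<le> i")
  case True
  then have "nat (i + 1) = Suc (nat i)" by simp
  then show ?thesis using True by (simp add: antipode_int_power_def funpow_swap1)
next
  case False
  then obtain n where i: "i = - int (Suc n)"
    by (metis int_cases linorder_not_le of_nat_0_le_iff)
  have "antipode_power (Suc n) (invol H (antipode H h)) = antipode_power n (invol H h)"
    by (simp add: funpow_swap1 antipode_invol_antipode h)
  moreover have "nat (- i) = Suc n" "\<not> 0 \<le> i" by (simp_all add: i)
  ultimately have "antipode_int_power i (antipode H h) = invol H (antipode_power n (invol H h))"
    by (simp add: antipode_int_power_def)
  also have "\<dots> = antipode_int_power (i + 1) h"
    by (cases n) (auto simp: i antipode_int_power_def invol_invol h nat_add_distrib)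
  finally show ?thesis ..
qed

text \<open>Starring exchanges \<open>S\<close> and its inverse.\<close>
lemma antipode_int_power_invol:
  assumes h: "h \<in> carrier H"
  shows "antipode_int_power i (invol H h) = invol H (antipode H (antipode_int_power (- i - 1) h))"
proof (cases "0 \<le> i")
  case True
  then obtain n where i: "i = int n" using nonneg_int_cases by blast
  have neg: "\<not> 0 \<le> - i - 1" "nat (- (- i - 1)) = Suc n" using i by auto
  have "antipode H (invol H (antipode H (antipode_power n (invol H h)))) = invol H (antipode_power n (invol H h))"
    by (rule antipode_invol_antipode) (simp add: antipode_power_closed h)
  then have "antipode H (antipode_int_power (- i - 1) h) = invol H (antipode_power n (invol H h))"
    unfolding antipode_int_power_def using neg by simp
  then show ?thesis
    by (simp add: antipode_int_power_def i invol_invol antipode_power_closed h)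
next
  case False
  then have pos: "0 \<le> - i - 1" "nat (- i) = Suc (nat (- i - 1))" by auto
  have "antipode_int_power i (invol H h) = invol H (antipode_power (nat (- i)) (invol H (invol H h)))"
    using False by (simp add: antipode_int_power_def)
  also have "\<dots> = invol H (antipode H (antipode_int_power (- i - 1) h))"
    unfolding pos(2) using pos(1) h by (simp add: antipode_int_power_def invol_invol)
  finally show ?thesis .
qed

end

lemma hopf_star_morphism_antipode_int_power:
  assumes "hopf_star_algebra H" "hopf_star_algebra K" "hopf_star_morphism H K \<psi>" "h \<in> carrier H"
  shows "\<psi> (hopf_star_algebra.antipode_int_power H i h) = hopf_star_algebra.antipode_int_power K i (\<psi> h)"
proof -
  interpret H: hopf_star_algebra H by fact
  interpret K: hopf_star_algebra K by fact
  interpret hopf_star_morphism H K \<psi> by fact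
  show ?thesis
    using assms(4) by (simp add: H.antipode_int_power_def K.antipode_int_power_def
        hopf_morphism_antipode_power[OF H.hopf_algebra_axioms hopf_morphism_axioms] map_invol
        H.antipode_power_closed)
qed

text \<open>
  An action of a Hopf \<open>*\<close>-algebra that preserves a functional \<open>t\<close> also preserves \<open>a \<mapsto> cnj (t (a\<^sup>*))\<close>; so
  \<open>T\<close> may be taken to be closed under this conjugation.  Coordinates with respect to a
  self-adjoint basis turn the involution into complex conjugation.
\<close>
locale star_measured_algebra = measured_algebra scale UNIV basis T Fix
  for scale :: "complex \<Rightarrow> 'a::{ring, monoid_mult} \<Rightarrow> 'a" and basis T Fix +
  fixes star :: "'a \<Rightarrow> 'a"
  assumes star_add: "star (a + b) = star a + star b"
    and star_scale: "star (scale c a) = scale (cnj c) (star a)"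
    and star_mult: "star (a * b) = star b * star a"
    and star_star: "star (star a) = a"
    and star_basis: "b \<in> basis \<Longrightarrow> star b = b"
    and T_star: "t \<in> T \<Longrightarrow> (\<lambda>a. cnj (t (star a))) \<in> T"
    and Fix_star: "a \<in> Fix \<Longrightarrow> star a \<in> Fix"
begin

lemma star_zero: "star 0 = 0"
  using star_scale[of 0 0] by simp

lemma star_sum: "star (\<Sum>x\<in>S. f x) = (\<Sum>x\<in>S. star (f x))"
  by (induction S rule: infinite_finite_induct) (simp_all add: star_zero star_add)

lemma coordinate_star: "coordinate b (star a) = cnj (coordinate b a)"
proof -
  have "star a = star (\<Sum>b | coordinate b a \<noteq> 0. scale (coordinate b a) b)"
    by (simp only: sum_coordinate)
  also have "\<dots> = (\<Sum>b | coordinate b a \<noteq> 0. scale (cnj (coordinate b a)) b)"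
    unfolding star_sum star_scale
    by (intro sum.cong refl) (simp add: star_basis representation_ne_zero coordinate_def)
  finally have eq: "(\<Sum>b | cnj (coordinate b a) \<noteq> 0. scale (cnj (coordinate b a)) b) = star a"
    by simp
  have "representation basis (star a) = (\<lambda>b. cnj (coordinate b a))"
  proof (rule representation_eqI[OF independent_basis in_span_basis])
    show "b \<in> basis" if "cnj (coordinate b a) \<noteq> 0" for b
      using that representation_ne_zero by (auto simp: coordinate_def)
    show "finite {b. cnj (coordinate b a) \<noteq> 0}" using finite_coordinate by simp
  qed (rule eq)
  then show ?thesis by (simp add: coordinate_def)
qed

text \<open>
  The system of the comatrix \<open>c\<^sub>p\<^sub>q\<^sup>*\<close>: the axiom \<open>(h \<cdot> a)\<^sup>* = S(h)\<^sup>* \<cdot> a\<^sup>*\<close> implies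
  \<open>S\<^bsup>i\<^esup>(h\<^sup>*) \<cdot> a = (S\<^bsup>-i-1\<^esup>(h) \<cdot> a\<^sup>*)\<^sup>*\<close>.
\<close>
definition star_system :: "(int \<Rightarrow> 'i \<Rightarrow> 'i \<Rightarrow> 'a \<Rightarrow> 'a) \<Rightarrow> int \<Rightarrow> 'i \<Rightarrow> 'i \<Rightarrow> 'a \<Rightarrow> 'a"
  where "star_system R i p q a = star (R (- i - 1) p q (star a))"

text \<open>
  The matrix \<open>R\<^sub>-\<^sub>1\<close> inverts \<open>R\<^sub>0\<close> after both have been transposed; multiplicativity is passed on by
  \<open>inverse_matrix_mult\<close> with the opposite multiplication.
\<close>
lemma coeff_system_star:
  assumes R: "coeff_system N R"
  shows "coeff_system N (star_system R)"
proof (rule coeff_systemI)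
  note D = coeff_systemD[OF R, simplified]
  have XY: "(\<Sum>r\<in>N. R 0 r q (R (- 1) p r a)) = (if p = q then a else 0)"
    "(\<Sum>r\<in>N. R (- 1) r q (R 0 p r a)) = (if p = q then a else 0)" if "p \<in> N" "q \<in> N" for p q a
    using D(6)[OF that, of "- 1" a] D(7)[OF that, of "- 1" a] by (simp_all add: twisted_comp_def)
  show "finite N" by (rule D(1))
  fix p q assume pq: "p \<in> N" "q \<in> N"
  show "operator (star_system R i p q)" for i
    by (rule linear_onI)
      (simp_all add: star_system_def star_add star_scale linear_onD[OF D(2)[OF pq]])
  have mult: "R (- 1) p q (b * a) = (\<Sum>r\<in>N. R (- 1) r q b * R (- 1) p r a)" for a b
    by (rule inverse_matrix_mult[where X = "\<lambda>p q. R 0 q p" and Y = "\<lambda>p q. R (- 1) q p"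
          and m = "\<lambda>a b. b * a" and N = N and p = q and q = p])
      (use D(1-3) XY pq in \<open>auto simp: sum_distrib_left sum_distrib_right\<close>)
  show "star_system R 0 p q (a * b) = (\<Sum>r\<in>N. star_system R 0 p r a * star_system R 0 r q b)" for a b
    by (simp add: star_system_def star_mult mult star_sum)
  show "t (star_system R 0 p q a) = (if p = q then t a else 0)" if t: "t \<in> T" for t a
  proof -
    define t' where "t' a = cnj (t (star a))" for a
    have t': "t' \<in> T" using T_star[OF t] by (simp add: t'_def[abs_def])
    have t0: "t' 0 = 0" using linear_onD(2)[OF linear_T[OF t'], of 0 0] by simp
    have "t' (R (- 1) p q x) = (\<Sum>r\<in>N. if r = q then t' (R (- 1) p r x) else 0)" for x
      using D(1) pq by simp
    also have "\<dots> x = (\<Sum>r\<in>N. t' (R 0 r q (R (- 1) p r x)))" for x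
      using D(4)[OF _ pq(2) t'] by (intro sum.cong refl) simp
    also have "\<dots> x = (if p = q then t' x else 0)" for x
      using XY(1)[OF pq] t0 by (simp add: T_sum[OF t', symmetric])
    finally have "t' (R (- 1) p q (star a)) = (if p = q then t' (star a) else 0)" .
    then show ?thesis
      by (auto simp: star_system_def t'_def star_star split: if_splits)
  qed
  show "star_system R 0 p q a = (if p = q then a else 0)" if a: "a \<in> Fix" for a
  proof -
    have "R (- 1) p q (star a) = (\<Sum>r\<in>N. if p = r then R (- 1) r q (star a) else 0)"
      using D(1) pq by simp
    also have "\<dots> = (\<Sum>r\<in>N. R (- 1) r q (R 0 p r (star a)))"
      using D(5)[OF pq(1) _ Fix_star[OF a]] operator_zero[OF D(2)[OF _ pq(2)]] by (intro sum.cong refl) simp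
    also have "\<dots> = (if p = q then star a else 0)" by (rule XY(2)[OF pq])
    finally show ?thesis by (auto simp: star_system_def star_zero star_star)
  qed
  fix i a
  have tc: "twisted_comp i (star_system R j p' r) (star_system R k p'' q') a =
      star (twisted_comp (- i - 2) (R (- j - 1) p' r) (R (- k - 1) p'' q') (star a))" for j k p' r p'' q'
    by (simp add: twisted_comp_def star_system_def star_star)
  have "- i - 1 = (- i - 2) + 1" "- (i + 1) - 1 = - i - 2" by auto
  note idx = this
  show "(\<Sum>r\<in>N. twisted_comp i (star_system R i p r) (star_system R (i + 1) r q) a) =
      (if p = q then a else 0)"
    using D(7)[OF pq, of "- i - 2" "star a"] unfolding tc idx star_sum[symmetric]
    by (simp add: star_zero star_star)
  show "(\<Sum>r\<in>N. twisted_comp i (star_system R (i + 1) p r) (star_system R i r q) a) =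
      (if p = q then a else 0)"
    using D(6)[OF pq, of "- i - 2" "star a"] unfolding tc idx star_sum[symmetric]
    by (simp add: star_zero star_star)
qed

definition star_letter :: "int \<times> 'a \<times> 'a \<Rightarrow> int \<times> 'a \<times> 'a"
  where "star_letter l = (- fst l - 1, star (fst (snd l)), snd (snd l))"

definition coeff_star :: "('a word \<Rightarrow> complex) \<Rightarrow> 'a word \<Rightarrow> complex"
  where "coeff_star \<phi> w = cnj (\<phi> (map star_letter w))"

lemma coeff_star_coeff: "coeff_star (coeff N R p q) = coeff N (star_system R) p q"
proof
  fix w
  show "coeff_star (coeff N R p q) w = coeff N (star_system R) p q w"
  proof (induction w arbitrary: p)
    case Nil
    then show ?case by (simp add: coeff_star_def)
  next
    case (Cons l w)
    obtain i a b where l: "l = (i, a, b)" by (cases l) auto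
    show ?case
      using Cons.IH by (simp add: coeff_star_def l star_letter_def star_system_def coordinate_star)
  qed
qed

lemma coeff_star_add: "coeff_star (\<phi> + \<psi>) = coeff_star \<phi> + coeff_star \<psi>"
  by (rule ext) (simp add: coeff_star_def plus_fun_apply)

lemma coeff_star_scale:
  "coeff_star (scale_fun c \<phi>) = scale_fun (cnj c) (coeff_star \<phi>)"
  by (rule ext) (simp add: coeff_star_def)

lemma coeff_star_closed: "\<phi> \<in> \<U> \<Longrightarrow> coeff_star \<phi> \<in> \<U>"
proof (induction \<phi> rule: coeff_space_induct)
  case (coeff N R p q)
  then show ?case
    using coeff_space.coeff[OF coeff_system_star[OF coeff(1)]]
    by (simp add: coeff_star_coeff)
qed (simp_all add: coeff_star_add coeff_star_scale coeff_space_add coeff_space.scale)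

lemma coeff_star_star: "coeff_star (coeff_star \<phi>) = \<phi>"
  by (rule ext) (simp add: coeff_star_def star_letter_def star_star o_def)

text \<open>
  The involution reverses products because \<open>i\<close> and \<open>-i-1\<close> have opposite parity.
\<close>
lemma star_system_tensor:
  "star_system (tensor_system R R') i (p, p') (q, q') = tensor_system (star_system R') (star_system R) i (p', p) (q', q)"
  by (auto simp: fun_eq_iff star_system_def tensor_system_def twisted_comp_def star_star)

lemma coeff_star_product:
  assumes "\<phi> \<in> \<U>" "\<psi> \<in> \<U>"
  shows "coeff_star (coeff_mul \<phi> \<psi>) =
    coeff_mul (coeff_star \<psi>) (coeff_star \<phi>)"
  using assms(1)
proof (induction \<phi> rule: coeff_space_induct)
  case R: (coeff N R p q)
  note R_space = coeff_space.coeff[OF R]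
  from assms(2) show ?case
  proof (induction \<psi> rule: coeff_space_induct)
    case (coeff M R' p' q')
    have f: "bij_betw prod.swap (M \<times> N) (N \<times> M)" by (rule bij_betwI[of _ _ _ prod.swap]) auto
    have "coeff_star (coeff_mul (coeff N R p q) (coeff M R' p' q')) =
        coeff (N \<times> M) (star_system (tensor_system R R')) (prod.swap (p', p)) (prod.swap (q', q))"
      using R coeff by (simp add: coeff_mul_coeff coeff_star_coeff)
    also have "\<dots> = coeff (M \<times> N) (tensor_system (star_system R') (star_system R)) (p', p) (q', q)"
      by (rule ext, rule coeff_reindex[OF f]) (use R coeff in \<open>auto simp: star_system_tensor\<close>)
    also have "\<dots> = coeff_mul (coeff_star (coeff M R' p' q')) (coeff_star (coeff N R p q))"
      using R coeff
      by (simp add: coeff_mul_coeff coeff_star_coeff coeff_system_star)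
    finally show ?case .
  qed (simp_all add: R_space coeff_mul_add_left coeff_mul_add_right coeff_star_add
      coeff_star_closed coeff_mul_scale_left coeff_mul_scale_right coeff_star_scale)
qed (use assms(2) in \<open>simp_all add: coeff_mul_add_left coeff_mul_add_right
    coeff_star_add coeff_star_closed coeff_mul_scale_left
    coeff_mul_scale_right coeff_star_scale\<close>)

definition universal_hopf_star :: "('a word \<Rightarrow> complex) star_hopf"
  where "universal_hopf_star = universal_hopf (star_hopf.fields coeff_star)"

lemma universal_hopf_star_simps [simp]:
  "carrier universal_hopf_star = \<U>" "smul universal_hopf_star = scale_fun"
  "mul universal_hopf_star = coeff_mul" "unity universal_hopf_star = unit_coeff"
  "comul universal_hopf_star = coeff_comul" "counit universal_hopf_star \<phi> = \<phi> []"
  "antipode universal_hopf_star = coeff_antipode" "invol universal_hopf_star = coeff_star"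
  by (simp_all add: universal_hopf_star_def) (simp add: universal_hopf_def star_hopf.defs)

lemma coeff_antipode_star_antipode_star:
  "coeff_star (coeff_antipode (coeff_star (coeff_antipode \<phi>))) = \<phi>"
  by (rule ext)
    (simp add: coeff_star_def coeff_antipode_def rev_map shift_letter_def star_letter_def
      star_star o_def)

lemma hopf_star_algebra_universal: "hopf_star_algebra universal_hopf_star"
proof (rule hopf_star_algebra.intro)
  show "hopf_algebra universal_hopf_star"
    unfolding universal_hopf_star_def by (rule hopf_algebra_universal)
  show "hopf_star_algebra_axioms universal_hopf_star"
  proof (rule hopf_star_algebra_axioms.intro, unfold universal_hopf_star_simps)
    fix h assume h: "h \<in> \<U>"
    show "tensor_eq scale_fun \<U> [[x, y]. (x, y) \<leftarrow> coeff_comul (coeff_star h)]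
        [[coeff_star x, coeff_star y]. (x, y) \<leftarrow> coeff_comul h]"
    proof (rule tensor_eq_functions2)
      show "(\<Sum>w\<leftarrow>[[x, y]. (x, y) \<leftarrow> coeff_comul (coeff_star h)]. word_eval [\<lambda>\<phi>. \<phi> u, \<lambda>\<phi>. \<phi> v] w) =
        (\<Sum>w\<leftarrow>[[coeff_star x, coeff_star y]. (x, y) \<leftarrow> coeff_comul h].
          word_eval [\<lambda>\<phi>. \<phi> u, \<lambda>\<phi>. \<phi> v] w)" for u v
        using comul_eval[OF coeff_star_closed[OF h], of u v]
          comul_eval[OF h, of "map star_letter u" "map star_letter v"]
        by (simp add: o_def case_prod_unfold coeff_star_def flip: cnj_sum_list complex_cnj_mult)
    qed (auto dest!: comul_closed[OF h] comul_closed[OF coeff_star_closed[OF h]]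
        intro: coeff_star_closed)
  qed (simp_all add: coeff_star_closed coeff_star_add coeff_star_scale
      coeff_star_product coeff_star_star coeff_antipode_star_antipode_star)
qed

lemma hopf_star_action_universal:
  assumes "\<And>t. \<tau> = Some t \<Longrightarrow> t \<in> T" "\<And>B. A' = Some B \<Longrightarrow> B \<subseteq> Fix"
  shows "hopf_star_action scale \<tau> A' star universal_hopf_star coeff_action"
proof (rule hopf_star_action.intro)
  show "hopf_action scale \<tau> A' universal_hopf_star coeff_action"
    unfolding universal_hopf_star_def by (rule hopf_action_universal[OF assms])
  show "hopf_star_action_axioms star universal_hopf_star coeff_action"
  proof (rule hopf_star_action_axioms.intro, unfold universal_hopf_star_simps, rule coordinate_eqI)
    fix h a b assume h: "h \<in> \<U>"
    show "coordinate b (star (coeff_action h a)) =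
        coordinate b (coeff_action (coeff_star (coeff_antipode h)) (star a))"
      using h by (simp add: coordinate_star coordinate_action coeff_star_closed
          coeff_antipode_closed)
        (simp add: coeff_star_def coeff_antipode_def star_letter_def shift_letter_def star_star)
  qed
qed

lemma antipode_int_power_letter:
  "hopf_star_algebra.antipode_int_power universal_hopf_star i \<phi> [(0, a, b)] = \<phi> [(i, a, b)]"
proof -
  interpret U: hopf_star_algebra universal_hopf_star by (rule hopf_star_algebra_universal)
  show ?thesis
    by (simp add: U.antipode_int_power_def antipode_power_letter)
      (simp add: coeff_star_def star_letter_def star_star antipode_power_letter)
qed

text \<open>
  What is left to see beyond the universal property without involutions is that the action preserves the
  conjugate functional, and that the universal map preserves the involution.
\<close>
theorem universal_hopf_star_algebra_coeffs:
  assumes T: "T = {t. \<tau> = Some t} \<union> {\<lambda>a. cnj (t (star a)) | t. \<tau> = Some t}"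
    and Fix: "Fix = insert 1 {a. \<exists>B. A' = Some B \<and> a \<in> B}"
  shows "universal_hopf_star_algebra TYPE('t::ab_group_add) scale \<tau> A' star universal_hopf_star coeff_action"
  unfolding universal_hopf_star_algebra_def
proof (intro conjI allI impI hopf_star_algebra_universal hopf_star_action_universal)
  show "t \<in> T" if "\<tau> = Some t" for t using that by (simp add: T)
  show "B \<subseteq> Fix" if "A' = Some B" for B using that by (auto simp: Fix)
  fix H' :: "'t star_hopf" and act'
  assume "hopf_star_algebra H' \<and> hopf_star_action scale \<tau> A' star H' act'"
  then interpret H': hopf_star_algebra H' + act': hopf_star_action scale \<tau> A' star H' act' by auto
  interpret acting_hopf_algebra scale UNIV basis T Fix \<tau> A' H' act' H'.antipode_int_power
  proof unfold_locales
    show "act' h a = scale (counit H' h) a" if "a \<in> Fix" "h \<in> carrier H'" for a h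
      using that act'.act_one act'.act_subalgebra by (auto simp: Fix)
    show "t (act' h a) = counit H' h * t a" if t: "t \<in> T" and h: "h \<in> carrier H'" for t h a
    proof -
      have "cnj (t (star (act' h a))) = counit H' h * cnj (t (star a))" if "\<tau> = Some t" for t
        using h act'.act_functional[OF that, of "invol H' (antipode H' h)"]
        by (simp add: act'.act_star H'.counit_invol H'.counit_antipode)
      then show ?thesis using t act'.act_functional[OF _ h] by (auto simp: T)
    qed
  qed (simp_all add: H'.antipode_int_power_closed H'.antipode_int_power_linear H'.antipode_int_power_unity
      H'.antipode_int_power_mul H'.antipode_int_power_succ, simp add: H'.antipode_int_power_def)
  have letter_invol: "letter_value l (invol H' h) = cnj (letter_value (star_letter l) h)"
    if "h \<in> carrier H'" for l h
  proof -
    obtain i a b where l: "l = (i, a, b)" by (cases l) auto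
    have "star (act' (H'.antipode_int_power (- i - 1) h) (star a)) = act' (H'.antipode_int_power i (invol H' h)) a"
      using that by (simp add: act'.act_star H'.antipode_int_power_closed H'.antipode_int_power_invol star_star)
    then show ?thesis
      by (simp add: l star_letter_def flip: coordinate_star)
  qed
  have word_invol: "word_value w (invol H' h) = cnj (word_value (map star_letter w) h)"
    if "h \<in> carrier H'" for w h
    using that
  proof (induction w arbitrary: h)
    case Nil
    then show ?case by (simp add: H'.counit_invol)
  next
    case (Cons l w)
    have "word_value (l # w) (invol H' h) =
        H'.sweedler (\<lambda>x y. letter_value l (invol H' x) * word_value w (invol H' y)) h"
      using H'.sweedler_invol[OF vector_space_field
          bilinear_on_product[OF functional_letter_value functional_word_value] Cons.prems]
      by simp
    also have "\<dots> = H'.sweedler (\<lambda>x y. cnj (letter_value (star_letter l) x * word_value (map star_letter w) y)) h"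
      by (rule H'.sweedler_cong[OF Cons.prems]) (simp add: letter_invol Cons.IH)
    also have "\<dots> = cnj (word_value (map star_letter (l # w)) h)"
      by (simp add: H'.sweedler_def case_prod_unfold cnj_sum_list)
    finally show ?case .
  qed
  have map_invol: "universal_map (invol H' h) = coeff_star (universal_map h)" if "h \<in> carrier H'" for h
    by (rule ext) (simp add: universal_map_def coeff_star_def word_invol that)
  show "\<exists>!\<psi>. \<psi> \<in> extensional (carrier H') \<and> hopf_star_morphism H' universal_hopf_star \<psi> \<and>
      (\<forall>h\<in>carrier H'. \<forall>a. act' h a = coeff_action (\<psi> h) a)"
  proof (rule universal_map_ex1)
    have "hopf_morphism H' universal_hopf_star (restrict universal_map (carrier H'))"
      unfolding universal_hopf_star_def
      by (rule hopf_morphism_cong[OF H'.hopf_algebra_axioms hopf_morphism_universal_map]) simp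
    then show "hopf_star_morphism H' universal_hopf_star (restrict universal_map (carrier H'))"
      by (simp add: hopf_star_morphism_def hopf_star_morphism_axioms_def map_invol)
    fix \<psi> assume \<psi>: "hopf_star_morphism H' universal_hopf_star \<psi>"
    then have \<psi>': "hopf_morphism H' universal_hopf_star \<psi>" by (simp add: hopf_star_morphism_def)
    have "\<psi> h [(i, a, b)] = \<psi> (H'.antipode_int_power i h) [(0, a, b)]" if "h \<in> carrier H'" for h i a b
      using hopf_star_morphism_antipode_int_power[OF H'.hopf_star_algebra_axioms
          hopf_star_algebra_universal \<psi> that]
      by (simp add: antipode_int_power_letter)
    then show "\<psi> h = universal_map h"
      if "\<forall>h\<in>carrier H'. \<forall>a. act' h a = coeff_action (\<psi> h) a" "h \<in> carrier H'" for h
      using universal_map_unique[OF \<psi>'[unfolded universal_hopf_star_def] that(1) _ that(2)] by blast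
  qed
qed

end

section \<open>The universal Hopf algebras\<close>

lemma universal_hopf_algebra_exists:
  fixes scale :: "'k::field \<Rightarrow> 'a::{ring, monoid_mult} \<Rightarrow> 'a"
  assumes "algebra_structure scale \<tau> A'"
  obtains H :: "('k, ('a, 'k) hopf_space) hopf" and act
  where "universal_hopf_algebra TYPE(('a, 'k) hopf_space) scale \<tau> A' H act"
    and "universal_hopf_algebra TYPE('t::ab_group_add) scale \<tau> A' H act"
proof -
  interpret algebra_structure scale \<tau> A' by fact
  obtain B where B: "B \<subseteq> UNIV" "independent B" "UNIV \<subseteq> span B"
    by (rule maximal_independent_subset)
  define T where "T = {t. \<tau> = Some t}"
  define Fix where "Fix = insert 1 {a. \<exists>B. A' = Some B \<and> a \<in> B}"
  interpret measured_algebra scale "{0..}" B T Fix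
  proof unfold_locales
    show "linear_on scale UNIV (*) t" if "t \<in> T" for t
    proof -
      interpret t: Vector_Spaces.linear scale "(*)" t using functional_linear that by (simp add: T_def)
      show ?thesis by (rule linear_onI) (simp_all add: t.add t.scale)
    qed
  qed (use B in \<open>auto simp: Fix_def\<close>)
  note universal = universal_hopf_algebra_coeffs[OF refl T_def Fix_def]
  show ?thesis by (rule that) (rule universal)+
qed

lemma universal_hopf_star_algebra_exists:
  fixes scale :: "complex \<Rightarrow> 'a::{ring, monoid_mult} \<Rightarrow> 'a"
  assumes "star_algebra_structure scale \<tau> A' star"
  obtains H :: "('a, complex) hopf_space star_hopf" and act
  where "universal_hopf_star_algebra TYPE(('a, complex) hopf_space) scale \<tau> A' star H act"
    and "universal_hopf_star_algebra TYPE('t::ab_group_add) scale \<tau> A' star H act"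
proof -
  interpret star_algebra_structure scale \<tau> A' star by fact
  obtain B where B: "B \<subseteq> {a. star a = a}" "independent B" "{a. star a = a} \<subseteq> span B"
    by (rule maximal_independent_subset[of "{a. star a = a}"])
  have span_B: "a \<in> span B" for a
  proof -
    have star_minus: "star (- a) = - star a" for a
      using star_scale[of "- 1" a] by simp
    \<comment> \<open>\<open>a = (x - \<i> y) / 2\<close> with \<open>x\<close> and \<open>y\<close> self-adjoint\<close>
    let ?x = "a + star a" and ?y = "scale \<i> (a - star a)"
    have "star ?x = ?x" by (simp add: star_add star_star add.commute)
    moreover have "star (a - star a) = star a - a"
      using star_add[of a "- star a"] by (simp add: star_minus star_star)
    then have "star ?y = scale (- \<i>) (star a - a)" by (simp only: star_scale complex_cnj_i)
    then have "star ?y = ?y" by (simp add: scale_right_diff_distrib)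
    ultimately have "?x \<in> span B" "?y \<in> span B" using B(3) by auto
    then have "scale (1/2) (?x + scale (- \<i>) ?y) \<in> span B"
      by (rule span_scale[OF span_add[OF _ span_scale]])
    also have "?x + scale (- \<i>) ?y = a + a" by simp
    also have "scale (1/2) (a + a) = a"
      by (simp add: scale_right_distrib flip: scale_left_distrib)
    finally show ?thesis .
  qed
  define T where "T = {t. \<tau> = Some t} \<union> {\<lambda>a. cnj (t (star a)) | t. \<tau> = Some t}"
  define Fix where "Fix = insert 1 {a. \<exists>B. A' = Some B \<and> a \<in> B}"
  have star_one: "star 1 = 1"
    using star_mult[of "star 1" 1] by (simp add: star_star)
  interpret star_measured_algebra scale B T Fix star
  proof unfold_locales
    have lin: "linear_on scale UNIV (*) t" if "\<tau> = Some t" for t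
    proof -
      interpret t: Vector_Spaces.linear scale "(*)" t using functional_linear that by simp
      show ?thesis by (rule linear_onI) (simp_all add: t.add t.scale)
    qed
    show "linear_on scale UNIV (*) t" if "t \<in> T" for t
      using that lin
      by (auto simp: T_def star_add star_scale linear_onD[OF lin] intro!: linear_onI)
    show "(\<lambda>a. cnj (t (star a))) \<in> T" if "t \<in> T" for t
      using that by (auto simp: T_def star_star)
    show "star a \<in> Fix" if "a \<in> Fix" for a
      using that subalgebra_star by (auto simp: Fix_def star_one)
  qed (use B span_B in \<open>auto simp: Fix_def star_add star_scale star_mult star_star\<close>)
  note universal = universal_hopf_star_algebra_coeffs[OF T_def Fix_def]
  show ?thesis by (rule that) (rule universal)+
qed

theorem theorem2p2p15:
  fixes scale :: "'k::field \<Rightarrow> 'a::{ring, monoid_mult} \<Rightarrow> 'a"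
    and \<tau> :: "('a \<Rightarrow> 'k) option" and A' :: "'a set option"
    and cscale :: "complex \<Rightarrow> 'b::{ring, monoid_mult} \<Rightarrow> 'b"
    and \<sigma> :: "('b \<Rightarrow> complex) option" and B' :: "'b set option" and star :: "'b \<Rightarrow> 'b"
  shows
    "(algebra_structure scale \<tau> A' \<longrightarrow>
        (\<exists>(H :: ('k, ('a, 'k) hopf_space) hopf) act.
            universal_hopf_algebra TYPE(('a, 'k) hopf_space) scale \<tau> A' H act) \<and>
        (\<forall>(H :: ('k, ('a, 'k) hopf_space) hopf) act.
            universal_hopf_algebra TYPE(('a, 'k) hopf_space) scale \<tau> A' H act \<longrightarrow>
            universal_hopf_algebra TYPE('t::ab_group_add) scale \<tau> A' H act)) \<and>
     (star_algebra_structure cscale \<sigma> B' star \<longrightarrow>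
        (\<exists>(H :: ('b, complex) hopf_space star_hopf) act.
            universal_hopf_star_algebra TYPE(('b, complex) hopf_space) cscale \<sigma> B' star H act) \<and>
        (\<forall>(H :: ('b, complex) hopf_space star_hopf) act.
            universal_hopf_star_algebra TYPE(('b, complex) hopf_space) cscale \<sigma> B' star H act \<longrightarrow>
            universal_hopf_star_algebra TYPE('u::ab_group_add) cscale \<sigma> B' star H act))"
proof (intro conjI impI allI)
  assume "algebra_structure scale \<tau> A'"
  then obtain U :: "('k, ('a, 'k) hopf_space) hopf" and act\<^sub>U where
    U: "universal_hopf_algebra TYPE(('a, 'k) hopf_space) scale \<tau> A' U act\<^sub>U"
      "universal_hopf_algebra TYPE('t) scale \<tau> A' U act\<^sub>U"
    by (rule universal_hopf_algebra_exists)
  show "\<exists>(H :: ('k, ('a, 'k) hopf_space) hopf) act.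
      universal_hopf_algebra TYPE(('a, 'k) hopf_space) scale \<tau> A' H act"
    using U(1) by blast
  show "universal_hopf_algebra TYPE('t) scale \<tau> A' H act"
    if "universal_hopf_algebra TYPE(('a, 'k) hopf_space) scale \<tau> A' H act"
    for H :: "('k, ('a, 'k) hopf_space) hopf" and act
    by (rule universal_hopf_algebra_transport[OF U that])
next
  assume "star_algebra_structure cscale \<sigma> B' star"
  then obtain U :: "('b, complex) hopf_space star_hopf" and act\<^sub>U where
    U: "universal_hopf_star_algebra TYPE(('b, complex) hopf_space) cscale \<sigma> B' star U act\<^sub>U"
      "universal_hopf_star_algebra TYPE('u) cscale \<sigma> B' star U act\<^sub>U"
    by (rule universal_hopf_star_algebra_exists)
  show "\<exists>(H :: ('b, complex) hopf_space star_hopf) act.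
      universal_hopf_star_algebra TYPE(('b, complex) hopf_space) cscale \<sigma> B' star H act"
    using U(1) by blast
  show "universal_hopf_star_algebra TYPE('u) cscale \<sigma> B' star H act"
    if "universal_hopf_star_algebra TYPE(('b, complex) hopf_space) cscale \<sigma> B' star H act"
    for H :: "('b, complex) hopf_space star_hopf" and act
    by (rule universal_hopf_star_algebra_transport[OF U that])
qed

end
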